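(* Let $R$ be a (unital) semilocal ring and let $P,Q$ be two countably generated projective right $R$-modules. The following are equivalent: (i) $P\precsim Q$; (ii) $\dim(P)\le\dim(Q)$ (componentwise); (iii) $P$ is isomorphic to a pure submodule of $Q$.
   Context: A unital ring $R$ with Jacobson radical $J(R)$ is semilocal if $R/J(R)$ is semisimple, i.e. $R/J(R)\cong M_{n_1}(D_1)\times\cdots\times M_{n_r}(D_r)$ for division rings $D_1,\dots,D_r$. $P\precsim Q$ means: for every finitely generated submodule $X\subseteq P$ there are module homomorphisms $\phi\colon X\to Q$ and $\psi\colon Q\to P$ such that $\psi\circ\phi$ is the inclusion $X\hookrightarrow P$. Let $\overline{\mathbb{N}}=\mathbb{N}\cup\{\infty\}$. Let $S_1,\dots,S_r$ be representatives of the isomorphism classes of simple right $R/J(R)$-modules. For a countably generated projective module $P$, $P/PJ(R)\cong S_1^{(x_1)}\oplus\cdots\oplus S_r^{(x_r)}$ for unique $x_i\in\overline{\mathbb{N}}$ (with $\infty$ meaning countably infinitely many copies), and $\dim(P)=(x_1,\dots,x_r)\in\overline{\mathbb{N}}^r$. *)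

theory Defs
  imports "HOL-Algebra.Algebra" "HOL-Library.Extended_Nat" "HOL-Library.Countable_Set"
begin

section \<open>Right modules\<close>

text \<open>
  HOL-Algebra's module locale requires a commutative ring. For right modules over an arbitrary
  ring we keep its record and its submodule locale (which does not use commutativity), but read
  \<open>a \<odot>\<^bsub>M\<^esub> x\<close> as the right action \<open>x \<cdot> a\<close>; this is visible only in the associativity law.
  As usual for the module record, the fields \<open>mult\<close> and \<open>one\<close> of a module carry no information.
\<close>

locale right_module = R?: ring R + M?: abelian_group M
  for R :: "('a, 'k) ring_scheme" (structure) and M :: "('a, 'b, 'm) module_scheme" (structure) +
  assumes smult_closed:
      "\<lbrakk>a \<in> carrier R; x \<in> carrier M\<rbrakk> \<Longrightarrow> a \<odot>\<^bsub>M\<^esub> x \<in> carrier M"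
    and smult_l_distr:
      "\<lbrakk>a \<in> carrier R; b \<in> carrier R; x \<in> carrier M\<rbrakk> \<Longrightarrow>
        (a \<oplus> b) \<odot>\<^bsub>M\<^esub> x = a \<odot>\<^bsub>M\<^esub> x \<oplus>\<^bsub>M\<^esub> b \<odot>\<^bsub>M\<^esub> x"
    and smult_r_distr:
      "\<lbrakk>a \<in> carrier R; x \<in> carrier M; y \<in> carrier M\<rbrakk> \<Longrightarrow>
        a \<odot>\<^bsub>M\<^esub> (x \<oplus>\<^bsub>M\<^esub> y) = a \<odot>\<^bsub>M\<^esub> x \<oplus>\<^bsub>M\<^esub> a \<odot>\<^bsub>M\<^esub> y"
    and smult_assoc:
      "\<lbrakk>a \<in> carrier R; b \<in> carrier R; x \<in> carrier M\<rbrakk> \<Longrightarrow>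
        (a \<otimes> b) \<odot>\<^bsub>M\<^esub> x = b \<odot>\<^bsub>M\<^esub> (a \<odot>\<^bsub>M\<^esub> x)"
    and smult_one:
      "x \<in> carrier M \<Longrightarrow> \<one> \<odot>\<^bsub>M\<^esub> x = x"

definition rmod_hom ::
  "('a, 'k) ring_scheme \<Rightarrow> ('a, 'b, 'm) module_scheme \<Rightarrow> ('a, 'c, 'n) module_scheme \<Rightarrow> ('b \<Rightarrow> 'c) set"
  where "rmod_hom R M N =
    {h \<in> carrier M \<rightarrow> carrier N.
       (\<forall>x\<in>carrier M. \<forall>y\<in>carrier M. h (x \<oplus>\<^bsub>M\<^esub> y) = h x \<oplus>\<^bsub>N\<^esub> h y) \<and>
       (\<forall>a\<in>carrier R. \<forall>x\<in>carrier M. h (a \<odot>\<^bsub>M\<^esub> x) = a \<odot>\<^bsub>N\<^esub> h x)}"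

definition rmod_iso ::
  "('a, 'k) ring_scheme \<Rightarrow> ('a, 'b, 'm) module_scheme \<Rightarrow> ('a, 'c, 'n) module_scheme \<Rightarrow> bool"
  where "rmod_iso R M N \<longleftrightarrow> (\<exists>h \<in> rmod_hom R M N. bij_betw h (carrier M) (carrier N))"

definition rmod_span ::
  "('a, 'k) ring_scheme \<Rightarrow> ('a, 'b, 'm) module_scheme \<Rightarrow> 'b set \<Rightarrow> 'b set"
  where "rmod_span R M Y = \<Inter> {N. submodule N R M \<and> Y \<subseteq> N}"

definition countably_generated ::
  "('a, 'k) ring_scheme \<Rightarrow> ('a, 'b, 'm) module_scheme \<Rightarrow> bool"
  where "countably_generated R M \<longleftrightarrow>
    (\<exists>Y. countable Y \<and> Y \<subseteq> carrier M \<and> rmod_span R M Y = carrier M)"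

definition fg_submodule ::
  "('a, 'k) ring_scheme \<Rightarrow> ('a, 'b, 'm) module_scheme \<Rightarrow> 'b set \<Rightarrow> bool"
  where "fg_submodule R M N \<longleftrightarrow>
    submodule N R M \<and> (\<exists>Y. finite Y \<and> Y \<subseteq> carrier M \<and> rmod_span R M Y = N)"

text \<open>
  The lifting property. A definition can only quantify over modules carried by fixed types; the
  ones below suffice, because they include \<open>C = P\<close> together with the free module on the set
  \<open>carrier P\<close> (finitely supported functions) as \<open>B\<close>. A splitting of the canonical surjection
  from \<open>B\<close> to \<open>C\<close> gives the lifting property against arbitrary modules.
\<close>

definition projective_rmodule :: "('a, 'k) ring_scheme \<Rightarrow> ('a, 'b, 'm) module_scheme \<Rightarrow> bool"
  where "projective_rmodule R P \<longleftrightarrow> right_module R P \<and>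
    (\<forall>(B :: ('a, 'b \<Rightarrow> 'a) module) (C :: ('a, 'b) module). \<forall>f g.
       right_module R B \<longrightarrow> right_module R C \<longrightarrow>
       g \<in> rmod_hom R B C \<longrightarrow> g ` carrier B = carrier C \<longrightarrow> f \<in> rmod_hom R P C \<longrightarrow>
       (\<exists>h \<in> rmod_hom R P B. \<forall>x\<in>carrier P. g (h x) = f x))"

text \<open>
  Purity in the sense of Cohn: every finite system of linear equations
  \<open>(\<Sum>j<n. x j \<cdot> a j i) = b i\<close>, \<open>i < m\<close>, with constants \<open>b i\<close> in \<open>N\<close> that is solvable in \<open>M\<close> is
  solvable in \<open>N\<close>.
\<close>

definition pure_submodule ::
  "('a, 'k) ring_scheme \<Rightarrow> ('a, 'b, 'm) module_scheme \<Rightarrow> 'b set \<Rightarrow> bool"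
  where "pure_submodule R M N \<longleftrightarrow> submodule N R M \<and>
    (\<forall>(m::nat) (n::nat) a b.
       (\<forall>j<n. \<forall>i<m. a j i \<in> carrier R) \<longrightarrow> (\<forall>i<m. b i \<in> N) \<longrightarrow>
       (\<exists>x. (\<forall>j<n. x j \<in> carrier M) \<and> (\<forall>i<m. (\<Oplus>\<^bsub>M\<^esub>j\<in>{..<n}. a j i \<odot>\<^bsub>M\<^esub> x j) = b i)) \<longrightarrow>
       (\<exists>y. (\<forall>j<n. y j \<in> N) \<and> (\<forall>i<m. (\<Oplus>\<^bsub>M\<^esub>j\<in>{..<n}. a j i \<odot>\<^bsub>M\<^esub> y j) = b i)))"

definition precsim_rmodule ::
  "('a, 'k) ring_scheme \<Rightarrow> ('a, 'b, 'm) module_scheme \<Rightarrow> ('a, 'c, 'n) module_scheme \<Rightarrow> bool"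
  where "precsim_rmodule R P Q \<longleftrightarrow>
    (\<forall>Y. fg_submodule R P Y \<longrightarrow>
       (\<exists>\<phi> \<in> rmod_hom R (P\<lparr>carrier := Y\<rparr>) Q. \<exists>\<psi> \<in> rmod_hom R Q P. \<forall>x\<in>Y. \<psi> (\<phi> x) = x))"

definition simple_rmodule :: "('a, 'k) ring_scheme \<Rightarrow> ('a, 'b, 'm) module_scheme \<Rightarrow> bool"
  where "simple_rmodule R M \<longleftrightarrow> right_module R M \<and> carrier M \<noteq> {\<zero>\<^bsub>M\<^esub>} \<and>
    (\<forall>N. submodule N R M \<longrightarrow> N = {\<zero>\<^bsub>M\<^esub>} \<or> N = carrier M)"

definition direct_sum_rmodule :: "'i set \<Rightarrow> ('i \<Rightarrow> ('a, 'b) module) \<Rightarrow> ('a, 'i \<Rightarrow> 'b) module"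
  where "direct_sum_rmodule I M =
    \<lparr>carrier = {f \<in> (\<Pi>\<^sub>E i\<in>I. carrier (M i)). finite {i \<in> I. f i \<noteq> \<zero>\<^bsub>M i\<^esub>}},
     monoid.mult = undefined, one = undefined,
     ring.zero = (\<lambda>i\<in>I. \<zero>\<^bsub>M i\<^esub>),
     ring.add = (\<lambda>f g. \<lambda>i\<in>I. f i \<oplus>\<^bsub>M i\<^esub> g i),
     module.smult = (\<lambda>a f. \<lambda>i\<in>I. a \<odot>\<^bsub>M i\<^esub> f i)\<rparr>"


section \<open>The Jacobson radical and semilocal rings\<close>

definition regular_rmodule :: "('a, 'k) ring_scheme \<Rightarrow> ('a, 'a) module"
  where "regular_rmodule R =
    \<lparr>carrier = carrier R, monoid.mult = monoid.mult R, one = \<one>\<^bsub>R\<^esub>,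
     ring.zero = \<zero>\<^bsub>R\<^esub>, ring.add = ring.add R,
     module.smult = (\<lambda>a x. x \<otimes>\<^bsub>R\<^esub> a)\<rparr>"

definition maximal_right_ideal :: "('a, 'k) ring_scheme \<Rightarrow> 'a set \<Rightarrow> bool"
  where "maximal_right_ideal R I \<longleftrightarrow>
    submodule I R (regular_rmodule R) \<and> I \<noteq> carrier R \<and>
    (\<forall>K. submodule K R (regular_rmodule R) \<longrightarrow> I \<subseteq> K \<longrightarrow> K = I \<or> K = carrier R)"

text \<open>Intersecting with \<open>carrier R\<close> matters only for the zero ring, which has no maximal right ideal.\<close>

definition jacobson_radical :: "('a, 'k) ring_scheme \<Rightarrow> 'a set"
  where "jacobson_radical R = carrier R \<inter> \<Inter> {I. maximal_right_ideal R I}"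

text \<open>Matrices are functions of two indices, normalised to \<open>undefined\<close> outside the index range.\<close>

definition matrix_ring :: "nat \<Rightarrow> ('d, 'k) ring_scheme \<Rightarrow> (nat \<times> nat \<Rightarrow> 'd) ring"
  where "matrix_ring n D =
    \<lparr>carrier = ({..<n} \<times> {..<n}) \<rightarrow>\<^sub>E carrier D,
     monoid.mult = (\<lambda>A B. \<lambda>(i, j)\<in>{..<n} \<times> {..<n}. \<Oplus>\<^bsub>D\<^esub>k\<in>{..<n}. A (i, k) \<otimes>\<^bsub>D\<^esub> B (k, j)),
     one = (\<lambda>(i, j)\<in>{..<n} \<times> {..<n}. if i = j then \<one>\<^bsub>D\<^esub> else \<zero>\<^bsub>D\<^esub>),
     ring.zero = (\<lambda>(i, j)\<in>{..<n} \<times> {..<n}. \<zero>\<^bsub>D\<^esub>),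
     ring.add = (\<lambda>A B. \<lambda>(i, j)\<in>{..<n} \<times> {..<n}. A (i, j) \<oplus>\<^bsub>D\<^esub> B (i, j))\<rparr>"

definition skew_field :: "('d, 'k) ring_scheme \<Rightarrow> bool"
  where "skew_field D \<longleftrightarrow> ring D \<and> Units D = carrier D - {\<zero>\<^bsub>D\<^esub>}"

text \<open>
  The entry type of the matrices may be taken to be the type of the elements of the given ring:
  if \<open>A\<close> is isomorphic to a product of matrix rings over division rings, then each of these
  division rings is isomorphic to a corner ring \<open>e A e\<close>. The empty product is the zero ring.
\<close>

definition semisimple_ring :: "('a, 'k) ring_scheme \<Rightarrow> bool"
  where "semisimple_ring A \<longleftrightarrow> ring A \<and>
    (\<exists>nDs :: (nat \<times> 'a ring) list.
       (\<forall>(n, D) \<in> set nDs. n \<ge> 1 \<and> skew_field D) \<and>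
       A \<simeq> RDirProd_list (map (\<lambda>(n, D). matrix_ring n D) nDs))"

definition semilocal_ring :: "('a, 'k) ring_scheme \<Rightarrow> bool"
  where "semilocal_ring R \<longleftrightarrow> ring R \<and> semisimple_ring (R Quot jacobson_radical R)"


section \<open>The dimension of a countably generated projective module\<close>

definition rmod_ideal_mult ::
  "('a, 'k) ring_scheme \<Rightarrow> ('a, 'b, 'm) module_scheme \<Rightarrow> 'a set \<Rightarrow> 'b set"
  where "rmod_ideal_mult R M I = rmod_span R M {a \<odot>\<^bsub>M\<^esub> x | a x. a \<in> I \<and> x \<in> carrier M}"

text \<open>The quotient \<open>M / M I\<close> as a right module over \<open>R Quot I\<close>.\<close>

definition quot_rmodule ::
  "('a, 'k) ring_scheme \<Rightarrow> ('a, 'b, 'm) module_scheme \<Rightarrow> 'a set \<Rightarrow> ('a set, 'b set) module"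
  where "quot_rmodule R M I =
    \<lparr>carrier = a_rcosets\<^bsub>M\<^esub> (rmod_ideal_mult R M I),
     monoid.mult = undefined, one = undefined,
     ring.zero = rmod_ideal_mult R M I,
     ring.add = set_add M,
     module.smult = (\<lambda>A Y. \<Union>a\<in>A. \<Union>x\<in>Y. rmod_ideal_mult R M I +>\<^bsub>M\<^esub> (a \<odot>\<^bsub>M\<^esub> x))\<rparr>"

text \<open>
  \<open>S 0, \<dots>, S (r - 1)\<close> represent the isomorphism classes of simple right modules over \<open>A\<close>.
  It suffices to test completeness on modules carried by sets of elements of \<open>A\<close>, since every
  simple module is isomorphic to a quotient of the regular module.
\<close>

definition simple_representatives ::
  "('a, 'k) ring_scheme \<Rightarrow> nat \<Rightarrow> (nat \<Rightarrow> ('a, 's) module) \<Rightarrow> bool"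
  where "simple_representatives A r S \<longleftrightarrow>
    (\<forall>i<r. simple_rmodule A (S i)) \<and>
    (\<forall>i<r. \<forall>j<r. rmod_iso A (S i) (S j) \<longrightarrow> i = j) \<and>
    (\<forall>M :: ('a, 'a set) module. simple_rmodule A M \<longrightarrow> (\<exists>i<r. rmod_iso A M (S i)))"

text \<open>
  The direct sum over \<open>i < r\<close> of \<open>x i\<close> copies of \<open>S i\<close>. The copies of \<open>S i\<close> are indexed by the natural numbers \<open>k\<close> with
  \<open>k < x i\<close>, i.e. by all of them if \<open>x i = \<infinity>\<close>.
\<close>

definition simple_sum ::
  "nat \<Rightarrow> (nat \<Rightarrow> ('a, 's) module) \<Rightarrow> (nat \<Rightarrow> enat) \<Rightarrow> ('a, nat \<times> nat \<Rightarrow> 's) module"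
  where "simple_sum r S x =
    direct_sum_rmodule {(i, k). i < r \<and> enat k < x i} (\<lambda>(i, k). S i)"

text \<open>Dimension vectors are functions on \<open>nat\<close>, padded by \<open>0\<close> from \<open>r\<close> on to make them unique.\<close>

definition rmod_dim ::
  "('a, 'k) ring_scheme \<Rightarrow> nat \<Rightarrow> (nat \<Rightarrow> ('a set, 's) module) \<Rightarrow> ('a, 'b, 'm) module_scheme
     \<Rightarrow> nat \<Rightarrow> enat"
  where "rmod_dim R r S P = (THE x.
    (\<forall>i\<ge>r. x i = 0) \<and>
    rmod_iso (R Quot jacobson_radical R) (quot_rmodule R P (jacobson_radical R)) (simple_sum r S x))"

end

theory Submission
  imports Defs
begin

text \<open>
  A homomorphism \<open>f: P \<rightarrow> Q\<close> that splits on every finite subset of \<open>P\<close>, i.e. such that each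
  finite \<open>Z \<subseteq> P\<close> admits \<open>\<psi>: Q \<rightarrow> P\<close> with \<open>\<psi> f = id\<close> on \<open>Z\<close>, witnesses (i) and is a pure
  monomorphism. If \<open>dim P \<le> dim Q\<close>, then \<open>P/PJ\<close> is a direct summand of \<open>Q/QJ\<close>; lifting the
  inclusion and the projection gives \<open>f\<close> and \<open>g\<close> with \<open>g f = 1 + d\<close> and \<open>d(P) \<subseteq> PJ\<close>. Let \<open>e\<close> be the
  partial sum \<open>\<Sum> k \<lambda>\<^sub>k\<close> of a dual basis \<open>(k, \<lambda>\<^sub>k)\<close> of \<open>P\<close> over finitely many \<open>k\<close>, with \<open>e = id\<close> on \<open>Z\<close>.
  Then \<open>e g f = 1 + e d\<close> on \<open>Z\<close>, and \<open>1 + e d\<close> is a perturbation of the identity by finitely many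
  rank one maps with coefficients in \<open>J\<close>, hence left invertible: one rank one term at a time, this
  is the invertibility of \<open>1 + j\<close> for \<open>j \<in> J\<close>. Conversely, purity of \<open>N \<subseteq> Q\<close>, applied to the
  coordinates of finitely many elements of \<open>N\<close> in a dual basis of \<open>Q\<close>, yields an endomorphism of \<open>Q\<close>
  with image in \<open>N\<close> that fixes them. Finally, (i) turns \<open>n\<close> independent copies of a simple module in
  \<open>P/PJ\<close> into \<open>n\<close> independent copies in \<open>Q/QJ\<close>.
\<close>

section \<open>Right modules and homomorphisms\<close>

text \<open>The obstacle is that \<open>P\<close> need not be finitely generated, so an endomorphism
  of \<open>P\<close> that is the identity modulo the radical need not even be left invertible. Over
  the integers localised at a prime p, the map e_i |-> e_i - p e_(i+1) on a free module with
  countable basis is the identity modulo p, yet its cokernel is the field of rationals, so its image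
  is not a direct summand. Hence a lifted map need not split, and left inverses are sought on finite
  sets only. In (i) the obstacle is that \<phi> lives on a submodule Y, and YJ may be smaller than
  the intersection of Y with PJ. So only \<psi> is reduced modulo J, and sums of simple modules are
  compared through homomorphisms whose image contains a prescribed finite set. The same comparison,
  applied to two isomorphisms, gives the uniqueness that the definite description in
  \<open>rmod_dim\<close> requires. Its existence part rests on writing the identity of R/J as a
  finite sum of generators of minimal right ideals.\<close>

lemma right_module_regular: "ring R \<Longrightarrow> right_module R (regular_rmodule R)"
proof -
  assume "ring R"
  then interpret ring R .
  have "abelian_group (regular_rmodule R)"
  proof (rule abelian_groupI)
    show "\<exists>y\<in>carrier (regular_rmodule R). y \<oplus>\<^bsub>regular_rmodule R\<^esub> x = \<zero>\<^bsub>regular_rmodule R\<^esub>"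
      if "x \<in> carrier (regular_rmodule R)" for x
      using that by (intro bexI[of _ "\<ominus>\<^bsub>R\<^esub> x"]) (auto simp: regular_rmodule_def l_neg)
  qed (simp_all add: regular_rmodule_def a_ac)
  then show ?thesis
    by (intro right_module.intro right_module_axioms.intro)
      (auto simp: regular_rmodule_def l_distr r_distr m_assoc ring_axioms)
qed

lemma regular_simps [simp]:
  "carrier (regular_rmodule R) = carrier R" "\<zero>\<^bsub>regular_rmodule R\<^esub> = \<zero>\<^bsub>R\<^esub>"
  "x \<oplus>\<^bsub>regular_rmodule R\<^esub> y = x \<oplus>\<^bsub>R\<^esub> y" "a \<odot>\<^bsub>regular_rmodule R\<^esub> x = x \<otimes>\<^bsub>R\<^esub> a"
  by (simp_all add: regular_rmodule_def)

lemma submodule_subset: "submodule N R M \<Longrightarrow> N \<subseteq> carrier M"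
  using subgroup.subset[of N "add_monoid M"] by (simp add: submodule_def)

lemma submodule_zero: "submodule N R M \<Longrightarrow> \<zero>\<^bsub>M\<^esub> \<in> N"
  using subgroup.one_closed[of N "add_monoid M"] by (simp add: submodule_def)

lemma submodule_add: "submodule N R M \<Longrightarrow> x \<in> N \<Longrightarrow> y \<in> N \<Longrightarrow> x \<oplus>\<^bsub>M\<^esub> y \<in> N"
  using subgroup.m_closed[of N "add_monoid M" x y] by (simp add: submodule_def)

lemma submodule_smult: "submodule N R M \<Longrightarrow> a \<in> carrier R \<Longrightarrow> x \<in> N \<Longrightarrow> a \<odot>\<^bsub>M\<^esub> x \<in> N"
  by (rule submodule.smult_closed)

lemma submodule_neg: "submodule N R M \<Longrightarrow> x \<in> N \<Longrightarrow> \<ominus>\<^bsub>M\<^esub> x \<in> N"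
  using subgroup.m_inv_closed[of N "add_monoid M" x] by (simp add: submodule_def a_inv_def)

lemmas submodule_facts = submodule_subset submodule_zero submodule_add submodule_smult

context right_module
begin

lemma smult_zero_left: "x \<in> carrier M \<Longrightarrow> \<zero> \<odot>\<^bsub>M\<^esub> x = \<zero>\<^bsub>M\<^esub>"
  using smult_l_distr[of \<zero> \<zero> x] smult_closed[of \<zero> x]
  by (metis M.add.r_cancel_one' R.l_zero R.zero_closed)

lemma smult_zero_right: "a \<in> carrier R \<Longrightarrow> a \<odot>\<^bsub>M\<^esub> \<zero>\<^bsub>M\<^esub> = \<zero>\<^bsub>M\<^esub>"
  using smult_r_distr[of a "\<zero>\<^bsub>M\<^esub>" "\<zero>\<^bsub>M\<^esub>"] smult_closed[of a "\<zero>\<^bsub>M\<^esub>"]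
  by (metis M.add.r_cancel_one' M.l_zero M.zero_closed)

lemma smult_minus_left: "a \<in> carrier R \<Longrightarrow> x \<in> carrier M \<Longrightarrow> (\<ominus> a) \<odot>\<^bsub>M\<^esub> x = \<ominus>\<^bsub>M\<^esub> (a \<odot>\<^bsub>M\<^esub> x)"
  using smult_l_distr[of "\<ominus> a" a x] smult_zero_left[of x]
  by (simp add: R.l_neg M.minus_equality smult_closed)

lemma smult_minus_right: "a \<in> carrier R \<Longrightarrow> x \<in> carrier M \<Longrightarrow> a \<odot>\<^bsub>M\<^esub> (\<ominus>\<^bsub>M\<^esub> x) = \<ominus>\<^bsub>M\<^esub> (a \<odot>\<^bsub>M\<^esub> x)"
  using smult_r_distr[of a "\<ominus>\<^bsub>M\<^esub> x" x] smult_zero_right[of a]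
  by (simp add: M.l_neg M.minus_equality smult_closed)

lemma smult_finsum:
  assumes "finite K" "f \<in> K \<rightarrow> carrier M" "a \<in> carrier R"
  shows "a \<odot>\<^bsub>M\<^esub> (\<Oplus>\<^bsub>M\<^esub>k\<in>K. f k) = (\<Oplus>\<^bsub>M\<^esub>k\<in>K. a \<odot>\<^bsub>M\<^esub> f k)"
  using assms(1,2)
proof (induct K)
  case empty
  then show ?case using assms(3) by (simp add: smult_zero_right)
next
  case (insert k K)
  then show ?case
    using assms(3) by (simp add: smult_r_distr smult_closed Pi_def)
qed

text \<open>Negatives come from the action of \<open>\<ominus> \<one>\<close>, which reduces the
  subgroup axioms to sums and scalar multiples.\<close>

lemma submoduleI':
  assumes "N \<subseteq> carrier M" "\<zero>\<^bsub>M\<^esub> \<in> N"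
    and "\<And>x y. x \<in> N \<Longrightarrow> y \<in> N \<Longrightarrow> x \<oplus>\<^bsub>M\<^esub> y \<in> N"
    and "\<And>a x. a \<in> carrier R \<Longrightarrow> x \<in> N \<Longrightarrow> a \<odot>\<^bsub>M\<^esub> x \<in> N"
  shows "submodule N R M"
proof -
  have "\<ominus>\<^bsub>M\<^esub> x \<in> N" if "x \<in> N" for x
    using assms(4)[of "\<ominus> \<one>" x] that assms(1) by (auto simp: smult_minus_left smult_one subset_iff)
  then show ?thesis
    using assms by (intro submodule.intro submodule_axioms.intro subgroup.intro) (auto simp: a_inv_def)
qed

lemma submodule_carrier: "submodule (carrier M) R M"
  by (rule submoduleI') (auto simp: smult_closed)

lemma submodule_finsum:
  assumes "submodule N R M" "finite K" "\<And>k. k \<in> K \<Longrightarrow> f k \<in> N"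
  shows "(\<Oplus>\<^bsub>M\<^esub>k\<in>K. f k) \<in> N"
  using assms(2,3)
proof (induct K)
  case empty
  then show ?case using submodule_zero[OF assms(1)] by simp
next
  case (insert k K)
  have "f k \<in> carrier M" "f \<in> K \<rightarrow> carrier M"
    using insert submodule_subset[OF assms(1)] by auto
  then show ?case
    using insert submodule_add[OF assms(1)] by simp
qed

lemma submodule_Inter:
  assumes "\<And>N. N \<in> \<N> \<Longrightarrow> submodule N R M" "\<N> \<noteq> {}"
  shows "submodule (\<Inter>\<N>) R M"
  by (rule submoduleI')
    (use assms in \<open>auto intro: submodule_zero submodule_add submodule_smult dest: submodule_subset\<close>)

lemma submodule_span: "Y \<subseteq> carrier M \<Longrightarrow> submodule (rmod_span R M Y) R M"
  unfolding rmod_span_def using submodule_carrier by (intro submodule_Inter) auto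

lemma span_superset: "Y \<subseteq> rmod_span R M Y"
  by (auto simp: rmod_span_def)

lemma span_least: "submodule N R M \<Longrightarrow> Y \<subseteq> N \<Longrightarrow> rmod_span R M Y \<subseteq> N"
  by (auto simp: rmod_span_def)

lemma submodule_cyclic: "x \<in> carrier M \<Longrightarrow> submodule ((\<lambda>a. a \<odot>\<^bsub>M\<^esub> x) ` carrier R) R M"
proof (rule submoduleI')
  assume x: "x \<in> carrier M"
  then show "\<zero>\<^bsub>M\<^esub> \<in> (\<lambda>a. a \<odot>\<^bsub>M\<^esub> x) ` carrier R"
    by (intro image_eqI[of _ _ \<zero>]) (auto simp: smult_zero_left)
  show "y \<oplus>\<^bsub>M\<^esub> z \<in> (\<lambda>a. a \<odot>\<^bsub>M\<^esub> x) ` carrier R"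
    if "y \<in> (\<lambda>a. a \<odot>\<^bsub>M\<^esub> x) ` carrier R" "z \<in> (\<lambda>a. a \<odot>\<^bsub>M\<^esub> x) ` carrier R" for y z
    using that x by (auto simp: smult_l_distr[symmetric])
  show "a \<odot>\<^bsub>M\<^esub> y \<in> (\<lambda>a. a \<odot>\<^bsub>M\<^esub> x) ` carrier R"
    if "a \<in> carrier R" "y \<in> (\<lambda>a. a \<odot>\<^bsub>M\<^esub> x) ` carrier R" for a y
    using that x by (auto simp: smult_assoc[symmetric])
qed (auto simp: smult_closed)

end

section \<open>Homomorphisms and the pointwise operations on them\<close>

lemma rmod_hom_closed: "h \<in> rmod_hom R M N \<Longrightarrow> x \<in> carrier M \<Longrightarrow> h x \<in> carrier N"
  by (auto simp: rmod_hom_def)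

lemma rmod_hom_add:
  "h \<in> rmod_hom R M N \<Longrightarrow> x \<in> carrier M \<Longrightarrow> y \<in> carrier M \<Longrightarrow> h (x \<oplus>\<^bsub>M\<^esub> y) = h x \<oplus>\<^bsub>N\<^esub> h y"
  by (auto simp: rmod_hom_def)

lemma rmod_hom_smult:
  "h \<in> rmod_hom R M N \<Longrightarrow> a \<in> carrier R \<Longrightarrow> x \<in> carrier M \<Longrightarrow> h (a \<odot>\<^bsub>M\<^esub> x) = a \<odot>\<^bsub>N\<^esub> h x"
  by (auto simp: rmod_hom_def)

lemma rmod_homI:
  assumes "\<And>x. x \<in> carrier M \<Longrightarrow> h x \<in> carrier N"
    and "\<And>x y. x \<in> carrier M \<Longrightarrow> y \<in> carrier M \<Longrightarrow> h (x \<oplus>\<^bsub>M\<^esub> y) = h x \<oplus>\<^bsub>N\<^esub> h y"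
    and "\<And>a x. a \<in> carrier R \<Longrightarrow> x \<in> carrier M \<Longrightarrow> h (a \<odot>\<^bsub>M\<^esub> x) = a \<odot>\<^bsub>N\<^esub> h x"
  shows "h \<in> rmod_hom R M N"
  using assms by (auto simp: rmod_hom_def)

lemma rmod_hom_comp:
  "g \<in> rmod_hom R N L \<Longrightarrow> f \<in> rmod_hom R M N \<Longrightarrow> (\<lambda>x. g (f x)) \<in> rmod_hom R M L"
  by (auto simp: rmod_hom_def Pi_def)

lemma rmod_hom_id: "(\<lambda>x. x) \<in> rmod_hom R M M"
  by (auto simp: rmod_hom_def)

lemma rmod_hom_zero:
  assumes "right_module R M" "right_module R N" "h \<in> rmod_hom R M N"
  shows "h \<zero>\<^bsub>M\<^esub> = \<zero>\<^bsub>N\<^esub>"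
proof -
  interpret M: right_module R M by fact
  interpret N: right_module R N by fact
  show ?thesis
    using rmod_hom_smult[OF assms(3), of "\<zero>\<^bsub>R\<^esub>" "\<zero>\<^bsub>M\<^esub>"] rmod_hom_closed[OF assms(3), of "\<zero>\<^bsub>M\<^esub>"]
    by (simp add: M.smult_zero_left N.smult_zero_left)
qed

lemma rmod_hom_neg:
  assumes "right_module R M" "right_module R N" "h \<in> rmod_hom R M N" "x \<in> carrier M"
  shows "h (\<ominus>\<^bsub>M\<^esub> x) = \<ominus>\<^bsub>N\<^esub> h x"
proof -
  interpret M: right_module R M by fact
  interpret N: right_module R N by fact
  show ?thesis
    using rmod_hom_smult[OF assms(3), of "\<ominus>\<^bsub>R\<^esub> \<one>\<^bsub>R\<^esub>" x] rmod_hom_closed[OF assms(3), of x] assms(4)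
    by (simp add: M.smult_minus_left N.smult_minus_left M.smult_one N.smult_one)
qed

lemma rmod_hom_minus:
  assumes "right_module R M" "right_module R N" "h \<in> rmod_hom R M N" "x \<in> carrier M" "y \<in> carrier M"
  shows "h (x \<ominus>\<^bsub>M\<^esub> y) = h x \<ominus>\<^bsub>N\<^esub> h y"
proof -
  interpret M: right_module R M by fact
  show ?thesis
    using assms by (simp add: a_minus_def rmod_hom_add rmod_hom_neg)
qed

lemma rmod_hom_finsum:
  assumes "right_module R M" "right_module R N" "h \<in> rmod_hom R M N" "finite K" "f \<in> K \<rightarrow> carrier M"
  shows "h (\<Oplus>\<^bsub>M\<^esub>k\<in>K. f k) = (\<Oplus>\<^bsub>N\<^esub>k\<in>K. h (f k))"
proof -
  interpret M: right_module R M by fact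
  interpret N: right_module R N by fact
  show ?thesis
    using assms(4,5)
  proof (induct K)
    case empty
    then show ?case using rmod_hom_zero[OF assms(1-3)] by simp
  next
    case (insert k K)
    then show ?case
      using rmod_hom_closed[OF assms(3)] by (simp add: rmod_hom_add[OF assms(3)] Pi_def)
  qed
qed

lemma submodule_vimage:
  assumes "right_module R M" "right_module R N" "h \<in> rmod_hom R M N" "submodule L R N"
  shows "submodule {x \<in> carrier M. h x \<in> L} R M"
proof -
  interpret M: right_module R M by fact
  show ?thesis
    using submodule_facts[OF assms(4)] rmod_hom_zero[OF assms(1-3)]
    by (intro M.submoduleI') (auto simp: M.smult_closed rmod_hom_add[OF assms(3)] rmod_hom_smult[OF assms(3)])
qed

lemma submodule_image:
  assumes "right_module R M" "right_module R N" "h \<in> rmod_hom R M N" "submodule L R M"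
  shows "submodule (h ` L) R N"
proof -
  interpret M: right_module R M by fact
  interpret N: right_module R N by fact
  note L = submodule_facts[OF assms(4)]
  show ?thesis
  proof (rule N.submoduleI')
    show "h ` L \<subseteq> carrier N" using L(1) rmod_hom_closed[OF assms(3)] by auto
    show "\<zero>\<^bsub>N\<^esub> \<in> h ` L" using L(2) rmod_hom_zero[OF assms(1-3)] by (metis image_eqI)
    show "x \<oplus>\<^bsub>N\<^esub> y \<in> h ` L" if "x \<in> h ` L" "y \<in> h ` L" for x y
    proof -
      from that obtain u v where "u \<in> L" "v \<in> L" "x = h u" "y = h v" by auto
      then show ?thesis
        using L(1,3) rmod_hom_add[OF assms(3), of u v] by (intro image_eqI[of _ _ "u \<oplus>\<^bsub>M\<^esub> v"]) (auto simp: subset_iff)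
    qed
    show "a \<odot>\<^bsub>N\<^esub> x \<in> h ` L" if "a \<in> carrier R" "x \<in> h ` L" for a x
    proof -
      from that obtain u where "u \<in> L" "x = h u" by auto
      then show ?thesis
        using L that rmod_hom_smult[OF assms(3), of a u] by (intro image_eqI[of _ _ "a \<odot>\<^bsub>M\<^esub> u"]) (auto simp: subset_iff)
    qed
  qed
qed

lemma submodule_equalizer:
  assumes "right_module R M" "right_module R N" "f \<in> rmod_hom R M N" "g \<in> rmod_hom R M N"
  shows "submodule {x \<in> carrier M. f x = g x} R M"
proof -
  interpret M: right_module R M by fact
  show ?thesis
    using rmod_hom_zero[OF assms(1-3)] rmod_hom_zero[OF assms(1,2,4)]
    by (intro M.submoduleI')
      (auto simp: M.smult_closed rmod_hom_add[OF assms(3)] rmod_hom_smult[OF assms(3)]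
        rmod_hom_add[OF assms(4)] rmod_hom_smult[OF assms(4)])
qed

lemma rmod_hom_pointwise_add:
  assumes "right_module R N" "f \<in> rmod_hom R M N" "g \<in> rmod_hom R M N"
  shows "(\<lambda>x. f x \<oplus>\<^bsub>N\<^esub> g x) \<in> rmod_hom R M N"
proof -
  interpret N: right_module R N by fact
  note f = rmod_hom_closed[OF assms(2)] rmod_hom_add[OF assms(2)] rmod_hom_smult[OF assms(2)]
  note g = rmod_hom_closed[OF assms(3)] rmod_hom_add[OF assms(3)] rmod_hom_smult[OF assms(3)]
  show ?thesis
    by (rule rmod_homI) (auto simp: f g N.smult_r_distr N.M.a_ac)
qed

lemma rmod_hom_pointwise_neg:
  assumes "right_module R N" "f \<in> rmod_hom R M N"
  shows "(\<lambda>x. \<ominus>\<^bsub>N\<^esub> f x) \<in> rmod_hom R M N"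
proof -
  interpret N: right_module R N by fact
  note f = rmod_hom_closed[OF assms(2)] rmod_hom_add[OF assms(2)] rmod_hom_smult[OF assms(2)]
  show ?thesis
    by (rule rmod_homI) (auto simp: f N.smult_minus_right N.M.minus_add N.M.a_comm)
qed

lemma rmod_hom_pointwise_minus:
  assumes "right_module R N" "f \<in> rmod_hom R M N" "g \<in> rmod_hom R M N"
  shows "(\<lambda>x. f x \<ominus>\<^bsub>N\<^esub> g x) \<in> rmod_hom R M N"
  unfolding a_minus_def
  by (intro rmod_hom_pointwise_add rmod_hom_pointwise_neg assms)

lemma rmod_hom_pointwise_zero:
  assumes "right_module R N"
  shows "(\<lambda>x. \<zero>\<^bsub>N\<^esub>) \<in> rmod_hom R M N"
proof -
  interpret N: right_module R N by fact
  show ?thesis by (rule rmod_homI) (auto simp: N.smult_zero_right)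
qed

lemma rmod_hom_pointwise_finsum:
  assumes "right_module R N" "finite K" "\<And>k. k \<in> K \<Longrightarrow> f k \<in> rmod_hom R M N"
  shows "(\<lambda>x. \<Oplus>\<^bsub>N\<^esub>k\<in>K. f k x) \<in> rmod_hom R M N"
proof -
  interpret N: right_module R N by fact
  have c: "f k x \<in> carrier N" if "k \<in> K" "x \<in> carrier M" for k x
    using rmod_hom_closed[OF assms(3)] that by auto
  show ?thesis
  proof (rule rmod_homI)
    fix x y assume xy: "x \<in> carrier M" "y \<in> carrier M"
    have "(\<Oplus>\<^bsub>N\<^esub>k\<in>K. f k (x \<oplus>\<^bsub>M\<^esub> y)) = (\<Oplus>\<^bsub>N\<^esub>k\<in>K. f k x \<oplus>\<^bsub>N\<^esub> f k y)"
      using c xy by (intro N.M.finsum_cong') (auto simp: rmod_hom_add[OF assms(3)])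
    then show "(\<Oplus>\<^bsub>N\<^esub>k\<in>K. f k (x \<oplus>\<^bsub>M\<^esub> y)) = (\<Oplus>\<^bsub>N\<^esub>k\<in>K. f k x) \<oplus>\<^bsub>N\<^esub> (\<Oplus>\<^bsub>N\<^esub>k\<in>K. f k y)"
      using c xy by (simp add: N.M.finsum_addf Pi_def)
  next
    fix a x assume ax: "a \<in> carrier R" "x \<in> carrier M"
    have "(\<Oplus>\<^bsub>N\<^esub>k\<in>K. f k (a \<odot>\<^bsub>M\<^esub> x)) = (\<Oplus>\<^bsub>N\<^esub>k\<in>K. a \<odot>\<^bsub>N\<^esub> f k x)"
      using c ax by (intro N.M.finsum_cong') (auto simp: rmod_hom_smult[OF assms(3)] N.smult_closed)
    then show "(\<Oplus>\<^bsub>N\<^esub>k\<in>K. f k (a \<odot>\<^bsub>M\<^esub> x)) = a \<odot>\<^bsub>N\<^esub> (\<Oplus>\<^bsub>N\<^esub>k\<in>K. f k x)"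
      using c ax assms(2) by (simp add: N.smult_finsum Pi_def)
  qed (use c in \<open>auto intro: N.M.finsum_closed\<close>)
qed

lemma rmod_hom_inv_into:
  assumes "right_module R M" "h \<in> rmod_hom R M N" "bij_betw h (carrier M) (carrier N)"
  shows "inv_into (carrier M) h \<in> rmod_hom R N M"
proof -
  interpret M: right_module R M by fact
  let ?g = "inv_into (carrier M) h"
  have g: "?g y \<in> carrier M" "h (?g y) = y" if "y \<in> carrier N" for y
    using that assms(3) by (auto simp: bij_betw_def inv_into_into f_inv_into_f)
  have gh: "?g (h x) = x" if "x \<in> carrier M" for x
    using that assms(3) by (auto simp: bij_betw_def inv_into_f_f)
  show ?thesis
  proof (rule rmod_homI)
    fix x y assume xy: "x \<in> carrier N" "y \<in> carrier N"
    show "?g (x \<oplus>\<^bsub>N\<^esub> y) = ?g x \<oplus>\<^bsub>M\<^esub> ?g y"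
      using rmod_hom_add[OF assms(2) g(1)[OF xy(1)] g(1)[OF xy(2)]] gh[of "?g x \<oplus>\<^bsub>M\<^esub> ?g y"] g xy by simp
  next
    fix a x assume ax: "a \<in> carrier R" "x \<in> carrier N"
    show "?g (a \<odot>\<^bsub>N\<^esub> x) = a \<odot>\<^bsub>M\<^esub> ?g x"
      using rmod_hom_smult[OF assms(2) ax(1) g(1)[OF ax(2)]] gh[of "a \<odot>\<^bsub>M\<^esub> ?g x"] g ax
      by (simp add: M.smult_closed)
  qed (use g in auto)
qed

text \<open>Every module axiom for \<open>N\<close> is the image of the same axiom for
  \<open>M\<close>, since \<open>\<rho>\<close> and \<open>q\<close> reach all scalars and all
  elements. This one transport yields the quotient modules over the quotient ring, their restriction
  to \<open>R\<close>, and copies of a module in another record or on another type.\<close>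

lemma right_module_image:
  assumes M: "right_module R M" and A: "ring A"
    and \<rho>: "\<And>b. b \<in> carrier A \<Longrightarrow> \<exists>a\<in>carrier R. b = \<rho> a"
      "\<And>a b. a \<in> carrier R \<Longrightarrow> b \<in> carrier R \<Longrightarrow> \<rho> (a \<oplus>\<^bsub>R\<^esub> b) = \<rho> a \<oplus>\<^bsub>A\<^esub> \<rho> b"
      "\<And>a b. a \<in> carrier R \<Longrightarrow> b \<in> carrier R \<Longrightarrow> \<rho> (a \<otimes>\<^bsub>R\<^esub> b) = \<rho> a \<otimes>\<^bsub>A\<^esub> \<rho> b"
      "\<rho> \<one>\<^bsub>R\<^esub> = \<one>\<^bsub>A\<^esub>"
    and q: "carrier N = q ` carrier M" "q \<zero>\<^bsub>M\<^esub> = \<zero>\<^bsub>N\<^esub>"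
      "\<And>x y. x \<in> carrier M \<Longrightarrow> y \<in> carrier M \<Longrightarrow> q (x \<oplus>\<^bsub>M\<^esub> y) = q x \<oplus>\<^bsub>N\<^esub> q y"
      "\<And>a x. a \<in> carrier R \<Longrightarrow> x \<in> carrier M \<Longrightarrow> q (a \<odot>\<^bsub>M\<^esub> x) = \<rho> a \<odot>\<^bsub>N\<^esub> q x"
  shows "right_module A N"
proof -
  interpret M: right_module R M by fact
  have *: "q (\<ominus>\<^bsub>M\<^esub> x) \<oplus>\<^bsub>N\<^esub> q x = \<zero>\<^bsub>N\<^esub>" if "x \<in> carrier M" for x
    using that by (simp add: q(2) q(3)[symmetric] M.l_neg)
  have ag: "abelian_group N"
  proof (rule abelian_groupI)
    show "\<exists>y\<in>carrier N. y \<oplus>\<^bsub>N\<^esub> x = \<zero>\<^bsub>N\<^esub>" if "x \<in> carrier N" for x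
      using that * q(1) by auto
    show "x \<oplus>\<^bsub>N\<^esub> y \<oplus>\<^bsub>N\<^esub> z = x \<oplus>\<^bsub>N\<^esub> (y \<oplus>\<^bsub>N\<^esub> z)"
      if "x \<in> carrier N" "y \<in> carrier N" "z \<in> carrier N" for x y z
      using that by (auto simp: q(1) q(3)[symmetric] M.M.a_assoc)
    show "x \<oplus>\<^bsub>N\<^esub> y = y \<oplus>\<^bsub>N\<^esub> x" if "x \<in> carrier N" "y \<in> carrier N" for x y
      using that by (auto simp: q(1) q(3)[symmetric] M.M.a_comm)
    show "x \<oplus>\<^bsub>N\<^esub> y \<in> carrier N" if "x \<in> carrier N" "y \<in> carrier N" for x y
      using that by (auto simp: q(1) q(3)[symmetric])
    show "\<zero>\<^bsub>N\<^esub> \<in> carrier N"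
      unfolding q(2)[symmetric] q(1) by simp
    show "\<zero>\<^bsub>N\<^esub> \<oplus>\<^bsub>N\<^esub> x = x" if "x \<in> carrier N" for x
      using that unfolding q(2)[symmetric] q(1) by (auto simp: q(3)[symmetric])
  qed
  have A_cases: thesis if "a \<in> carrier A" "\<And>c. c \<in> carrier R \<Longrightarrow> a = \<rho> c \<Longrightarrow> thesis" for a thesis
    using \<rho>(1) that by auto
  have N_cases: thesis if "x \<in> carrier N" "\<And>u. u \<in> carrier M \<Longrightarrow> x = q u \<Longrightarrow> thesis" for x thesis
    using q(1) that by auto
  show ?thesis
  proof (intro right_module.intro right_module_axioms.intro A ag)
    fix a x assume a: "a \<in> carrier A" and x: "x \<in> carrier N"
    from a obtain c where c: "c \<in> carrier R" "a = \<rho> c" by (rule A_cases)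
    from x obtain u where u: "u \<in> carrier M" "x = q u" by (rule N_cases)
    from c u show "a \<odot>\<^bsub>N\<^esub> x \<in> carrier N"
      by (simp only: q(4)[symmetric] q(1) image_eqI[OF refl] M.smult_closed)
    show "a \<odot>\<^bsub>N\<^esub> (x \<oplus>\<^bsub>N\<^esub> y) = a \<odot>\<^bsub>N\<^esub> x \<oplus>\<^bsub>N\<^esub> a \<odot>\<^bsub>N\<^esub> y" if "y \<in> carrier N" for y
    proof -
      from that obtain v where v: "v \<in> carrier M" "y = q v" by (rule N_cases)
      with c u show ?thesis
        by (simp only: q(3,4)[symmetric] M.smult_r_distr M.smult_closed M.M.add.m_closed)
    qed
  next
    fix a b x assume a: "a \<in> carrier A" and b: "b \<in> carrier A" and x: "x \<in> carrier N"
    from a obtain c where c: "c \<in> carrier R" "a = \<rho> c" by (rule A_cases)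
    from b obtain d where d: "d \<in> carrier R" "b = \<rho> d" by (rule A_cases)
    from x obtain u where u: "u \<in> carrier M" "x = q u" by (rule N_cases)
    from c d u show "(a \<oplus>\<^bsub>A\<^esub> b) \<odot>\<^bsub>N\<^esub> x = a \<odot>\<^bsub>N\<^esub> x \<oplus>\<^bsub>N\<^esub> b \<odot>\<^bsub>N\<^esub> x"
      by (simp only: q(3,4)[symmetric] \<rho>(2)[symmetric] M.smult_l_distr M.smult_closed M.R.add.m_closed)
    from c d u show "(a \<otimes>\<^bsub>A\<^esub> b) \<odot>\<^bsub>N\<^esub> x = b \<odot>\<^bsub>N\<^esub> (a \<odot>\<^bsub>N\<^esub> x)"
      by (simp only: q(3,4)[symmetric] \<rho>(3)[symmetric] M.smult_assoc M.smult_closed M.R.m_closed)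
  next
    fix x assume "x \<in> carrier N"
    then obtain u where u: "u \<in> carrier M" "x = q u" by (rule N_cases)
    then show "\<one>\<^bsub>A\<^esub> \<odot>\<^bsub>N\<^esub> x = x"
      by (simp only: q(4)[symmetric] \<rho>(4)[symmetric] M.smult_one M.R.one_closed)
  qed
qed

section \<open>Direct sums\<close>

lemma direct_sum_carrier:
  "F \<in> carrier (direct_sum_rmodule I M) \<longleftrightarrow>
    F \<in> (\<Pi>\<^sub>E i\<in>I. carrier (M i)) \<and> finite {i \<in> I. F i \<noteq> \<zero>\<^bsub>M i\<^esub>}"
  by (simp add: direct_sum_rmodule_def)

lemma direct_sum_mem: "F \<in> carrier (direct_sum_rmodule I M) \<Longrightarrow> i \<in> I \<Longrightarrow> F i \<in> carrier (M i)"
  by (auto simp: direct_sum_carrier)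

lemma direct_sum_simps:
  "\<zero>\<^bsub>direct_sum_rmodule I M\<^esub> = (\<lambda>i\<in>I. \<zero>\<^bsub>M i\<^esub>)"
  "F \<oplus>\<^bsub>direct_sum_rmodule I M\<^esub> G = (\<lambda>i\<in>I. F i \<oplus>\<^bsub>M i\<^esub> G i)"
  "a \<odot>\<^bsub>direct_sum_rmodule I M\<^esub> F = (\<lambda>i\<in>I. a \<odot>\<^bsub>M i\<^esub> F i)"
  by (simp_all add: direct_sum_rmodule_def)

lemma direct_sum_eqI:
  assumes "F \<in> carrier (direct_sum_rmodule I M)" "G \<in> carrier (direct_sum_rmodule I M)"
    and "\<And>i. i \<in> I \<Longrightarrow> F i = G i"
  shows "F = G"
  using assms by (auto simp: direct_sum_carrier intro: PiE_ext)

lemma right_module_direct_sum: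
  assumes R: "ring R" and M: "\<And>i. i \<in> I \<Longrightarrow> right_module R (M i)"
  shows "right_module R (direct_sum_rmodule I M)"
proof -
  let ?D = "direct_sum_rmodule I M"
  have ag: "abelian_group (M i)" if "i \<in> I" for i
    using M[OF that] by (simp add: right_module_def)
  note ag' = ag[THEN abelian_group.axioms(1)]
  have add: "F \<oplus>\<^bsub>?D\<^esub> G \<in> carrier ?D" if "F \<in> carrier ?D" "G \<in> carrier ?D" for F G
  proof -
    have "{i \<in> I. F i \<oplus>\<^bsub>M i\<^esub> G i \<noteq> \<zero>\<^bsub>M i\<^esub>} \<subseteq> {i \<in> I. F i \<noteq> \<zero>\<^bsub>M i\<^esub>} \<union> {i \<in> I. G i \<noteq> \<zero>\<^bsub>M i\<^esub>}"
      using ag'[THEN abelian_monoid.l_zero] ag'[THEN abelian_monoid.zero_closed] by auto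
    then have "finite {i \<in> I. F i \<oplus>\<^bsub>M i\<^esub> G i \<noteq> \<zero>\<^bsub>M i\<^esub>}"
      using that by (auto simp: direct_sum_carrier intro: finite_subset)
    then show ?thesis
      using that ag'[THEN abelian_monoid.a_closed]
      by (auto simp: direct_sum_carrier direct_sum_simps PiE_iff extensional_def cong: conj_cong)
  qed
  have smult: "a \<odot>\<^bsub>?D\<^esub> F \<in> carrier ?D" if "a \<in> carrier R" "F \<in> carrier ?D" for a F
  proof -
    have "{i \<in> I. a \<odot>\<^bsub>M i\<^esub> F i \<noteq> \<zero>\<^bsub>M i\<^esub>} \<subseteq> {i \<in> I. F i \<noteq> \<zero>\<^bsub>M i\<^esub>}"
      using M[THEN right_module.smult_zero_right] that by auto
    then have "finite {i \<in> I. a \<odot>\<^bsub>M i\<^esub> F i \<noteq> \<zero>\<^bsub>M i\<^esub>}"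
      using that by (auto simp: direct_sum_carrier intro: finite_subset)
    then show ?thesis
      using that M[THEN right_module.smult_closed]
      by (auto simp: direct_sum_carrier direct_sum_simps PiE_iff extensional_def cong: conj_cong)
  qed
  have zero: "\<zero>\<^bsub>?D\<^esub> \<in> carrier ?D"
    using ag'[THEN abelian_monoid.zero_closed]
    by (auto simp: direct_sum_carrier direct_sum_simps cong: conj_cong)
  interpret R: ring R by fact
  show ?thesis
  proof (intro right_module.intro right_module_axioms.intro R abelian_groupI add zero smult)
    fix F G H assume *: "F \<in> carrier ?D" "G \<in> carrier ?D" "H \<in> carrier ?D"
    show "F \<oplus>\<^bsub>?D\<^esub> G \<oplus>\<^bsub>?D\<^esub> H = F \<oplus>\<^bsub>?D\<^esub> (G \<oplus>\<^bsub>?D\<^esub> H)"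
    proof (rule direct_sum_eqI[of _ I M])
      fix i assume i: "i \<in> I"
      interpret right_module R "M i" by (rule M[OF i])
      show "(F \<oplus>\<^bsub>?D\<^esub> G \<oplus>\<^bsub>?D\<^esub> H) i = (F \<oplus>\<^bsub>?D\<^esub> (G \<oplus>\<^bsub>?D\<^esub> H)) i"
        using * i by (simp add: direct_sum_simps direct_sum_mem[of _ I M] M.a_assoc)
    qed (simp_all add: * add smult zero R.ring_simprules)
  next
    fix F G assume *: "F \<in> carrier ?D" "G \<in> carrier ?D"
    show "F \<oplus>\<^bsub>?D\<^esub> G = G \<oplus>\<^bsub>?D\<^esub> F"
    proof (rule direct_sum_eqI[of _ I M])
      fix i assume i: "i \<in> I"
      interpret right_module R "M i" by (rule M[OF i])
      show "(F \<oplus>\<^bsub>?D\<^esub> G) i = (G \<oplus>\<^bsub>?D\<^esub> F) i"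
        using * i by (simp add: direct_sum_simps direct_sum_mem[of _ I M] M.a_comm)
    qed (simp_all add: * add smult zero R.ring_simprules)
  next
    fix F assume *: "F \<in> carrier ?D"
    show "\<zero>\<^bsub>?D\<^esub> \<oplus>\<^bsub>?D\<^esub> F = F"
    proof (rule direct_sum_eqI[of _ I M])
      fix i assume i: "i \<in> I"
      interpret right_module R "M i" by (rule M[OF i])
      show "(\<zero>\<^bsub>?D\<^esub> \<oplus>\<^bsub>?D\<^esub> F) i = (F) i"
        using * i by (simp add: direct_sum_simps direct_sum_mem[of _ I M] )
    qed (simp_all add: * add smult zero R.ring_simprules)
    show "\<one>\<^bsub>R\<^esub> \<odot>\<^bsub>?D\<^esub> F = F"
    proof (rule direct_sum_eqI[of _ I M])
      fix i assume i: "i \<in> I"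
      interpret right_module R "M i" by (rule M[OF i])
      show "(\<one>\<^bsub>R\<^esub> \<odot>\<^bsub>?D\<^esub> F) i = (F) i"
        using * i by (simp add: direct_sum_simps direct_sum_mem[of _ I M] smult_one)
    qed (simp_all add: * add smult zero R.ring_simprules)
    have "(\<ominus>\<^bsub>R\<^esub> \<one>\<^bsub>R\<^esub>) \<odot>\<^bsub>?D\<^esub> F \<oplus>\<^bsub>?D\<^esub> F = \<zero>\<^bsub>?D\<^esub>"
    proof (rule direct_sum_eqI[of _ I M])
      fix i assume i: "i \<in> I"
      interpret right_module R "M i" by (rule M[OF i])
      show "((\<ominus>\<^bsub>R\<^esub> \<one>\<^bsub>R\<^esub>) \<odot>\<^bsub>?D\<^esub> F \<oplus>\<^bsub>?D\<^esub> F) i = (\<zero>\<^bsub>?D\<^esub>) i"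
        using * i by (simp add: direct_sum_simps direct_sum_mem[of _ I M] smult_minus_left smult_one M.l_neg smult_closed)
    qed (simp_all add: * add smult zero R.ring_simprules)
    then show "\<exists>G\<in>carrier ?D. G \<oplus>\<^bsub>?D\<^esub> F = \<zero>\<^bsub>?D\<^esub>"
      using smult[of "\<ominus>\<^bsub>R\<^esub> \<one>\<^bsub>R\<^esub>" F] * by auto
  next
    fix a b F assume *: "a \<in> carrier R" "b \<in> carrier R" "F \<in> carrier ?D"
    show "(a \<oplus>\<^bsub>R\<^esub> b) \<odot>\<^bsub>?D\<^esub> F = a \<odot>\<^bsub>?D\<^esub> F \<oplus>\<^bsub>?D\<^esub> b \<odot>\<^bsub>?D\<^esub> F"
    proof (rule direct_sum_eqI[of _ I M])
      fix i assume i: "i \<in> I"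
      interpret right_module R "M i" by (rule M[OF i])
      show "((a \<oplus>\<^bsub>R\<^esub> b) \<odot>\<^bsub>?D\<^esub> F) i = (a \<odot>\<^bsub>?D\<^esub> F \<oplus>\<^bsub>?D\<^esub> b \<odot>\<^bsub>?D\<^esub> F) i"
        using * i by (simp add: direct_sum_simps direct_sum_mem[of _ I M] smult_l_distr)
    qed (simp_all add: * add smult zero R.ring_simprules)
    show "(a \<otimes>\<^bsub>R\<^esub> b) \<odot>\<^bsub>?D\<^esub> F = b \<odot>\<^bsub>?D\<^esub> (a \<odot>\<^bsub>?D\<^esub> F)"
    proof (rule direct_sum_eqI[of _ I M])
      fix i assume i: "i \<in> I"
      interpret right_module R "M i" by (rule M[OF i])
      show "((a \<otimes>\<^bsub>R\<^esub> b) \<odot>\<^bsub>?D\<^esub> F) i = (b \<odot>\<^bsub>?D\<^esub> (a \<odot>\<^bsub>?D\<^esub> F)) i"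
        using * i by (simp add: direct_sum_simps direct_sum_mem[of _ I M] smult_assoc)
    qed (simp_all add: * add smult zero R.ring_simprules)
  next
    fix a F G assume *: "a \<in> carrier R" "F \<in> carrier ?D" "G \<in> carrier ?D"
    show "a \<odot>\<^bsub>?D\<^esub> (F \<oplus>\<^bsub>?D\<^esub> G) = a \<odot>\<^bsub>?D\<^esub> F \<oplus>\<^bsub>?D\<^esub> a \<odot>\<^bsub>?D\<^esub> G"
    proof (rule direct_sum_eqI[of _ I M])
      fix i assume i: "i \<in> I"
      interpret right_module R "M i" by (rule M[OF i])
      show "(a \<odot>\<^bsub>?D\<^esub> (F \<oplus>\<^bsub>?D\<^esub> G)) i = (a \<odot>\<^bsub>?D\<^esub> F \<oplus>\<^bsub>?D\<^esub> a \<odot>\<^bsub>?D\<^esub> G) i"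
        using * i by (simp add: direct_sum_simps direct_sum_mem[of _ I M] smult_r_distr)
    qed (simp_all add: * add smult zero R.ring_simprules)
  qed
qed

definition direct_sum_single :: "'i set \<Rightarrow> ('i \<Rightarrow> ('a, 'b) module) \<Rightarrow> 'i \<Rightarrow> 'b \<Rightarrow> 'i \<Rightarrow> 'b"
  where "direct_sum_single I M i s = (\<lambda>j\<in>I. if j = i then s else \<zero>\<^bsub>M j\<^esub>)"

text \<open>The homomorphism out of the direct sum with components \<open>g i\<close>. Summing over
  the support keeps the sum finite, at the price of an index set that varies with
  \<open>F\<close>.\<close>

definition direct_sum_map ::
  "'i set \<Rightarrow> ('i \<Rightarrow> ('a, 'b) module) \<Rightarrow> ('a, 'c, 'n) module_scheme \<Rightarrow> ('i \<Rightarrow> 'b \<Rightarrow> 'c) \<Rightarrow> ('i \<Rightarrow> 'b) \<Rightarrow> 'c"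
  where "direct_sum_map I M N g F = (\<Oplus>\<^bsub>N\<^esub>i\<in>{i \<in> I. F i \<noteq> \<zero>\<^bsub>M i\<^esub>}. g i (F i))"

context
  fixes R :: "('a, 'k) ring_scheme" and I :: "'i set" and M :: "'i \<Rightarrow> ('a, 'b) module"
  assumes R: "ring R" and M: "\<And>i. i \<in> I \<Longrightarrow> right_module R (M i)"
begin

lemma direct_sum_summand_zero: "i \<in> I \<Longrightarrow> \<zero>\<^bsub>M i\<^esub> \<in> carrier (M i)"
  using M abelian_monoid.zero_closed abelian_group.axioms(1) right_module.axioms(2) by blast

lemma direct_sum_single_hom: "i \<in> I \<Longrightarrow> direct_sum_single I M i \<in> rmod_hom R (M i) (direct_sum_rmodule I M)"
proof (rule rmod_homI)
  fix s assume i: "i \<in> I" and s: "s \<in> carrier (M i)"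
  have "finite {j \<in> I. direct_sum_single I M i s j \<noteq> \<zero>\<^bsub>M j\<^esub>}"
    by (rule finite_subset[of _ "{i}"]) (auto simp: direct_sum_single_def)
  then show "direct_sum_single I M i s \<in> carrier (direct_sum_rmodule I M)"
    using i s direct_sum_summand_zero by (auto simp: direct_sum_carrier direct_sum_single_def)
next
  fix s t assume i: "i \<in> I" and st: "s \<in> carrier (M i)" "t \<in> carrier (M i)"
  show "direct_sum_single I M i (s \<oplus>\<^bsub>M i\<^esub> t) =
      direct_sum_single I M i s \<oplus>\<^bsub>direct_sum_rmodule I M\<^esub> direct_sum_single I M i t"
    using M[THEN right_module.axioms(2), THEN abelian_group.axioms(1), THEN abelian_monoid.l_zero]
      direct_sum_summand_zero
    by (auto simp: direct_sum_single_def direct_sum_simps fun_eq_iff)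
next
  fix a s assume i: "i \<in> I" and as: "a \<in> carrier R" "s \<in> carrier (M i)"
  show "direct_sum_single I M i (a \<odot>\<^bsub>M i\<^esub> s) = a \<odot>\<^bsub>direct_sum_rmodule I M\<^esub> direct_sum_single I M i s"
    using M[THEN right_module.smult_zero_right] as
    by (auto simp: direct_sum_single_def direct_sum_simps fun_eq_iff)
qed

lemma direct_sum_component_hom: "i \<in> I \<Longrightarrow> (\<lambda>F. F i) \<in> rmod_hom R (direct_sum_rmodule I M) (M i)"
  by (rule rmod_homI) (auto simp: direct_sum_mem direct_sum_simps)

text \<open>Induction over a finite set containing the support: each step splits off one component
  as a \<open>direct_sum_single\<close> and leaves an element supported in the remaining
  set.\<close>

lemma submodule_direct_sum_eq:
  assumes H: "submodule H R (direct_sum_rmodule I M)"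
    and single: "\<And>i s. i \<in> I \<Longrightarrow> s \<in> carrier (M i) \<Longrightarrow> direct_sum_single I M i s \<in> H"
  shows "H = carrier (direct_sum_rmodule I M)"
proof
  show "H \<subseteq> carrier (direct_sum_rmodule I M)" by (rule submodule_subset[OF H])
  have "F \<in> H" if "finite T" "F \<in> carrier (direct_sum_rmodule I M)" "{i \<in> I. F i \<noteq> \<zero>\<^bsub>M i\<^esub>} \<subseteq> T" for F T
    using that
  proof (induct T arbitrary: F)
    case empty
    then have "F = \<zero>\<^bsub>direct_sum_rmodule I M\<^esub>"
      by (auto simp: direct_sum_simps direct_sum_carrier PiE_iff extensional_def fun_eq_iff)
    then show ?case using submodule_zero[OF H] by simp
  next
    case (insert i T)
    show ?case
    proof (cases "i \<in> I")
      case False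
      then show ?thesis using insert(3)[of F] insert(4,5) by blast
    next
      case i: True
      let ?G = "\<lambda>j\<in>I. if j = i then \<zero>\<^bsub>M j\<^esub> else F j"
      have "{j \<in> I. ?G j \<noteq> \<zero>\<^bsub>M j\<^esub>} \<subseteq> {j \<in> I. F j \<noteq> \<zero>\<^bsub>M j\<^esub>}" by auto
      then have "finite {j \<in> I. ?G j \<noteq> \<zero>\<^bsub>M j\<^esub>}"
        using insert(4) unfolding direct_sum_carrier by (elim conjE) (rule finite_subset)
      then have "?G \<in> carrier (direct_sum_rmodule I M)"
        unfolding direct_sum_carrier using direct_sum_mem[OF insert(4)] direct_sum_summand_zero
        by (intro conjI) auto
      moreover have "{j \<in> I. ?G j \<noteq> \<zero>\<^bsub>M j\<^esub>} \<subseteq> T" using insert(5) by auto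
      ultimately have "?G \<in> H" by (rule insert(3))
      moreover have "direct_sum_single I M i (F i) \<in> H"
        by (rule single[OF i direct_sum_mem[OF insert(4) i]])
      ultimately have "direct_sum_single I M i (F i) \<oplus>\<^bsub>direct_sum_rmodule I M\<^esub> ?G \<in> H"
        by (rule submodule_add[OF H, rotated])
      moreover have "direct_sum_single I M i (F i) \<oplus>\<^bsub>direct_sum_rmodule I M\<^esub> ?G = F"
      proof
        fix j
        show "(direct_sum_single I M i (F i) \<oplus>\<^bsub>direct_sum_rmodule I M\<^esub> ?G) j = F j"
        proof (cases "j \<in> I")
          case True
          interpret right_module R "M j" by (rule M[OF True])
          show ?thesis
            using True direct_sum_mem[OF insert(4) True] M.r_zero[of "F j"]
            by (cases "j = i") (auto simp: direct_sum_simps direct_sum_single_def)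
        next
          case False
          then show ?thesis using insert(4) by (auto simp: direct_sum_simps direct_sum_carrier PiE_iff extensional_def)
        qed
      qed
      ultimately show ?thesis by simp
    qed
  qed
  then show "carrier (direct_sum_rmodule I M) \<subseteq> H"
    by (auto simp: direct_sum_carrier)
qed

context
  fixes N :: "('a, 'c, 'n) module_scheme" and g
  assumes N: "right_module R N" and g: "\<And>i. i \<in> I \<Longrightarrow> g i \<in> rmod_hom R (M i) N"
begin

text \<open>Values at elements with different supports can be added only over a common finite index
  set \<open>T\<close>; the additional terms vanish because each \<open>g i\<close> maps zero to
  zero.\<close>

lemma direct_sum_map_eq:
  assumes "F \<in> carrier (direct_sum_rmodule I M)" "finite T" "T \<subseteq> I" "{i \<in> I. F i \<noteq> \<zero>\<^bsub>M i\<^esub>} \<subseteq> T"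
  shows "direct_sum_map I M N g F = (\<Oplus>\<^bsub>N\<^esub>i\<in>T. g i (F i))"
proof -
  interpret N: right_module R N by (rule N)
  have gF: "g i (F i) \<in> carrier N" if "i \<in> I" for i
    using rmod_hom_closed[OF g[OF that] direct_sum_mem[OF assms(1) that]] .
  show ?thesis
    unfolding direct_sum_map_def
  proof (rule N.M.add.finprod_mono_neutral_cong_left)
    show "g i (F i) = \<zero>\<^bsub>N\<^esub>" if "i \<in> T - {i \<in> I. F i \<noteq> \<zero>\<^bsub>M i\<^esub>}" for i
      using that assms(3) rmod_hom_zero[OF M N g] by auto
  qed (use assms gF in auto)
qed

lemma direct_sum_map_hom: "direct_sum_map I M N g \<in> rmod_hom R (direct_sum_rmodule I M) N"
proof -
  interpret N: right_module R N by (rule N)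
  let ?s = "\<lambda>F. {i \<in> I. F i \<noteq> \<zero>\<^bsub>M i\<^esub>}"
  have gF: "g i (F i) \<in> carrier N" if "i \<in> I" "F \<in> carrier (direct_sum_rmodule I M)" for i F
    using rmod_hom_closed[OF g[OF that(1)] direct_sum_mem[OF that(2,1)]] .
  interpret D: right_module R "direct_sum_rmodule I M"
    by (rule right_module_direct_sum[OF R M])
  show ?thesis
  proof (rule rmod_homI)
    fix F assume "F \<in> carrier (direct_sum_rmodule I M)"
    then show "direct_sum_map I M N g F \<in> carrier N"
      unfolding direct_sum_map_def by (intro N.M.finsum_closed) (auto intro: gF)
  next
    fix F G assume F: "F \<in> carrier (direct_sum_rmodule I M)" and G: "G \<in> carrier (direct_sum_rmodule I M)"
    let ?FG = "F \<oplus>\<^bsub>direct_sum_rmodule I M\<^esub> G"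
    let ?T = "?s F \<union> ?s G \<union> ?s ?FG"
    have FG: "?FG \<in> carrier (direct_sum_rmodule I M)" using F G by simp
    have fin: "finite ?T" using F G FG by (auto simp: direct_sum_carrier)
    have "direct_sum_map I M N g ?FG = (\<Oplus>\<^bsub>N\<^esub>i\<in>?T. g i (?FG i))"
      using fin by (intro direct_sum_map_eq FG) auto
    also have "\<dots> = (\<Oplus>\<^bsub>N\<^esub>i\<in>?T. g i (F i) \<oplus>\<^bsub>N\<^esub> g i (G i))"
      using F G gF rmod_hom_add[OF g]
      by (intro N.M.finsum_cong') (auto simp: direct_sum_simps direct_sum_mem)
    also have "\<dots> = (\<Oplus>\<^bsub>N\<^esub>i\<in>?T. g i (F i)) \<oplus>\<^bsub>N\<^esub> (\<Oplus>\<^bsub>N\<^esub>i\<in>?T. g i (G i))"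
      using F G gF by (intro N.M.finsum_addf) auto
    also have "(\<Oplus>\<^bsub>N\<^esub>i\<in>?T. g i (F i)) = direct_sum_map I M N g F"
      using fin by (intro direct_sum_map_eq[symmetric] F) auto
    also have "(\<Oplus>\<^bsub>N\<^esub>i\<in>?T. g i (G i)) = direct_sum_map I M N g G"
      using fin by (intro direct_sum_map_eq[symmetric] G) auto
    finally show "direct_sum_map I M N g ?FG = direct_sum_map I M N g F \<oplus>\<^bsub>N\<^esub> direct_sum_map I M N g G" .
  next
    fix a F assume a: "a \<in> carrier R" and F: "F \<in> carrier (direct_sum_rmodule I M)"
    let ?aF = "a \<odot>\<^bsub>direct_sum_rmodule I M\<^esub> F"
    let ?T = "?s F \<union> ?s ?aF"
    have aF: "?aF \<in> carrier (direct_sum_rmodule I M)" using a F by (rule D.smult_closed)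
    have fin: "finite ?T" using F aF by (auto simp: direct_sum_carrier)
    have "direct_sum_map I M N g ?aF = (\<Oplus>\<^bsub>N\<^esub>i\<in>?T. g i (?aF i))"
      using fin by (intro direct_sum_map_eq aF) auto
    also have "\<dots> = (\<Oplus>\<^bsub>N\<^esub>i\<in>?T. a \<odot>\<^bsub>N\<^esub> g i (F i))"
      using a F gF rmod_hom_smult[OF g]
      by (intro N.M.finsum_cong') (auto simp: direct_sum_simps direct_sum_mem N.smult_closed)
    also have "\<dots> = a \<odot>\<^bsub>N\<^esub> (\<Oplus>\<^bsub>N\<^esub>i\<in>?T. g i (F i))"
      using F gF a fin by (intro N.smult_finsum[symmetric]) auto
    also have "(\<Oplus>\<^bsub>N\<^esub>i\<in>?T. g i (F i)) = direct_sum_map I M N g F"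
      using fin by (intro direct_sum_map_eq[symmetric] F) auto
    finally show "direct_sum_map I M N g ?aF = a \<odot>\<^bsub>N\<^esub> direct_sum_map I M N g F" .
  qed
qed

lemma direct_sum_map_single:
  assumes "i \<in> I" "s \<in> carrier (M i)"
  shows "direct_sum_map I M N g (direct_sum_single I M i s) = g i s"
proof -
  interpret N: right_module R N by (rule N)
  have "direct_sum_map I M N g (direct_sum_single I M i s) = (\<Oplus>\<^bsub>N\<^esub>j\<in>{i}. g j (direct_sum_single I M i s j))"
    using assms by (intro direct_sum_map_eq rmod_hom_closed[OF direct_sum_single_hom])
      (auto simp: direct_sum_single_def split: if_splits)
  also have "\<dots> = g i s"
    using assms rmod_hom_closed[OF g] by (simp add: direct_sum_single_def)
  finally show ?thesis .
qed

end

end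

section \<open>The Jacobson radical, dual bases and purity\<close>

context right_module
begin

lemma submodule_sum:
  assumes "submodule A R M" "submodule B R M"
  shows "submodule {x \<oplus>\<^bsub>M\<^esub> y | x y. x \<in> A \<and> y \<in> B} R M"
proof (rule submoduleI')
  note A = submodule_facts[OF assms(1)] and B = submodule_facts[OF assms(2)]
  show "{x \<oplus>\<^bsub>M\<^esub> y | x y. x \<in> A \<and> y \<in> B} \<subseteq> carrier M" using A(1) B(1) by auto
  have "\<zero>\<^bsub>M\<^esub> = \<zero>\<^bsub>M\<^esub> \<oplus>\<^bsub>M\<^esub> \<zero>\<^bsub>M\<^esub>" by simp
  then show "\<zero>\<^bsub>M\<^esub> \<in> {x \<oplus>\<^bsub>M\<^esub> y | x y. x \<in> A \<and> y \<in> B}" using A(2) B(2) by blast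
  fix u assume "u \<in> {x \<oplus>\<^bsub>M\<^esub> y | x y. x \<in> A \<and> y \<in> B}"
  then obtain x y where u: "u = x \<oplus>\<^bsub>M\<^esub> y" "x \<in> A" "y \<in> B" by auto
  then have xy: "x \<in> carrier M" "y \<in> carrier M" using A(1) B(1) by auto
  show "u \<oplus>\<^bsub>M\<^esub> v \<in> {x \<oplus>\<^bsub>M\<^esub> y | x y. x \<in> A \<and> y \<in> B}"
    if v: "v \<in> {x \<oplus>\<^bsub>M\<^esub> y | x y. x \<in> A \<and> y \<in> B}" for v
  proof -
    from v obtain x' y' where v: "v = x' \<oplus>\<^bsub>M\<^esub> y'" "x' \<in> A" "y' \<in> B" by auto
    then have "x' \<in> carrier M" "y' \<in> carrier M" using A(1) B(1) by auto
    then have "u \<oplus>\<^bsub>M\<^esub> v = (x \<oplus>\<^bsub>M\<^esub> x') \<oplus>\<^bsub>M\<^esub> (y \<oplus>\<^bsub>M\<^esub> y')"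
      using u(1) v(1) xy by (simp add: M.a_ac)
    then show ?thesis using A(3)[OF u(2) v(2)] B(3)[OF u(3) v(3)] by blast
  qed
  show "a \<odot>\<^bsub>M\<^esub> u \<in> {x \<oplus>\<^bsub>M\<^esub> y | x y. x \<in> A \<and> y \<in> B}" if a: "a \<in> carrier R" for a
    using A(4)[OF a u(2)] B(4)[OF a u(3)] xy a u(1) by (auto simp: smult_r_distr)
qed

end

section \<open>Maximal right ideals and the Jacobson radical\<close>

context ring
begin

lemma left_mult_hom: "a \<in> carrier R \<Longrightarrow> (\<lambda>x. a \<otimes> x) \<in> rmod_hom R (regular_rmodule R) (regular_rmodule R)"
  by (rule rmod_homI) (auto simp: r_distr m_assoc)

lemma submodule_regular_one:
  assumes "submodule K R (regular_rmodule R)" "\<one> \<in> K"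
  shows "K = carrier R"
  using submodule_subset[OF assms(1)] submodule_smult[OF assms(1) _ assms(2)] by auto

text \<open>A right ideal is proper exactly if it misses \<open>\<one>\<close>, and missing
  \<open>\<one>\<close> passes to unions of chains; so Zorn's lemma applies to the right ideals
  above \<open>I\<close> that miss \<open>\<one>\<close>.\<close>

lemma exists_maximal_right_ideal:
  assumes I: "submodule I R (regular_rmodule R)" and one: "\<one> \<notin> I"
  shows "\<exists>K. maximal_right_ideal R K \<and> I \<subseteq> K"
proof -
  interpret reg: right_module R "regular_rmodule R" by (rule right_module_regular[OF ring_axioms])
  let ?A = "{K. submodule K R (regular_rmodule R) \<and> I \<subseteq> K \<and> \<one> \<notin> K}"
  have "\<exists>K\<in>?A. \<forall>Z\<in>?A. K \<subseteq> Z \<longrightarrow> Z = K"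
  proof (rule subset_Zorn_nonempty)
    show "?A \<noteq> {}" using I one by auto
    fix C assume C: "C \<noteq> {}" "subset.chain ?A C"
    then have CA: "C \<subseteq> ?A" and cmp: "\<And>Z Y. Z \<in> C \<Longrightarrow> Y \<in> C \<Longrightarrow> Z \<subseteq> Y \<or> Y \<subseteq> Z"
      by (auto simp: subset_chain_def)
    have "submodule (\<Union>C) R (regular_rmodule R)"
    proof (rule reg.submoduleI')
      show "\<Union>C \<subseteq> carrier (regular_rmodule R)"
        using CA submodule_subset by blast
      show "\<zero>\<^bsub>regular_rmodule R\<^esub> \<in> \<Union>C"
        using CA C(1) submodule_zero by fastforce
      show "x \<oplus>\<^bsub>regular_rmodule R\<^esub> y \<in> \<Union>C" if xy: "x \<in> \<Union>C" "y \<in> \<Union>C" for x y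
      proof -
        obtain Z where "Z \<in> C" "x \<in> Z" "y \<in> Z" using cmp xy by blast
        moreover from this have "submodule Z R (regular_rmodule R)" using CA by auto
        ultimately show ?thesis using submodule_add[of Z R "regular_rmodule R" x y] by (intro UnionI)
      qed
      show "a \<odot>\<^bsub>regular_rmodule R\<^esub> x \<in> \<Union>C" if "a \<in> carrier R" "x \<in> \<Union>C" for a x
        using that CA submodule_smult[of _ R "regular_rmodule R" a x] by blast
    qed
    then show "\<Union>C \<in> ?A" using CA C(1) by auto
  qed
  then obtain K where "K \<in> ?A" and K_max: "\<forall>Z\<in>?A. K \<subseteq> Z \<longrightarrow> Z = K" ..
  then have K: "submodule K R (regular_rmodule R)" "I \<subseteq> K" "\<one> \<notin> K" by auto
  have "maximal_right_ideal R K"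
    unfolding maximal_right_ideal_def
  proof (intro conjI allI impI K(1))
    show "K \<noteq> carrier R" using K(3) by auto
    show "L = K \<or> L = carrier R" if L: "submodule L R (regular_rmodule R)" "K \<subseteq> L" for L
    proof (cases "\<one> \<in> L")
      case True
      then show ?thesis using submodule_regular_one[OF L(1)] by simp
    next
      case False
      then have "L \<in> ?A" using L K(2) by auto
      then show ?thesis using K_max L(2) by blast
    qed
  qed
  then show ?thesis using K(2) by blast
qed

lemma submodule_jacobson_radical: "submodule (jacobson_radical R) R (regular_rmodule R)"
proof -
  interpret reg: right_module R "regular_rmodule R" by (rule right_module_regular[OF ring_axioms])
  have "jacobson_radical R = \<Inter>(insert (carrier R) {I. maximal_right_ideal R I})"
    by (auto simp: jacobson_radical_def)
  moreover have "submodule (\<Inter>(insert (carrier R) {I. maximal_right_ideal R I})) R (regular_rmodule R)"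
    using reg.submodule_carrier by (intro reg.submodule_Inter) (auto simp: maximal_right_ideal_def)
  ultimately show ?thesis by simp
qed

lemma jacobson_radical_closed: "j \<in> jacobson_radical R \<Longrightarrow> j \<in> carrier R"
  by (simp add: jacobson_radical_def)

text \<open>Left multiplication by \<open>a\<close> embeds \<open>R\<close> modulo this preimage
  into the simple module \<open>R\<close> modulo \<open>I\<close>. If the preimage is proper, the
  embedding is onto, so the preimage is again maximal. The proof carries this out on
  elements.\<close>

lemma maximal_right_ideal_vimage:
  assumes I: "maximal_right_ideal R I" and a: "a \<in> carrier R"
    and ne: "{x \<in> carrier R. a \<otimes> x \<in> I} \<noteq> carrier R"
  shows "maximal_right_ideal R {x \<in> carrier R. a \<otimes> x \<in> I}"
proof -
  interpret reg: right_module R "regular_rmodule R" by (rule right_module_regular[OF ring_axioms])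
  have I': "submodule I R (regular_rmodule R)" using I by (simp add: maximal_right_ideal_def)
  note If = submodule_facts[OF I']
  have sub: "submodule {x \<in> carrier R. a \<otimes> x \<in> I} R (regular_rmodule R)"
    using submodule_vimage[OF reg.right_module_axioms reg.right_module_axioms left_mult_hom[OF a] I'] by simp
  show ?thesis
    unfolding maximal_right_ideal_def
  proof (intro conjI allI impI sub ne)
    fix K assume K: "submodule K R (regular_rmodule R)" and le: "{x \<in> carrier R. a \<otimes> x \<in> I} \<subseteq> K"
    have KR: "K \<subseteq> carrier R" using submodule_subset[OF K] by simp
    show "K = {x \<in> carrier R. a \<otimes> x \<in> I} \<or> K = carrier R"
    proof (cases "\<exists>k\<in>K. a \<otimes> k \<notin> I")
      case False
      then show ?thesis using le KR by auto
    next
      case True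
      then obtain k where k: "k \<in> K" "a \<otimes> k \<notin> I" by auto
      \<comment> \<open>\<open>?L\<close> is the right ideal I + aK. It contains the element ak
        outside \<open>I\<close>, so by maximality of \<open>I\<close> it is all of
        \<open>R\<close>.\<close>
      let ?L = "{x \<oplus>\<^bsub>regular_rmodule R\<^esub> y | x y. x \<in> I \<and> y \<in> (\<lambda>x. a \<otimes> x) ` K}"
      have L: "submodule ?L R (regular_rmodule R)"
        by (intro reg.submodule_sum I' submodule_image[OF _ _ left_mult_hom[OF a]] K reg.right_module_axioms)
      have aK: "a \<otimes> x \<in> carrier R" if "x \<in> K" for x using that KR a by auto
      have "I \<subseteq> ?L"
      proof
        fix x assume "x \<in> I"
        then have "x = x \<oplus>\<^bsub>regular_rmodule R\<^esub> a \<otimes> \<zero>" "\<zero> \<in> K"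
          using a If(1) submodule_zero[OF K] by auto
        then show "x \<in> ?L" using \<open>x \<in> I\<close> by blast
      qed
      moreover have "a \<otimes> k \<in> ?L"
      proof -
        have "a \<otimes> k = \<zero> \<oplus>\<^bsub>regular_rmodule R\<^esub> a \<otimes> k" "\<zero> \<in> I" using If(2) k aK[of k] by auto
        then show ?thesis using k(1) by blast
      qed
      ultimately have "?L = carrier R"
        using I L k(2) unfolding maximal_right_ideal_def by blast
      have "y \<in> K" if y: "y \<in> carrier R" for y
      proof -
        have "a \<otimes> y \<in> ?L" using \<open>?L = carrier R\<close> a y by simp
        then obtain i x where ix: "i \<in> I" "x \<in> K" "a \<otimes> y = i \<oplus> a \<otimes> x" by auto
        have x: "x \<in> carrier R" and i: "i \<in> carrier R" using ix KR If(1) by auto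
        \<comment> \<open>From ay = i + ax, the difference y - x lies in the preimage of
          \<open>I\<close> and hence in \<open>K\<close>; since x lies in \<open>K\<close>, so does
          y.\<close>
        have "a \<otimes> (y \<ominus> x) = i"
          using ix(3) x y i a by (simp add: a_minus_def r_distr r_minus a_assoc r_neg)
        then have "y \<ominus> x \<in> K" using ix(1) x y le by auto
        then have "(y \<ominus> x) \<oplus> x \<in> K" using submodule_add[OF K] ix(2) by simp
        then show ?thesis using x y by (simp add: a_minus_def a_assoc l_neg)
      qed
      then show ?thesis using KR by auto
    qed
  qed
qed

text \<open>An intersection of right ideals is a priori only a right ideal. For a maximal right
  ideal \<open>I\<close>, the elements that \<open>a\<close> multiplies into \<open>I\<close> form a
  maximal right ideal or the whole ring, and \<open>j\<close> lies in either.\<close>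

lemma jacobson_radical_left_closed:
  assumes "a \<in> carrier R" "j \<in> jacobson_radical R"
  shows "a \<otimes> j \<in> jacobson_radical R"
  unfolding jacobson_radical_def
proof (intro IntI InterI)
  note j = jacobson_radical_closed[OF assms(2)]
  show "a \<otimes> j \<in> carrier R" using assms(1) j by simp
  fix I assume "I \<in> {I. maximal_right_ideal R I}"
  then have I: "maximal_right_ideal R I" by simp
  show "a \<otimes> j \<in> I"
  proof (cases "{x \<in> carrier R. a \<otimes> x \<in> I} = carrier R")
    case True
    then show ?thesis using j by auto
  next
    case False
    then show ?thesis
      using maximal_right_ideal_vimage[OF I assms(1)] assms(2) unfolding jacobson_radical_def by blast
  qed
qed

lemma jacobson_radical_ideal: "ideal (jacobson_radical R) R"
proof (rule idealI)
  note J = submodule_jacobson_radical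
  show "subgroup (jacobson_radical R) (add_monoid R)"
  proof (intro subgroup.intro)
    fix x assume x: "x \<in> jacobson_radical R"
    then have "\<ominus> x \<in> jacobson_radical R"
      using submodule_smult[OF J, of "\<ominus> \<one>" x] jacobson_radical_closed[OF x] by (simp add: r_minus)
    then show "inv\<^bsub>add_monoid R\<^esub> x \<in> jacobson_radical R" by (simp add: a_inv_def)
  qed (use submodule_facts[OF J] in auto)
  show "x \<otimes> a \<in> jacobson_radical R" if "a \<in> jacobson_radical R" "x \<in> carrier R" for a x
    using that by (intro jacobson_radical_left_closed)
  show "a \<otimes> x \<in> jacobson_radical R" if "a \<in> jacobson_radical R" "x \<in> carrier R" for a x
    using submodule_smult[OF J that(2,1)] by simp
qed (rule ring_axioms)

text \<open>Otherwise the right ideal (1 + j)R is proper and lies in a maximal one, which also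
  contains \<open>j\<close> and therefore \<open>\<one>\<close>.\<close>

lemma jacobson_radical_right_inverse:
  assumes j: "j \<in> jacobson_radical R"
  shows "\<exists>b\<in>carrier R. (\<one> \<oplus> j) \<otimes> b = \<one>"
proof (rule ccontr)
  assume *: "\<not> (\<exists>b\<in>carrier R. (\<one> \<oplus> j) \<otimes> b = \<one>)"
  interpret reg: right_module R "regular_rmodule R" by (rule right_module_regular[OF ring_axioms])
  note jR = jacobson_radical_closed[OF j]
  let ?I = "(\<lambda>a. a \<odot>\<^bsub>regular_rmodule R\<^esub> (\<one> \<oplus> j)) ` carrier R"
  have "submodule ?I R (regular_rmodule R)" using jR by (intro reg.submodule_cyclic) simp
  moreover have "\<one> \<notin> ?I" using * by force
  ultimately obtain K where K: "maximal_right_ideal R K" "?I \<subseteq> K"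
    using exists_maximal_right_ideal by blast
  then have K': "submodule K R (regular_rmodule R)" "K \<noteq> carrier R" by (auto simp: maximal_right_ideal_def)
  have "j \<in> K" using j K(1) by (auto simp: jacobson_radical_def)
  then have "\<ominus>\<^bsub>R\<^esub> j \<in> K"
    using submodule_smult[OF K'(1), of "\<ominus> \<one>" j] jR by (simp add: r_minus)
  moreover have "\<one> \<oplus> j \<in> K"
    using K(2) jR by (auto simp: image_subset_iff dest!: bspec[of _ _ \<one>])
  ultimately have "(\<one> \<oplus> j) \<oplus> \<ominus> j \<in> K" using submodule_add[OF K'(1)] by simp
  then have "\<one> \<in> K" using jR by (simp add: a_assoc r_neg)
  then show False using submodule_regular_one K' by blast
qed

text \<open>A right inverse b of 1 + j equals 1 - jb, so it lies in 1 + J and has a right inverse c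
  of its own. Thus b has the left inverse 1 + j and the right inverse c; these agree, and b is a
  two-sided inverse.\<close>

lemma jacobson_radical_left_inverse:
  assumes j: "j \<in> jacobson_radical R"
  shows "\<exists>b\<in>carrier R. b \<otimes> (\<one> \<oplus> j) = \<one>"
proof -
  note jR = jacobson_radical_closed[OF j]
  obtain b where b: "b \<in> carrier R" "(\<one> \<oplus> j) \<otimes> b = \<one>"
    using jacobson_radical_right_inverse[OF j] by auto
  have "j \<otimes> (\<ominus> b) \<in> jacobson_radical R"
    using ideal.I_r_closed[OF jacobson_radical_ideal j, of "\<ominus> b"] b by simp
  then obtain c where c: "c \<in> carrier R" "(\<one> \<oplus> j \<otimes> (\<ominus> b)) \<otimes> c = \<one>"
    using jacobson_radical_right_inverse by blast
  have "b \<oplus> j \<otimes> b = \<one>" using b jR by (simp add: l_distr)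
  then have "\<one> \<oplus> j \<otimes> (\<ominus> b) = (b \<oplus> j \<otimes> b) \<oplus> \<ominus> (j \<otimes> b)" using b jR by (simp add: r_minus)
  also have "\<dots> = b" using b jR by (simp add: a_assoc r_neg)
  finally have "\<one> \<oplus> j \<otimes> (\<ominus> b) = b" .
  then have bc: "b \<otimes> c = \<one>" using c by simp
  have "\<one> \<oplus> j = (\<one> \<oplus> j) \<otimes> (b \<otimes> c)" using bc jR by simp
  also have "\<dots> = ((\<one> \<oplus> j) \<otimes> b) \<otimes> c" using b c jR by (intro m_assoc[symmetric]) auto
  also have "\<dots> = c" using b c by simp
  finally show ?thesis using bc b by auto
qed

end

section \<open>Dual bases of projective modules\<close>

definition dual_basis ::
  "('a, 'k) ring_scheme \<Rightarrow> ('a, 'b, 'm) module_scheme \<Rightarrow> ('b \<Rightarrow> 'b \<Rightarrow> 'a) \<Rightarrow> bool"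
  where "dual_basis R P l \<longleftrightarrow>
    (\<forall>k\<in>carrier P. l k \<in> rmod_hom R P (regular_rmodule R)) \<and>
    (\<forall>x\<in>carrier P. finite {k \<in> carrier P. l k x \<noteq> \<zero>\<^bsub>R\<^esub>} \<and>
      (\<Oplus>\<^bsub>P\<^esub>k\<in>{k \<in> carrier P. l k x \<noteq> \<zero>\<^bsub>R\<^esub>}. l k x \<odot>\<^bsub>P\<^esub> k) = x)"

text \<open>The functionals are the components of a splitting of the canonical surjection onto
  \<open>P\<close> from the free module on the set \<open>carrier P\<close>. All elements of
  \<open>P\<close> serve as generators, so the index \<open>k\<close> of a functional is itself the
  generator it belongs to.\<close>

lemma projective_dual_basis:
  assumes "projective_rmodule R P"
  shows "\<exists>l. dual_basis R P l"
proof -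
  interpret P: right_module R P using assms by (simp add: projective_rmodule_def)
  \<comment> \<open>The lifting property in \<open>projective_rmodule\<close> speaks of plain
    \<open>module\<close> records. \<open>C\<close> is \<open>P\<close> without its extension
    fields; sums formed in \<open>C\<close> are translated back by \<open>finsum_C\<close>.\<close>
  define C where "C = \<lparr>carrier = carrier P, monoid.mult = monoid.mult P, one = \<one>\<^bsub>P\<^esub>,
     ring.zero = \<zero>\<^bsub>P\<^esub>, ring.add = ring.add P, module.smult = module.smult P\<rparr>"
  have C_simps: "carrier C = carrier P" "ring.zero C = ring.zero P" "ring.add C = ring.add P"
    "module.smult C = module.smult P"
    by (simp_all add: C_def)
  have C: "right_module R C"
    by (rule right_module_image[OF P.right_module_axioms P.R.ring_axioms, of "\<lambda>a. a" C "\<lambda>x. x"])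
      (auto simp: C_simps)
  interpret C: right_module R C by (rule C)
  have finsum_C: "finsum C f K = finsum P f K" if "finite K" "f \<in> K \<rightarrow> carrier P" for f K
    using that by (induct K) (auto simp: C_simps Pi_def)
  let ?B = "direct_sum_rmodule (carrier P) (\<lambda>_. regular_rmodule R)"
  have reg: "right_module R (regular_rmodule R)" by (rule right_module_regular[OF P.R.ring_axioms])
  have B: "right_module R ?B"
    by (rule right_module_direct_sum[OF P.R.ring_axioms]) (rule reg)
  define g where "g = direct_sum_map (carrier P) (\<lambda>_. regular_rmodule R) C (\<lambda>k a. a \<odot>\<^bsub>P\<^esub> k)"
  have gk: "(\<lambda>a. a \<odot>\<^bsub>P\<^esub> k) \<in> rmod_hom R (regular_rmodule R) C" if "k \<in> carrier P" for k
    using that by (intro rmod_homI) (auto simp: C_simps P.smult_closed P.smult_l_distr P.smult_assoc)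
  have g: "g \<in> rmod_hom R ?B C"
    unfolding g_def by (rule direct_sum_map_hom[OF P.R.ring_axioms reg C gk])
  have "g ` carrier ?B = carrier C"
  proof
    show "g ` carrier ?B \<subseteq> carrier C" using rmod_hom_closed[OF g] by auto
    show "carrier C \<subseteq> g ` carrier ?B"
    proof
      fix x assume "x \<in> carrier C"
      then have x: "x \<in> carrier P" by (simp add: C_simps)
      let ?F = "direct_sum_single (carrier P) (\<lambda>_. regular_rmodule R) x \<one>\<^bsub>R\<^esub>"
      have "g ?F = x"
        unfolding g_def
        by (subst direct_sum_map_single[OF P.R.ring_axioms reg C gk]) (use x in \<open>auto simp: P.smult_one\<close>)
      moreover have "?F \<in> carrier ?B"
        by (rule rmod_hom_closed[OF direct_sum_single_hom[OF P.R.ring_axioms reg]]) (use x in auto)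
      ultimately show "x \<in> g ` carrier ?B" by (metis image_eqI)
    qed
  qed
  moreover have "(\<lambda>x. x) \<in> rmod_hom R P C"
    by (rule rmod_homI) (auto simp: C_simps)
  ultimately obtain h where h: "h \<in> rmod_hom R P ?B" "\<And>x. x \<in> carrier P \<Longrightarrow> g (h x) = x"
    using assms B C g unfolding projective_rmodule_def by blast
  have "dual_basis R P (\<lambda>k x. h x k)"
    unfolding dual_basis_def
  proof (intro conjI ballI)
    fix k assume "k \<in> carrier P"
    then show "(\<lambda>x. h x k) \<in> rmod_hom R P (regular_rmodule R)"
      by (rule rmod_hom_comp[OF direct_sum_component_hom[OF P.R.ring_axioms reg] h(1)])
  next
    fix x assume x: "x \<in> carrier P"
    show "finite {k \<in> carrier P. h x k \<noteq> \<zero>\<^bsub>R\<^esub>}"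
      using rmod_hom_closed[OF h(1) x] by (simp add: direct_sum_carrier)
    show "(\<Oplus>\<^bsub>P\<^esub>k\<in>{k \<in> carrier P. h x k \<noteq> \<zero>\<^bsub>R\<^esub>}. h x k \<odot>\<^bsub>P\<^esub> k) = x"
      using h(2)[OF x] rmod_hom_closed[OF h(1) x] unfolding g_def direct_sum_map_def
      by (subst (asm) finsum_C) (auto simp: direct_sum_carrier PiE_iff intro!: P.smult_closed)
  qed
  then show ?thesis by blast
qed

text \<open>Enlarging the support by zero terms lets several elements be expanded over one common
  finite set \<open>K\<close>.\<close>

lemma dual_basis_expand:
  assumes P: "right_module R P" and l: "dual_basis R P l" and x: "x \<in> carrier P"
    and K: "finite K" "K \<subseteq> carrier P" "{k \<in> carrier P. l k x \<noteq> \<zero>\<^bsub>R\<^esub>} \<subseteq> K"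
  shows "(\<Oplus>\<^bsub>P\<^esub>k\<in>K. l k x \<odot>\<^bsub>P\<^esub> k) = x"
proof -
  interpret P: right_module R P by fact
  have lk: "l k x \<in> carrier R" if "k \<in> carrier P" for k
    using l that x rmod_hom_closed[of "l k" R P "regular_rmodule R" x] by (auto simp: dual_basis_def)
  have "(\<Oplus>\<^bsub>P\<^esub>k\<in>{k \<in> carrier P. l k x \<noteq> \<zero>\<^bsub>R\<^esub>}. l k x \<odot>\<^bsub>P\<^esub> k) = (\<Oplus>\<^bsub>P\<^esub>k\<in>K. l k x \<odot>\<^bsub>P\<^esub> k)"
    by (rule P.M.add.finprod_mono_neutral_cong_left)
      (use K lk in \<open>auto simp: P.smult_closed P.smult_zero_left\<close>)
  then show ?thesis using l x by (simp add: dual_basis_def)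
qed

lemma dual_basis_hom:
  "dual_basis R P l \<Longrightarrow> k \<in> carrier P \<Longrightarrow> l k \<in> rmod_hom R P (regular_rmodule R)"
  by (simp add: dual_basis_def)

text \<open>In right module notation the map is x |-> y l(x); the scalar stands on the right of
  \<open>y\<close>, so linearity is the associativity law of the action.\<close>

lemma rank_one_hom:
  assumes N: "right_module R N" and l: "l \<in> rmod_hom R M (regular_rmodule R)" and y: "y \<in> carrier N"
  shows "(\<lambda>x. l x \<odot>\<^bsub>N\<^esub> y) \<in> rmod_hom R M N"
proof -
  interpret N: right_module R N by fact
  note lc = rmod_hom_closed[OF l, simplified]
  show ?thesis
    using y lc
    by (intro rmod_homI)
      (auto simp: rmod_hom_add[OF l] rmod_hom_smult[OF l] N.smult_closed N.smult_l_distr N.smult_assoc)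
qed

text \<open>If \<open>T\<close> undoes the perturbation by the terms in \<open>K\<close>, then after
  applying \<open>T\<close> the new term turns the identity into x |-> x + q \<mu>(x) with q = T(p
  k). This map multiplies \<mu>(x) by 1 + \<mu>(q), so left invertibility moves from the module to
  the ring, where \<mu>(q) is in the radical.\<close>

lemma one_plus_finite_rank_left_invertible:
  assumes P: "right_module R P" and K: "finite K" "p \<in> K \<rightarrow> carrier P"
    and \<mu>: "\<And>k. k \<in> K \<Longrightarrow> \<mu> k \<in> rmod_hom R P (regular_rmodule R)"
      "\<And>k x. k \<in> K \<Longrightarrow> x \<in> carrier P \<Longrightarrow> \<mu> k x \<in> jacobson_radical R"
  shows "\<exists>T\<in>rmod_hom R P P. \<forall>x\<in>carrier P. T (x \<oplus>\<^bsub>P\<^esub> (\<Oplus>\<^bsub>P\<^esub>k\<in>K. \<mu> k x \<odot>\<^bsub>P\<^esub> p k)) = x"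
proof -
  interpret P: right_module R P by fact
  from K \<mu> show ?thesis
  proof (induct K)
    case empty
    then show ?case using rmod_hom_id by (intro bexI[of _ "\<lambda>x. x"]) auto
  next
    case (insert k K)
    then obtain T where T: "T \<in> rmod_hom R P P"
      and Tx: "\<And>x. x \<in> carrier P \<Longrightarrow> T (x \<oplus>\<^bsub>P\<^esub> (\<Oplus>\<^bsub>P\<^esub>k\<in>K. \<mu> k x \<odot>\<^bsub>P\<^esub> p k)) = x"
      by (auto simp: Pi_def)
    define q where "q = T (p k)"
    have pk: "p k \<in> carrier P" using insert by auto
    have q: "q \<in> carrier P" using rmod_hom_closed[OF T pk] by (simp add: q_def)
    have \<mu>k: "\<mu> k \<in> rmod_hom R P (regular_rmodule R)" using insert by auto
    note \<mu>c = rmod_hom_closed[OF \<mu>k, simplified]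
    obtain a where a: "a \<in> carrier R" "a \<otimes>\<^bsub>R\<^esub> (\<one>\<^bsub>R\<^esub> \<oplus>\<^bsub>R\<^esub> \<mu> k q) = \<one>\<^bsub>R\<^esub>"
      using P.R.jacobson_radical_left_inverse[of "\<mu> k q"] insert q by auto
    \<comment> \<open>the left inverse of the rank one perturbation \<open>x \<mapsto> x + q \<mu>(x)\<close>\<close>
    define V where "V = (\<lambda>z. z \<ominus>\<^bsub>P\<^esub> (a \<otimes>\<^bsub>R\<^esub> \<mu> k z) \<odot>\<^bsub>P\<^esub> q)"
    have V: "V \<in> rmod_hom R P P"
      unfolding V_def
      by (intro rmod_hom_pointwise_minus rank_one_hom P q rmod_hom_id
          rmod_hom_comp[OF P.R.left_mult_hom[OF a(1)] \<mu>k])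
    have "V (T (x \<oplus>\<^bsub>P\<^esub> (\<Oplus>\<^bsub>P\<^esub>k\<in>insert k K. \<mu> k x \<odot>\<^bsub>P\<^esub> p k))) = x" if x: "x \<in> carrier P" for x
    proof -
      have c: "\<mu> i x \<odot>\<^bsub>P\<^esub> p i \<in> carrier P" if "i \<in> insert k K" for i
        using rmod_hom_closed[OF insert(5)[OF that] x] insert(4) that by (auto intro!: P.smult_closed)
      have fs: "(\<Oplus>\<^bsub>P\<^esub>i\<in>K. \<mu> i x \<odot>\<^bsub>P\<^esub> p i) \<in> carrier P"
        using c by (auto intro!: P.M.finsum_closed)
      have "(\<Oplus>\<^bsub>P\<^esub>i\<in>insert k K. \<mu> i x \<odot>\<^bsub>P\<^esub> p i) = \<mu> k x \<odot>\<^bsub>P\<^esub> p k \<oplus>\<^bsub>P\<^esub> (\<Oplus>\<^bsub>P\<^esub>i\<in>K. \<mu> i x \<odot>\<^bsub>P\<^esub> p i)"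
        using insert(1,2) c by (intro P.M.finsum_insert) auto
      then have "x \<oplus>\<^bsub>P\<^esub> (\<Oplus>\<^bsub>P\<^esub>i\<in>insert k K. \<mu> i x \<odot>\<^bsub>P\<^esub> p i) =
          (x \<oplus>\<^bsub>P\<^esub> (\<Oplus>\<^bsub>P\<^esub>i\<in>K. \<mu> i x \<odot>\<^bsub>P\<^esub> p i)) \<oplus>\<^bsub>P\<^esub> \<mu> k x \<odot>\<^bsub>P\<^esub> p k"
        using c fs x by (simp add: P.M.a_ac)
      then have "T (x \<oplus>\<^bsub>P\<^esub> (\<Oplus>\<^bsub>P\<^esub>i\<in>insert k K. \<mu> i x \<odot>\<^bsub>P\<^esub> p i)) =
          T (x \<oplus>\<^bsub>P\<^esub> (\<Oplus>\<^bsub>P\<^esub>i\<in>K. \<mu> i x \<odot>\<^bsub>P\<^esub> p i)) \<oplus>\<^bsub>P\<^esub> T (\<mu> k x \<odot>\<^bsub>P\<^esub> p k)"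
        using c fs x by (simp add: rmod_hom_add[OF T])
      also have "\<dots> = x \<oplus>\<^bsub>P\<^esub> \<mu> k x \<odot>\<^bsub>P\<^esub> q"
        using Tx[OF x] x \<mu>c pk by (simp add: q_def rmod_hom_smult[OF T])
      finally have TT: "T (x \<oplus>\<^bsub>P\<^esub> (\<Oplus>\<^bsub>P\<^esub>i\<in>insert k K. \<mu> i x \<odot>\<^bsub>P\<^esub> p i)) = x \<oplus>\<^bsub>P\<^esub> \<mu> k x \<odot>\<^bsub>P\<^esub> q" .
      \<comment> \<open>The functional sees the perturbed element as (1 + \<mu>(q)) \<mu>(x), so
        multiplying by \<open>a\<close> recovers the coefficient \<mu>(x), and \<open>V\<close>
        subtracts exactly the term that was added.\<close>
      have "a \<otimes>\<^bsub>R\<^esub> \<mu> k (x \<oplus>\<^bsub>P\<^esub> \<mu> k x \<odot>\<^bsub>P\<^esub> q) = a \<otimes>\<^bsub>R\<^esub> (\<mu> k x \<oplus>\<^bsub>R\<^esub> \<mu> k q \<otimes>\<^bsub>R\<^esub> \<mu> k x)"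
        using x q \<mu>c by (simp add: rmod_hom_add[OF \<mu>k] rmod_hom_smult[OF \<mu>k] P.smult_closed)
      also have "\<dots> = a \<otimes>\<^bsub>R\<^esub> ((\<one>\<^bsub>R\<^esub> \<oplus>\<^bsub>R\<^esub> \<mu> k q) \<otimes>\<^bsub>R\<^esub> \<mu> k x)"
        using x q \<mu>c a by (simp add: P.R.l_distr)
      also have "\<dots> = \<mu> k x"
        using x q \<mu>c a by (simp add: P.R.m_assoc[symmetric])
      finally have "V (x \<oplus>\<^bsub>P\<^esub> \<mu> k x \<odot>\<^bsub>P\<^esub> q) = x \<oplus>\<^bsub>P\<^esub> \<mu> k x \<odot>\<^bsub>P\<^esub> q \<ominus>\<^bsub>P\<^esub> \<mu> k x \<odot>\<^bsub>P\<^esub> q"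
        by (simp add: V_def)
      also have "\<dots> = x"
        using x q \<mu>c by (simp add: a_minus_def P.smult_closed P.M.a_assoc P.M.r_neg)
      finally show ?thesis by (simp add: TT)
    qed
    then show ?case by (intro bexI[OF _ rmod_hom_comp[OF V T]]) auto
  qed
qed

lemma submodule_rmod_ideal_mult:
  assumes "right_module R M" "I \<subseteq> carrier R"
  shows "submodule (rmod_ideal_mult R M I) R M"
proof -
  interpret right_module R M by fact
  show ?thesis
    unfolding rmod_ideal_mult_def using assms(2) smult_closed by (intro submodule_span) auto
qed

text \<open>On generators l(xa) = l(x)a, which lies in \<open>I\<close> by closure under
  multiplication from the left. For the radical this is where its two-sidedness enters: the
  coefficients of the perturbation are in J.\<close>

lemma hom_rmod_ideal_mult:
  assumes M: "right_module R M" and I: "ideal I R" and l: "l \<in> rmod_hom R M (regular_rmodule R)"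
    and x: "x \<in> rmod_ideal_mult R M I"
  shows "l x \<in> I"
proof -
  interpret M: right_module R M by fact
  interpret I: ideal I R by fact
  have "submodule I R (regular_rmodule R)"
    by (rule right_module.submoduleI'[OF right_module_regular[OF M.R.ring_axioms]])
      (auto simp: I.I_r_closed)
  then have "submodule {x \<in> carrier M. l x \<in> I} R M"
    by (rule submodule_vimage[OF M right_module_regular[OF M.R.ring_axioms] l])
  then have "rmod_ideal_mult R M I \<subseteq> {x \<in> carrier M. l x \<in> I}"
    unfolding rmod_ideal_mult_def using rmod_hom_closed[OF l]
    by (intro M.span_least) (auto simp: rmod_hom_smult[OF l] I.I_l_closed M.smult_closed)
  then show ?thesis using x by blast
qed

lemma left_inverse_on_finite_set:
  assumes P: "projective_rmodule R P" and h: "h \<in> rmod_hom R P P"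
    and hJ: "\<And>x. x \<in> carrier P \<Longrightarrow> h x \<in> rmod_ideal_mult R P (jacobson_radical R)"
    and Z: "finite Z" "Z \<subseteq> carrier P"
  shows "\<exists>w\<in>rmod_hom R P P. \<forall>x\<in>Z. w (x \<oplus>\<^bsub>P\<^esub> h x) = x"
proof -
  have P': "right_module R P" using P by (simp add: projective_rmodule_def)
  interpret P: right_module R P by fact
  obtain l where l: "dual_basis R P l" using projective_dual_basis[OF P] ..
  note lh = dual_basis_hom[OF l]
  define K where "K = (\<Union>x\<in>Z. {k \<in> carrier P. l k x \<noteq> \<zero>\<^bsub>R\<^esub>})"
  have K: "finite K" "K \<subseteq> carrier P"
    using Z l by (auto simp: K_def dual_basis_def)
  define e where "e = (\<lambda>x. \<Oplus>\<^bsub>P\<^esub>k\<in>K. l k x \<odot>\<^bsub>P\<^esub> k)"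
  have e: "e \<in> rmod_hom R P P"
    unfolding e_def using K by (intro rmod_hom_pointwise_finsum rank_one_hom P' lh) auto
  have ex: "e x = x" if "x \<in> Z" for x
    unfolding e_def using that Z by (intro dual_basis_expand[OF P' l _ K]) (auto simp: K_def)
  have "\<exists>T\<in>rmod_hom R P P. \<forall>x\<in>carrier P. T (x \<oplus>\<^bsub>P\<^esub> (\<Oplus>\<^bsub>P\<^esub>k\<in>K. l k (h x) \<odot>\<^bsub>P\<^esub> k)) = x"
    using K rmod_hom_comp[OF lh h] hom_rmod_ideal_mult[OF P' P.R.jacobson_radical_ideal lh hJ]
    by (intro one_plus_finite_rank_left_invertible[OF P' K(1)]) auto
  then obtain T where T: "T \<in> rmod_hom R P P" "\<And>x. x \<in> carrier P \<Longrightarrow> T (x \<oplus>\<^bsub>P\<^esub> e (h x)) = x"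
    by (auto simp: e_def)
  \<comment> \<open>On \<open>Z\<close> the map \<open>e\<close> is the identity, so e(x + h x) = x
    + e(h x), which \<open>T\<close> sends back to x. The map sought is therefore \<open>T\<close>
    after \<open>e\<close>.\<close>
  have "T (e (x \<oplus>\<^bsub>P\<^esub> h x)) = x" if "x \<in> Z" for x
    using that Z T(2)[of x] ex[of x] rmod_hom_closed[OF h] by (auto simp: rmod_hom_add[OF e] subset_iff)
  then show ?thesis
    by (intro bexI[OF _ rmod_hom_comp[OF T(1) e]]) auto
qed

text \<open>The expansions of the elements of \<open>Z\<close> in a dual basis form a linear system
  with constants in \<open>N\<close> that is solved in \<open>Q\<close> by the generators
  themselves. Purity replaces the generators by vectors of \<open>N\<close>, and keeping the
  coordinate functionals turns this solution into an endomorphism.\<close>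

lemma pure_submodule_retraction:
  assumes Q: "projective_rmodule R Q" and N: "pure_submodule R Q N"
    and Z: "finite Z" "Z \<subseteq> N"
  shows "\<exists>\<theta>\<in>rmod_hom R Q Q. \<theta> ` carrier Q \<subseteq> N \<and> (\<forall>x\<in>Z. \<theta> x = x)"
proof -
  have Q': "right_module R Q" using Q by (simp add: projective_rmodule_def)
  interpret Q: right_module R Q by fact
  have subN: "submodule N R Q" using N by (simp add: pure_submodule_def)
  note NQ = submodule_subset[OF subN]
  obtain l where l: "dual_basis R Q l" using projective_dual_basis[OF Q] ..
  note lh = dual_basis_hom[OF l]
  define K where "K = (\<Union>x\<in>Z. {k \<in> carrier Q. l k x \<noteq> \<zero>\<^bsub>R\<^esub>})"
  have K: "finite K" "K \<subseteq> carrier Q"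
    using Z l NQ by (auto simp: K_def dual_basis_def)
  have ex: "(\<Oplus>\<^bsub>Q\<^esub>k\<in>K. l k x \<odot>\<^bsub>Q\<^esub> k) = x" if "x \<in> Z" for x
    using that Z NQ by (intro dual_basis_expand[OF Q' l _ K]) (auto simp: K_def)
  \<comment> \<open>Purity is stated for systems indexed by initial segments of the naturals:
    \<open>u\<close> numbers the equations, one for each element of \<open>Z\<close>, and
    \<open>v\<close> numbers the unknowns, one for each generator in \<open>K\<close>.\<close>
  obtain u m where u: "Z = u ` {..<m::nat}" 
    using finite_imp_nat_seg_image_inj_on[OF Z(1)] by (auto simp: lessThan_def)
  obtain v where v: "bij_betw v {..<card K} K"
    using ex_bij_betw_nat_finite[OF K(1)] by (auto simp: atLeast0LessThan)
  have vK: "v j \<in> carrier Q" if "j < card K" for j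
    using v that K(2) by (auto simp: bij_betw_def)
  have reindex: "(\<Oplus>\<^bsub>Q\<^esub>k\<in>K. f k) = (\<Oplus>\<^bsub>Q\<^esub>j\<in>{..<card K}. f (v j))" if "f \<in> K \<rightarrow> carrier Q" for f
    using v that Q.M.finsum_reindex[of f v "{..<card K}"] by (auto simp: bij_betw_def)
  define a where "a = (\<lambda>j i. l (v j) (u i))"
  have uN: "u i \<in> N" "u i \<in> carrier Q" if "i < m" for i using u that Z NQ by auto
  have aR: "a j i \<in> carrier R" if "j < card K" "i < m" for i j
    using rmod_hom_closed[OF lh[OF vK[OF that(1)]] uN(2)[OF that(2)]] by (simp add: a_def)
  have "(\<Oplus>\<^bsub>Q\<^esub>j\<in>{..<card K}. a j i \<odot>\<^bsub>Q\<^esub> v j) = u i" if "i < m" for i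
  proof -
    have "(\<lambda>k. l k (u i) \<odot>\<^bsub>Q\<^esub> k) \<in> K \<rightarrow> carrier Q"
      using rmod_hom_closed[OF lh uN(2)[OF that]] K(2) by (auto intro!: Q.smult_closed)
    then show ?thesis using reindex[of "\<lambda>k. l k (u i) \<odot>\<^bsub>Q\<^esub> k"] ex[of "u i"] that u by (simp add: a_def)
  qed
  then have "\<exists>y. (\<forall>j<card K. y j \<in> N) \<and> (\<forall>i<m. (\<Oplus>\<^bsub>Q\<^esub>j\<in>{..<card K}. a j i \<odot>\<^bsub>Q\<^esub> y j) = u i)"
    using N aR uN vK unfolding pure_submodule_def by blast
  then obtain y where y: "\<And>j. j < card K \<Longrightarrow> y j \<in> N"
    "\<And>i. i < m \<Longrightarrow> (\<Oplus>\<^bsub>Q\<^esub>j\<in>{..<card K}. a j i \<odot>\<^bsub>Q\<^esub> y j) = u i" by blast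
  \<comment> \<open>The i-th equation of the solved system says precisely that
    \<open>\<theta>\<close> fixes \<open>u i\<close>.\<close>
  define \<theta> where "\<theta> = (\<lambda>x. \<Oplus>\<^bsub>Q\<^esub>j\<in>{..<card K}. l (v j) x \<odot>\<^bsub>Q\<^esub> y j)"
  have "\<theta> \<in> rmod_hom R Q Q"
    unfolding \<theta>_def using y(1) NQ vK by (intro rmod_hom_pointwise_finsum rank_one_hom Q' lh) auto
  moreover have "\<theta> x \<in> N" if "x \<in> carrier Q" for x
    unfolding \<theta>_def using rmod_hom_closed[OF lh[OF vK] that] y(1)
    by (intro Q.submodule_finsum[OF subN] submodule_smult[OF subN]) auto
  moreover have "\<theta> x = x" if "x \<in> Z" for x
    using that u y(2) by (auto simp: \<theta>_def a_def)
  ultimately show ?thesis by blast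
qed

section \<open>Minimal right ideals of semisimple rings\<close>

text \<open>
  The laws needed to decompose the identity of a product of matrix rings; verifying only them
  avoids the proof that matrix multiplication is associative.
\<close>

definition zero_laws :: "('a, 'k) ring_scheme \<Rightarrow> bool"
  where "zero_laws B \<longleftrightarrow>
    \<zero>\<^bsub>B\<^esub> \<in> carrier B \<and> \<one>\<^bsub>B\<^esub> \<in> carrier B \<and>
    (\<forall>x\<in>carrier B. \<zero>\<^bsub>B\<^esub> \<oplus>\<^bsub>B\<^esub> x = x \<and> x \<oplus>\<^bsub>B\<^esub> \<zero>\<^bsub>B\<^esub> = x \<and> \<zero>\<^bsub>B\<^esub> \<otimes>\<^bsub>B\<^esub> x = \<zero>\<^bsub>B\<^esub> \<and>
      (\<forall>y\<in>carrier B. x \<oplus>\<^bsub>B\<^esub> y \<in> carrier B \<and> x \<otimes>\<^bsub>B\<^esub> y \<in> carrier B))"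

text \<open>
  The right ideals \<open>e B\<close>, \<open>e \<in> E\<close>, are zero or minimal, and \<open>1\<close> is a sum of elements of \<open>E\<close>.
\<close>

definition minimal_generators :: "('a, 'k) ring_scheme \<Rightarrow> 'a set \<Rightarrow> bool"
  where "minimal_generators B E \<longleftrightarrow> finite E \<and> E \<subseteq> carrier B \<and>
    (\<forall>L. L \<subseteq> carrier B \<longrightarrow> E \<subseteq> L \<longrightarrow> \<zero>\<^bsub>B\<^esub> \<in> L \<longrightarrow> (\<forall>x\<in>L. \<forall>y\<in>L. x \<oplus>\<^bsub>B\<^esub> y \<in> L) \<longrightarrow> \<one>\<^bsub>B\<^esub> \<in> L) \<and>
    (\<forall>e\<in>E. \<forall>a\<in>carrier B. e \<otimes>\<^bsub>B\<^esub> a = \<zero>\<^bsub>B\<^esub> \<or> (\<exists>b\<in>carrier B. (e \<otimes>\<^bsub>B\<^esub> a) \<otimes>\<^bsub>B\<^esub> b = e))"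

text \<open>Compatibility with zero is a separate hypothesis: \<open>ring_iso\<close> speaks of
  sums, products and the identity, and nothing yet ties the zero field of \<open>C\<close> to its
  addition.\<close>

lemma zero_laws_iso:
  assumes B: "zero_laws B" and h: "h \<in> ring_iso B C" and h0: "h \<zero>\<^bsub>B\<^esub> = \<zero>\<^bsub>C\<^esub>"
  shows "zero_laws C"
proof -
  have hC: "carrier C = h ` carrier B" and h1: "\<one>\<^bsub>C\<^esub> = h \<one>\<^bsub>B\<^esub>"
    using h by (auto simp: ring_iso_def ring_hom_def bij_betw_def)
  have hom: "h x \<oplus>\<^bsub>C\<^esub> h y = h (x \<oplus>\<^bsub>B\<^esub> y)" "h x \<otimes>\<^bsub>C\<^esub> h y = h (x \<otimes>\<^bsub>B\<^esub> y)"
    if "x \<in> carrier B" "y \<in> carrier B" for x y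
    using h that by (auto simp: ring_iso_def ring_hom_def)
  show ?thesis
    using B unfolding zero_laws_def hC h1 h0[symmetric] by (auto simp: hom)
qed

lemma minimal_generators_iso:
  assumes B: "zero_laws B" and E: "minimal_generators B E"
    and h: "h \<in> ring_iso B C" and h0: "h \<zero>\<^bsub>B\<^esub> = \<zero>\<^bsub>C\<^esub>"
  shows "minimal_generators C (h ` E)"
proof -
  have hC: "carrier C = h ` carrier B" and h1: "\<one>\<^bsub>C\<^esub> = h \<one>\<^bsub>B\<^esub>" and inj: "inj_on h (carrier B)"
    using h by (auto simp: ring_iso_def ring_hom_def bij_betw_def)
  have hom: "h x \<oplus>\<^bsub>C\<^esub> h y = h (x \<oplus>\<^bsub>B\<^esub> y)" "h x \<otimes>\<^bsub>C\<^esub> h y = h (x \<otimes>\<^bsub>B\<^esub> y)"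
    if "x \<in> carrier B" "y \<in> carrier B" for x y
    using h that by (auto simp: ring_iso_def ring_hom_def)
  have clos: "x \<oplus>\<^bsub>B\<^esub> y \<in> carrier B" "x \<otimes>\<^bsub>B\<^esub> y \<in> carrier B" if "x \<in> carrier B" "y \<in> carrier B" for x y
    using B that by (auto simp: zero_laws_def)
  have one: "\<one>\<^bsub>B\<^esub> \<in> carrier B" "\<zero>\<^bsub>B\<^esub> \<in> carrier B" using B by (auto simp: zero_laws_def)
  have EB: "E \<subseteq> carrier B" using E by (auto simp: minimal_generators_def)
  show ?thesis
    unfolding minimal_generators_def
  proof (intro conjI ballI allI impI)
    show "finite (h ` E)" "h ` E \<subseteq> carrier C" using E hC by (auto simp: minimal_generators_def)
  next
    fix L assume L: "L \<subseteq> carrier C" "h ` E \<subseteq> L" "\<zero>\<^bsub>C\<^esub> \<in> L" "\<forall>x\<in>L. \<forall>y\<in>L. x \<oplus>\<^bsub>C\<^esub> y \<in> L"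
    let ?L = "{x \<in> carrier B. h x \<in> L}"
    have "\<forall>x\<in>?L. \<forall>y\<in>?L. x \<oplus>\<^bsub>B\<^esub> y \<in> ?L"
      using L(4) clos(1) by (auto simp: hom(1)[symmetric])
    moreover have "E \<subseteq> ?L" "\<zero>\<^bsub>B\<^esub> \<in> ?L" using L EB one h0 by auto
    ultimately have "\<one>\<^bsub>B\<^esub> \<in> ?L"
      using E unfolding minimal_generators_def by (metis (no_types, lifting) mem_Collect_eq subsetI)
    then show "\<one>\<^bsub>C\<^esub> \<in> L" using h1 by simp
  next
    fix e a assume "e \<in> h ` E" and "a \<in> carrier C"
    then obtain f u where f: "f \<in> E" "f \<in> carrier B" "e = h f" and u: "u \<in> carrier B" "a = h u"
      using EB hC by auto
    from E f(1) u(1) consider "f \<otimes>\<^bsub>B\<^esub> u = \<zero>\<^bsub>B\<^esub>" | b where "b \<in> carrier B" "(f \<otimes>\<^bsub>B\<^esub> u) \<otimes>\<^bsub>B\<^esub> b = f"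
      unfolding minimal_generators_def by blast
    then show "e \<otimes>\<^bsub>C\<^esub> a = \<zero>\<^bsub>C\<^esub> \<or> (\<exists>b\<in>carrier C. (e \<otimes>\<^bsub>C\<^esub> a) \<otimes>\<^bsub>C\<^esub> b = e)"
    proof cases
      case 1
      then show ?thesis using f u h0 by (simp add: hom)
    next
      case (2 b)
      then show ?thesis using f u hC clos by (intro disjI2 bexI[of _ "h b"]) (auto simp: hom)
    qed
  qed
qed

section \<open>Direct products\<close>

lemma RDirProd_simps:
  "carrier (RDirProd B C) = carrier B \<times> carrier C"
  "\<zero>\<^bsub>RDirProd B C\<^esub> = (\<zero>\<^bsub>B\<^esub>, \<zero>\<^bsub>C\<^esub>)" "\<one>\<^bsub>RDirProd B C\<^esub> = (\<one>\<^bsub>B\<^esub>, \<one>\<^bsub>C\<^esub>)"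
  "(x, y) \<oplus>\<^bsub>RDirProd B C\<^esub> (x', y') = (x \<oplus>\<^bsub>B\<^esub> x', y \<oplus>\<^bsub>C\<^esub> y')"
  "(x, y) \<otimes>\<^bsub>RDirProd B C\<^esub> (x', y') = (x \<otimes>\<^bsub>B\<^esub> x', y \<otimes>\<^bsub>C\<^esub> y')"
  by (simp_all add: RDirProd_def DirProd_def monoid.defs)

lemma zero_laws_RDirProd:
  "zero_laws B \<Longrightarrow> zero_laws C \<Longrightarrow> zero_laws (RDirProd B C)"
  by (auto simp: zero_laws_def RDirProd_simps)

text \<open>The right ideal of (e, 0) is eB x 0, so minimality is inherited from the factor, with
  witnesses padded by zero. The identity is (1, 0) + (0, 1).\<close>

lemma minimal_generators_RDirProd:
  assumes B: "zero_laws B" "minimal_generators B E" and C: "zero_laws C" "minimal_generators C F"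
  shows "minimal_generators (RDirProd B C) ((\<lambda>e. (e, \<zero>\<^bsub>C\<^esub>)) ` E \<union> (\<lambda>f. (\<zero>\<^bsub>B\<^esub>, f)) ` F)"
  unfolding minimal_generators_def
proof (intro conjI ballI allI impI)
  have EB: "E \<subseteq> carrier B" "F \<subseteq> carrier C" "finite E" "finite F"
    using B C by (auto simp: minimal_generators_def)
  note lB = B(1)[unfolded zero_laws_def] and lC = C(1)[unfolded zero_laws_def]
  show "finite ((\<lambda>e. (e, \<zero>\<^bsub>C\<^esub>)) ` E \<union> (\<lambda>f. (\<zero>\<^bsub>B\<^esub>, f)) ` F)" using EB by auto
  show "(\<lambda>e. (e, \<zero>\<^bsub>C\<^esub>)) ` E \<union> (\<lambda>f. (\<zero>\<^bsub>B\<^esub>, f)) ` F \<subseteq> carrier (RDirProd B C)"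
    using EB lB lC by (auto simp: RDirProd_simps)
  show "\<one>\<^bsub>RDirProd B C\<^esub> \<in> L"
    if L: "L \<subseteq> carrier (RDirProd B C)" "(\<lambda>e. (e, \<zero>\<^bsub>C\<^esub>)) ` E \<union> (\<lambda>f. (\<zero>\<^bsub>B\<^esub>, f)) ` F \<subseteq> L"
      "\<zero>\<^bsub>RDirProd B C\<^esub> \<in> L" "\<forall>x\<in>L. \<forall>y\<in>L. x \<oplus>\<^bsub>RDirProd B C\<^esub> y \<in> L" for L
  proof -
    \<comment> \<open>The slices of \<open>L\<close> along the two axes; each is closed under sums
      in its factor and contains the generators there, so it contains the identity of that
      factor.\<close>
    let ?M = "{x \<in> carrier B. (x, \<zero>\<^bsub>C\<^esub>) \<in> L}" and ?N = "{y \<in> carrier C. (\<zero>\<^bsub>B\<^esub>, y) \<in> L}"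
    have add: "(x \<oplus>\<^bsub>B\<^esub> x', y \<oplus>\<^bsub>C\<^esub> y') \<in> L" if "(x, y) \<in> L" "(x', y') \<in> L" for x x' y y'
      using L(4)[rule_format, OF that] by (simp add: RDirProd_simps)
    have "\<forall>x\<in>?M. \<forall>y\<in>?M. x \<oplus>\<^bsub>B\<^esub> y \<in> ?M"
      using add[of _ "\<zero>\<^bsub>C\<^esub>" _ "\<zero>\<^bsub>C\<^esub>"] lB lC by auto
    moreover have "E \<subseteq> ?M" "\<zero>\<^bsub>B\<^esub> \<in> ?M" "?M \<subseteq> carrier B"
      using L(2,3) EB lB by (auto simp: RDirProd_simps)
    ultimately have 1: "\<one>\<^bsub>B\<^esub> \<in> ?M"
      using B(2) unfolding minimal_generators_def by blast
    have "\<forall>x\<in>?N. \<forall>y\<in>?N. x \<oplus>\<^bsub>C\<^esub> y \<in> ?N"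
      using add[of "\<zero>\<^bsub>B\<^esub>" _ "\<zero>\<^bsub>B\<^esub>"] lB lC by auto
    moreover have "F \<subseteq> ?N" "\<zero>\<^bsub>C\<^esub> \<in> ?N" "?N \<subseteq> carrier C"
      using L(2,3) EB lC by (auto simp: RDirProd_simps)
    ultimately have "\<one>\<^bsub>C\<^esub> \<in> ?N"
      using C(2) unfolding minimal_generators_def by blast
    with 1 show ?thesis
      using add[of "\<one>\<^bsub>B\<^esub>" "\<zero>\<^bsub>C\<^esub>" "\<zero>\<^bsub>B\<^esub>" "\<one>\<^bsub>C\<^esub>"] lB lC by (auto simp: RDirProd_simps)
  qed
  fix e a assume e: "e \<in> (\<lambda>e. (e, \<zero>\<^bsub>C\<^esub>)) ` E \<union> (\<lambda>f. (\<zero>\<^bsub>B\<^esub>, f)) ` F"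
    and "a \<in> carrier (RDirProd B C)"
  then obtain u v where a: "a = (u, v)" "u \<in> carrier B" "v \<in> carrier C" by (auto simp: RDirProd_simps)
  from e show "e \<otimes>\<^bsub>RDirProd B C\<^esub> a = \<zero>\<^bsub>RDirProd B C\<^esub> \<or>
      (\<exists>b\<in>carrier (RDirProd B C). (e \<otimes>\<^bsub>RDirProd B C\<^esub> a) \<otimes>\<^bsub>RDirProd B C\<^esub> b = e)"
  proof
    assume "e \<in> (\<lambda>e. (e, \<zero>\<^bsub>C\<^esub>)) ` E"
    then obtain f where f: "f \<in> E" "e = (f, \<zero>\<^bsub>C\<^esub>)" by auto
    from B(2) f(1) a(2) consider "f \<otimes>\<^bsub>B\<^esub> u = \<zero>\<^bsub>B\<^esub>" | b where "b \<in> carrier B" "(f \<otimes>\<^bsub>B\<^esub> u) \<otimes>\<^bsub>B\<^esub> b = f"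
      unfolding minimal_generators_def by blast
    then show ?thesis
    proof cases
      case 1
      then show ?thesis using a f lC by (simp add: RDirProd_simps)
    next
      case (2 b)
      then show ?thesis
        using a f lC by (intro disjI2 bexI[of _ "(b, \<zero>\<^bsub>C\<^esub>)"]) (auto simp: RDirProd_simps)
    qed
  next
    assume "e \<in> (\<lambda>f. (\<zero>\<^bsub>B\<^esub>, f)) ` F"
    then obtain f where f: "f \<in> F" "e = (\<zero>\<^bsub>B\<^esub>, f)" by auto
    from C(2) f(1) a(3) consider "f \<otimes>\<^bsub>C\<^esub> v = \<zero>\<^bsub>C\<^esub>" | b where "b \<in> carrier C" "(f \<otimes>\<^bsub>C\<^esub> v) \<otimes>\<^bsub>C\<^esub> b = f"
      unfolding minimal_generators_def by blast
    then show ?thesis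
    proof cases
      case 1
      then show ?thesis using a f lB by (simp add: RDirProd_simps)
    next
      case (2 b)
      then show ?thesis
        using a f lB by (intro disjI2 bexI[of _ "(\<zero>\<^bsub>B\<^esub>, b)"]) (auto simp: RDirProd_simps)
    qed
  qed
qed

section \<open>Matrix rings over division rings\<close>

lemma matrix_ring_simps:
  "carrier (matrix_ring n D) = ({..<n} \<times> {..<n}) \<rightarrow>\<^sub>E carrier D"
  "\<zero>\<^bsub>matrix_ring n D\<^esub> = (\<lambda>(i, j)\<in>{..<n} \<times> {..<n}. \<zero>\<^bsub>D\<^esub>)"
  "\<one>\<^bsub>matrix_ring n D\<^esub> = (\<lambda>(i, j)\<in>{..<n} \<times> {..<n}. if i = j then \<one>\<^bsub>D\<^esub> else \<zero>\<^bsub>D\<^esub>)"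
  "A \<oplus>\<^bsub>matrix_ring n D\<^esub> B = (\<lambda>(i, j)\<in>{..<n} \<times> {..<n}. A (i, j) \<oplus>\<^bsub>D\<^esub> B (i, j))"
  "A \<otimes>\<^bsub>matrix_ring n D\<^esub> B =
    (\<lambda>(i, j)\<in>{..<n} \<times> {..<n}. \<Oplus>\<^bsub>D\<^esub>k\<in>{..<n}. A (i, k) \<otimes>\<^bsub>D\<^esub> B (k, j))"
  by (simp_all add: matrix_ring_def)

definition matrix_unit :: "nat \<Rightarrow> ('d, 'k) ring_scheme \<Rightarrow> nat \<Rightarrow> nat \<Rightarrow> 'd \<Rightarrow> nat \<times> nat \<Rightarrow> 'd"
  where "matrix_unit n D s t d = (\<lambda>(i, j)\<in>{..<n} \<times> {..<n}. if i = s \<and> j = t then d else \<zero>\<^bsub>D\<^esub>)"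

context ring
begin

lemma matrix_entry: "A \<in> carrier (matrix_ring n R) \<Longrightarrow> i < n \<Longrightarrow> j < n \<Longrightarrow> A (i, j) \<in> carrier R"
  by (auto simp: matrix_ring_simps)

lemma zero_laws_matrix_ring: "zero_laws (matrix_ring n R)"
proof -
  have "A \<otimes>\<^bsub>matrix_ring n R\<^esub> B \<in> carrier (matrix_ring n R)"
    if "A \<in> carrier (matrix_ring n R)" "B \<in> carrier (matrix_ring n R)" for A B
    unfolding matrix_ring_simps(1,5) using that by (auto intro!: finsum_closed m_closed matrix_entry)
  moreover have "A \<oplus>\<^bsub>matrix_ring n R\<^esub> B \<in> carrier (matrix_ring n R)"
    if "A \<in> carrier (matrix_ring n R)" "B \<in> carrier (matrix_ring n R)" for A B
    unfolding matrix_ring_simps(1,4) using that by (auto intro!: a_closed matrix_entry)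
  moreover have "\<zero>\<^bsub>matrix_ring n R\<^esub> \<oplus>\<^bsub>matrix_ring n R\<^esub> A = A" "A \<oplus>\<^bsub>matrix_ring n R\<^esub> \<zero>\<^bsub>matrix_ring n R\<^esub> = A"
    if "A \<in> carrier (matrix_ring n R)" for A
    using that by (auto simp: matrix_ring_simps fun_eq_iff PiE_iff extensional_def)
  moreover have "\<zero>\<^bsub>matrix_ring n R\<^esub> \<otimes>\<^bsub>matrix_ring n R\<^esub> A = \<zero>\<^bsub>matrix_ring n R\<^esub>"
    if "A \<in> carrier (matrix_ring n R)" for A
  proof -
    have "(\<Oplus>k\<in>{..<n}. \<zero>\<^bsub>matrix_ring n R\<^esub> (i, k) \<otimes> A (k, j)) = \<zero>" if "i < n" "j < n" for i j
      using matrix_entry[OF \<open>A \<in> _\<close>] that by (intro add.finprod_one_eqI) (auto simp: matrix_ring_simps(2))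
    then show ?thesis by (auto simp: matrix_ring_simps(5) fun_eq_iff) (auto simp: matrix_ring_simps(2))
  qed
  ultimately show ?thesis
    by (auto simp: zero_laws_def) (auto simp: matrix_ring_simps)
qed

lemma matrix_unit_closed: "d \<in> carrier R \<Longrightarrow> matrix_unit n R s t d \<in> carrier (matrix_ring n R)"
  by (auto simp: matrix_unit_def matrix_ring_simps)

lemma matrix_unit_mult_left:
  assumes "A \<in> carrier (matrix_ring n R)" "t < n" "i < n" "j < n"
  shows "(matrix_unit n R s t \<one> \<otimes>\<^bsub>matrix_ring n R\<^esub> A) (i, j) = (if i = s then A (t, j) else \<zero>)"
proof -
  have "(\<Oplus>k\<in>{..<n}. matrix_unit n R s t \<one> (i, k) \<otimes> A (k, j)) =
      (\<Oplus>k\<in>{..<n}. if t = k then (if i = s then A (k, j) else \<zero>) else \<zero>)"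
    using assms matrix_entry[OF assms(1)] by (intro finsum_cong') (auto simp: matrix_unit_def)
  also have "\<dots> = (if i = s then A (t, j) else \<zero>)"
    using assms matrix_entry[OF assms(1)] by (intro finsum_singleton) auto
  finally show ?thesis using assms by (simp add: matrix_ring_simps)
qed

lemma matrix_unit_mult_right:
  assumes "A \<in> carrier (matrix_ring n R)" "s < n" "i < n" "j < n" "d \<in> carrier R"
  shows "(A \<otimes>\<^bsub>matrix_ring n R\<^esub> matrix_unit n R s t d) (i, j) = (if j = t then A (i, s) \<otimes> d else \<zero>)"
proof -
  have "(\<Oplus>k\<in>{..<n}. A (i, k) \<otimes> matrix_unit n R s t d (k, j)) =
      (\<Oplus>k\<in>{..<n}. if s = k then (if j = t then A (i, k) \<otimes> d else \<zero>) else \<zero>)"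
    using assms matrix_entry[OF assms(1)] by (intro finsum_cong') (auto simp: matrix_unit_def)
  also have "\<dots> = (if j = t then A (i, s) \<otimes> d else \<zero>)"
    using assms matrix_entry[OF assms(1)] by (intro finsum_singleton) auto
  finally show ?thesis using assms by (simp add: matrix_ring_simps)
qed

end

text \<open>Multiplying \<open>a\<close> from the left by the diagonal unit at t keeps row t and
  erases the others. A row over a division ring is either zero or has an invertible entry from which
  the diagonal unit can be recovered.\<close>

lemma minimal_generators_matrix_ring:
  assumes "skew_field D"
  shows "minimal_generators (matrix_ring n D) ((\<lambda>t. matrix_unit n D t t \<one>\<^bsub>D\<^esub>) ` {..<n})"
  unfolding minimal_generators_def
proof (intro conjI ballI allI impI)
  interpret ring D using assms by (simp add: skew_field_def)
  note laws = zero_laws_matrix_ring[of n, unfolded zero_laws_def]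
  show "finite ((\<lambda>t. matrix_unit n D t t \<one>\<^bsub>D\<^esub>) ` {..<n})" by simp
  show "(\<lambda>t. matrix_unit n D t t \<one>\<^bsub>D\<^esub>) ` {..<n} \<subseteq> carrier (matrix_ring n D)"
    using matrix_unit_closed by auto
  show "\<one>\<^bsub>matrix_ring n D\<^esub> \<in> L"
    if L: "(\<lambda>t. matrix_unit n D t t \<one>\<^bsub>D\<^esub>) ` {..<n} \<subseteq> L" "\<zero>\<^bsub>matrix_ring n D\<^esub> \<in> L"
      "\<forall>x\<in>L. \<forall>y\<in>L. x \<oplus>\<^bsub>matrix_ring n D\<^esub> y \<in> L" for L
  proof -
    \<comment> \<open>Partial identity matrices with m ones on the diagonal, built up by adding one
      diagonal unit at a time.\<close>
    have "(\<lambda>(i, j)\<in>{..<n} \<times> {..<n}. if i = j \<and> i < m then \<one>\<^bsub>D\<^esub> else \<zero>\<^bsub>D\<^esub>) \<in> L" if "m \<le> n" for m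
      using that
    proof (induct m)
      case 0
      have "(\<lambda>(i, j)\<in>{..<n} \<times> {..<n}. if i = j \<and> i < 0 then \<one>\<^bsub>D\<^esub> else \<zero>\<^bsub>D\<^esub>) = \<zero>\<^bsub>matrix_ring n D\<^esub>"
        by (auto simp: matrix_ring_simps fun_eq_iff)
      then show ?case using L(2) by (simp only:)
    next
      case (Suc m)
      then have "m \<le> n" "matrix_unit n D m m \<one>\<^bsub>D\<^esub> \<in> L" using L(1) by auto
      from bspec[OF bspec[OF L(3) Suc(1)[OF this(1)]] this(2)]
      have "(\<lambda>(i, j)\<in>{..<n} \<times> {..<n}. if i = j \<and> i < m then \<one>\<^bsub>D\<^esub> else \<zero>\<^bsub>D\<^esub>)
          \<oplus>\<^bsub>matrix_ring n D\<^esub> matrix_unit n D m m \<one>\<^bsub>D\<^esub> \<in> L" .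
      also have "(\<lambda>(i, j)\<in>{..<n} \<times> {..<n}. if i = j \<and> i < m then \<one>\<^bsub>D\<^esub> else \<zero>\<^bsub>D\<^esub>)
          \<oplus>\<^bsub>matrix_ring n D\<^esub> matrix_unit n D m m \<one>\<^bsub>D\<^esub> =
          (\<lambda>(i, j)\<in>{..<n} \<times> {..<n}. if i = j \<and> i < Suc m then \<one>\<^bsub>D\<^esub> else \<zero>\<^bsub>D\<^esub>)"
        by (auto simp: matrix_ring_simps matrix_unit_def fun_eq_iff)
      finally show ?case .
    qed
    from this[of n] have "(\<lambda>(i, j)\<in>{..<n} \<times> {..<n}. if i = j \<and> i < n then \<one>\<^bsub>D\<^esub> else \<zero>\<^bsub>D\<^esub>) \<in> L" by simp
    also have "(\<lambda>(i, j)\<in>{..<n} \<times> {..<n}. if i = j \<and> i < n then \<one>\<^bsub>D\<^esub> else \<zero>\<^bsub>D\<^esub>) = \<one>\<^bsub>matrix_ring n D\<^esub>"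
      by (auto simp: matrix_ring_simps fun_eq_iff)
    finally show ?thesis .
  qed
  fix e a assume "e \<in> (\<lambda>t. matrix_unit n D t t \<one>\<^bsub>D\<^esub>) ` {..<n}" and a: "a \<in> carrier (matrix_ring n D)"
  then obtain t where t: "t < n" "e = matrix_unit n D t t \<one>\<^bsub>D\<^esub>" by auto
  have e: "e \<in> carrier (matrix_ring n D)" using t matrix_unit_closed by auto
  have ea: "e \<otimes>\<^bsub>matrix_ring n D\<^esub> a \<in> carrier (matrix_ring n D)" using laws e a by auto
  show "e \<otimes>\<^bsub>matrix_ring n D\<^esub> a = \<zero>\<^bsub>matrix_ring n D\<^esub> \<or>
    (\<exists>b\<in>carrier (matrix_ring n D). (e \<otimes>\<^bsub>matrix_ring n D\<^esub> a) \<otimes>\<^bsub>matrix_ring n D\<^esub> b = e)"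
  proof (cases "\<exists>s<n. a (t, s) \<noteq> \<zero>\<^bsub>D\<^esub>")
    case False
    have "(e \<otimes>\<^bsub>matrix_ring n D\<^esub> a) p = \<zero>\<^bsub>matrix_ring n D\<^esub> p" if "p \<in> {..<n} \<times> {..<n}" for p
      using that False t matrix_unit_mult_left[OF a] by (auto simp: matrix_ring_simps(2))
    then have "e \<otimes>\<^bsub>matrix_ring n D\<^esub> a = \<zero>\<^bsub>matrix_ring n D\<^esub>"
      using ea laws unfolding matrix_ring_simps(1) by (meson PiE_ext)
    then show ?thesis ..
  next
    case True
    then obtain s where s: "s < n" "a (t, s) \<noteq> \<zero>\<^bsub>D\<^esub>" by auto
    then have u: "a (t, s) \<in> Units D"
      using assms matrix_entry[OF a t(1) s(1)] by (auto simp: skew_field_def)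
    \<comment> \<open>The witness moves the entry in column s to column t and scales it to
      one.\<close>
    let ?b = "matrix_unit n D s t (inv\<^bsub>D\<^esub> a (t, s))"
    have b: "?b \<in> carrier (matrix_ring n D)" using u by (intro matrix_unit_closed) auto
    have "((e \<otimes>\<^bsub>matrix_ring n D\<^esub> a) \<otimes>\<^bsub>matrix_ring n D\<^esub> ?b) p = e p" if "p \<in> {..<n} \<times> {..<n}" for p
    proof -
      obtain i j where p: "p = (i, j)" "i < n" "j < n" using \<open>p \<in> _\<close> by auto
      have "((e \<otimes>\<^bsub>matrix_ring n D\<^esub> a) \<otimes>\<^bsub>matrix_ring n D\<^esub> ?b) (i, j) =
          (if j = t then (e \<otimes>\<^bsub>matrix_ring n D\<^esub> a) (i, s) \<otimes>\<^bsub>D\<^esub> inv\<^bsub>D\<^esub> a (t, s) else \<zero>\<^bsub>D\<^esub>)"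
        using ea s p u by (intro matrix_unit_mult_right) auto
      moreover have "(e \<otimes>\<^bsub>matrix_ring n D\<^esub> a) (i, s) = (if i = t then a (t, s) else \<zero>\<^bsub>D\<^esub>)"
        unfolding t(2) using a s t p by (intro matrix_unit_mult_left) auto
      ultimately show ?thesis using p u t by (auto simp: matrix_unit_def Units_r_inv)
    qed
    moreover have "(e \<otimes>\<^bsub>matrix_ring n D\<^esub> a) \<otimes>\<^bsub>matrix_ring n D\<^esub> ?b \<in> carrier (matrix_ring n D)"
      using laws ea b by auto
    ultimately have "(e \<otimes>\<^bsub>matrix_ring n D\<^esub> a) \<otimes>\<^bsub>matrix_ring n D\<^esub> ?b = e"
      using e unfolding matrix_ring_simps(1) by (meson PiE_ext)
    then show ?thesis using b by blast
  qed
qed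

text \<open>Induction along the list, where each product is a copy of a binary one. The empty
  product is the zero ring, and there the empty set of generators serves because the identity is
  zero.\<close>

lemma minimal_generators_RDirProd_list:
  assumes "\<forall>(n, D) \<in> set nDs. skew_field D"
  shows "zero_laws (RDirProd_list (map (\<lambda>(n, D). matrix_ring n D) nDs)) \<and>
    (\<exists>E. minimal_generators (RDirProd_list (map (\<lambda>(n, D). matrix_ring n D) nDs)) E)"
  using assms
proof (induct nDs)
  case Nil
  have "zero_laws nil_ring" by (simp add: zero_laws_def monoid.defs)
  moreover have "minimal_generators nil_ring {}"
    by (simp add: minimal_generators_def monoid.defs)
  ultimately show ?case by auto
next
  case (Cons nD nDs)
  obtain n D where nD: "nD = (n, D)" by (cases nD)
  let ?B = "matrix_ring n D" and ?Cs = "map (\<lambda>(n, D). matrix_ring n D) nDs"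
  let ?h = "\<lambda>(a, as). a # as"
  have D: "skew_field D" "ring D" using Cons(2) nD by (auto simp: skew_field_def)
  have IH: "zero_laws (RDirProd_list ?Cs)" "\<exists>E. minimal_generators (RDirProd_list ?Cs) E"
    using Cons by auto
  have iso: "?h \<in> ring_iso (RDirProd ?B (RDirProd_list ?Cs)) (RDirProd_list (?B # ?Cs))"
    by (rule RDirProd_list_iso1)
  have zero: "?h \<zero>\<^bsub>RDirProd ?B (RDirProd_list ?Cs)\<^esub> = \<zero>\<^bsub>RDirProd_list (?B # ?Cs)\<^esub>"
    by (simp add: RDirProd_simps RDirProd_list_zero')
  have laws: "zero_laws (RDirProd ?B (RDirProd_list ?Cs))"
    by (intro zero_laws_RDirProd ring.zero_laws_matrix_ring D IH)
  obtain F where "minimal_generators (RDirProd_list ?Cs) F" using IH(2) ..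
  then show ?case
    using zero_laws_iso[OF laws iso zero]
      minimal_generators_iso[OF laws minimal_generators_RDirProd[OF
        ring.zero_laws_matrix_ring[OF D(2)] minimal_generators_matrix_ring[OF D(1)] IH(1)] iso zero]
    unfolding nD by (simp only: list.map prod.case) blast
qed

lemma semisimple_ring_minimal_generators:
  assumes "semisimple_ring A"
  shows "\<exists>E. minimal_generators A E"
proof -
  interpret A: ring A using assms by (simp add: semisimple_ring_def)
  obtain nDs :: "(nat \<times> 'a ring) list" where "\<forall>(n, D) \<in> set nDs. n \<ge> 1 \<and> skew_field D"
    and iso: "A \<simeq> RDirProd_list (map (\<lambda>(n, D). matrix_ring n D) nDs)"
    using assms unfolding semisimple_ring_def by blast
  then have nDs: "\<forall>(n, D) \<in> set nDs. skew_field D" by auto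
  define B where "B = RDirProd_list (map (\<lambda>(n, D). matrix_ring n D) nDs)"
  obtain E where B: "zero_laws B" "minimal_generators B E"
    using minimal_generators_RDirProd_list[OF nDs] unfolding B_def by blast
  obtain h where h: "h \<in> ring_iso A B" using iso unfolding B_def is_ring_iso_def by blast
  let ?g = "inv_into (carrier A) h"
  have g: "?g \<in> ring_iso B A" by (rule ring_iso_set_sym[OF A.ring_axioms h])
  have "\<zero>\<^bsub>B\<^esub> \<in> carrier B" "\<zero>\<^bsub>B\<^esub> \<oplus>\<^bsub>B\<^esub> \<zero>\<^bsub>B\<^esub> = \<zero>\<^bsub>B\<^esub>" using B(1) by (auto simp: zero_laws_def)
  moreover have "?g x \<in> carrier A" "?g (x \<oplus>\<^bsub>B\<^esub> y) = ?g x \<oplus>\<^bsub>A\<^esub> ?g y" if "x \<in> carrier B" "y \<in> carrier B" for x y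
    using g that by (auto simp: ring_iso_def ring_hom_def)
  ultimately have "?g \<zero>\<^bsub>B\<^esub> \<in> carrier A" "?g \<zero>\<^bsub>B\<^esub> \<oplus>\<^bsub>A\<^esub> ?g \<zero>\<^bsub>B\<^esub> = ?g \<zero>\<^bsub>B\<^esub>"
    by metis+
  \<comment> \<open>An additively idempotent element of the ring \<open>A\<close> is zero. This
    supplies the compatibility with zero, which \<open>ring_iso\<close> does not state.\<close>
  then have "?g \<zero>\<^bsub>B\<^esub> = \<zero>\<^bsub>A\<^esub>" by (simp add: A.add.l_cancel_one)
  then show ?thesis using minimal_generators_iso[OF B g] by blast
qed

section \<open>Sums of simple modules\<close>

lemma rmod_hom_inj_onI:
  assumes M: "right_module R M" and N: "right_module R N" and h: "h \<in> rmod_hom R M N"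
    and ker: "\<And>x. x \<in> carrier M \<Longrightarrow> h x = \<zero>\<^bsub>N\<^esub> \<Longrightarrow> x = \<zero>\<^bsub>M\<^esub>"
  shows "inj_on h (carrier M)"
proof (rule inj_onI)
  interpret M: right_module R M by fact
  interpret N: right_module R N by fact
  fix x y assume xy: "x \<in> carrier M" "y \<in> carrier M" "h x = h y"
  then have "h (x \<ominus>\<^bsub>M\<^esub> y) = h y \<ominus>\<^bsub>N\<^esub> h y" by (simp add: rmod_hom_minus[OF M N h])
  then have "h (x \<ominus>\<^bsub>M\<^esub> y) = \<zero>\<^bsub>N\<^esub>"
    using rmod_hom_closed[OF h xy(2)] by (simp add: N.M.r_neg a_minus_def)
  then have "x \<ominus>\<^bsub>M\<^esub> y = \<zero>\<^bsub>M\<^esub>" using ker xy by simp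
  moreover have "x = (x \<ominus>\<^bsub>M\<^esub> y) \<oplus>\<^bsub>M\<^esub> y" using xy by (simp add: a_minus_def M.M.a_assoc M.M.l_neg)
  ultimately show "x = y" using xy(2) by simp
qed

lemma simple_rmodule_cyclic:
  assumes M: "simple_rmodule R M" and x: "x \<in> carrier M" "x \<noteq> \<zero>\<^bsub>M\<^esub>" and s: "s \<in> carrier M"
  shows "\<exists>a\<in>carrier R. s = a \<odot>\<^bsub>M\<^esub> x"
proof -
  interpret M: right_module R M using M by (simp add: simple_rmodule_def)
  have "x \<in> (\<lambda>a. a \<odot>\<^bsub>M\<^esub> x) ` carrier R"
    using x by (intro image_eqI[of _ _ "\<one>\<^bsub>R\<^esub>"]) (auto simp: M.smult_one)
  then have "(\<lambda>a. a \<odot>\<^bsub>M\<^esub> x) ` carrier R = carrier M"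
    using M M.submodule_cyclic[OF x(1)] x(2) unfolding simple_rmodule_def by blast
  then show ?thesis using s by blast
qed

lemma simple_rmodule_schur:
  assumes M: "simple_rmodule R M" and N: "simple_rmodule R N" and h: "h \<in> rmod_hom R M N"
    and x: "x \<in> carrier M" "h x \<noteq> \<zero>\<^bsub>N\<^esub>"
  shows "bij_betw h (carrier M) (carrier N)"
proof -
  have M': "right_module R M" and N': "right_module R N"
    using M N by (simp_all add: simple_rmodule_def)
  interpret M: right_module R M by fact
  interpret N: right_module R N by fact
  have "submodule {u \<in> carrier M. h u \<in> {\<zero>\<^bsub>N\<^esub>}} R M"
    by (rule submodule_vimage[OF M' N' h], rule N.submoduleI') (auto simp: N.smult_zero_right)
  then have "{u \<in> carrier M. h u \<in> {\<zero>\<^bsub>N\<^esub>}} = {\<zero>\<^bsub>M\<^esub>}"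
    using M x unfolding simple_rmodule_def by blast
  then have "inj_on h (carrier M)" by (intro rmod_hom_inj_onI[OF M' N' h]) blast
  moreover have "h ` carrier M = carrier N"
    using N submodule_image[OF M' N' h M.submodule_carrier] x unfolding simple_rmodule_def by blast
  ultimately show ?thesis by (simp add: bij_betw_def)
qed

text \<open>Gaussian elimination over the division ring of endomorphisms of \<open>S\<close>.\<close>

lemma homogeneous_system_over_endomorphisms:
  assumes S: "simple_rmodule R S" and J: "finite J" "m < card J"
    and d: "\<And>j l. j \<in> J \<Longrightarrow> l < m \<Longrightarrow> d j l \<in> rmod_hom R S S"
  shows "\<exists>c. (\<forall>j\<in>J. c j \<in> rmod_hom R S S) \<and> (\<exists>j\<in>J. \<exists>s\<in>carrier S. c j s \<noteq> \<zero>\<^bsub>S\<^esub>) \<and>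
    (\<forall>l<m. \<forall>s\<in>carrier S. (\<Oplus>\<^bsub>S\<^esub>j\<in>J. c j (d j l s)) = \<zero>\<^bsub>S\<^esub>)"
proof -
  have S': "right_module R S" using S by (simp add: simple_rmodule_def)
  interpret S: right_module R S by fact
  from J d show ?thesis
  proof (induct m arbitrary: J d)
    case 0
    \<comment> \<open>Without equations the family of identity maps is a solution; it is nontrivial
      because \<open>J\<close> is nonempty and \<open>S\<close> is nonzero.\<close>
    then obtain j where "j \<in> J" by fastforce
    moreover obtain s where "s \<in> carrier S" "s \<noteq> \<zero>\<^bsub>S\<^esub>"
      using S S.M.zero_closed unfolding simple_rmodule_def by blast
    ultimately show ?case using rmod_hom_id by (intro exI[of _ "\<lambda>j s. s"]) auto
  next
    case (Suc m)
    show ?case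
    proof (cases "\<exists>j\<in>J. \<exists>s\<in>carrier S. d j m s \<noteq> \<zero>\<^bsub>S\<^esub>")
      \<comment> \<open>The last equation holds for every choice of coefficients, so a solution of
        the smaller system suffices.\<close>
      case False
      obtain c where c: "\<forall>j\<in>J. c j \<in> rmod_hom R S S" "\<exists>j\<in>J. \<exists>s\<in>carrier S. c j s \<noteq> \<zero>\<^bsub>S\<^esub>"
        "\<forall>l<m. \<forall>s\<in>carrier S. (\<Oplus>\<^bsub>S\<^esub>j\<in>J. c j (d j l s)) = \<zero>\<^bsub>S\<^esub>"
        using Suc(1)[of J d] Suc(2-4) by auto
      have "(\<Oplus>\<^bsub>S\<^esub>j\<in>J. c j (d j m s)) = \<zero>\<^bsub>S\<^esub>" if "s \<in> carrier S" for s
        using False c(1) that by (intro S.M.add.finprod_one_eqI) (auto simp: rmod_hom_zero[OF S' S'])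
      then show ?thesis using c by (intro exI[of _ c]) (auto simp: less_Suc_eq)
    next
      case True
      then obtain j0 s0 where j0: "j0 \<in> J" "s0 \<in> carrier S" "d j0 m s0 \<noteq> \<zero>\<^bsub>S\<^esub>" by auto
      have d0: "d j0 m \<in> rmod_hom R S S" using Suc(4) j0 by auto
      have bij: "bij_betw (d j0 m) (carrier S) (carrier S)"
        by (rule simple_rmodule_schur[OF S S d0 j0(2,3)])
      define u where "u = inv_into (carrier S) (d j0 m)"
      have u: "u \<in> rmod_hom R S S" unfolding u_def by (rule rmod_hom_inv_into[OF S' d0 bij])
      have ud: "u (d j0 m s) = s" if "s \<in> carrier S" for s
        using bij that by (auto simp: u_def bij_betw_def inv_into_f_f)
      let ?J = "J - {j0}"
      \<comment> \<open>Elimination with the pivot \<open>d j0 m\<close>, invertible by Schur's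
        lemma. The unknowns act from the left, so the multiple to be subtracted is
        \<open>d j m\<close> after \<open>u\<close> after \<open>d j0 l\<close>.\<close>
      define d' where "d' = (\<lambda>j l s. d j l s \<ominus>\<^bsub>S\<^esub> d j m (u (d j0 l s)))"
      have dd: "d j l \<in> rmod_hom R S S" if "j \<in> J" "l < Suc m" for j l using Suc(4) that by auto
      have d': "d' j l \<in> rmod_hom R S S" if "j \<in> ?J" "l < m" for j l
      proof -
        have "(\<lambda>s. u (d j0 l s)) \<in> rmod_hom R S S" using that j0 by (intro rmod_hom_comp[OF u dd]) auto
        then have "(\<lambda>s. d j m (u (d j0 l s))) \<in> rmod_hom R S S"
          using that by (intro rmod_hom_comp[OF dd]) auto
        then show ?thesis
          unfolding d'_def using that by (intro rmod_hom_pointwise_minus S' dd) auto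
      qed
      obtain c where c: "\<forall>j\<in>?J. c j \<in> rmod_hom R S S" "\<exists>j\<in>?J. \<exists>s\<in>carrier S. c j s \<noteq> \<zero>\<^bsub>S\<^esub>"
        "\<forall>l<m. \<forall>s\<in>carrier S. (\<Oplus>\<^bsub>S\<^esub>j\<in>?J. c j (d' j l s)) = \<zero>\<^bsub>S\<^esub>"
      proof -
        have "finite ?J" "m < card ?J" using Suc(2,3) j0(1) by (auto simp: card_Diff_singleton)
        from Suc(1)[of ?J d', OF this d'] that show ?thesis by blast
      qed
      \<comment> \<open>The last equation determines the coefficient at \<open>j0\<close> as the
        negative of \<open>v\<close>. With this choice the l-th equation becomes the l-th equation
        of the reduced system.\<close>
      define v where "v = (\<lambda>t. \<Oplus>\<^bsub>S\<^esub>j\<in>?J. c j (d j m (u t)))"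
      have v: "v \<in> rmod_hom R S S"
        unfolding v_def using c(1) Suc(2) dd
        by (intro rmod_hom_pointwise_finsum S' rmod_hom_comp[OF _ rmod_hom_comp[OF _ u]]) auto
      define c' where "c' = c(j0 := (\<lambda>t. \<ominus>\<^bsub>S\<^esub> v t))"
      have c'hom: "\<forall>j\<in>J. c' j \<in> rmod_hom R S S"
        using c(1) rmod_hom_pointwise_neg[OF S' v] by (auto simp: c'_def)
      have cl: "d j l s \<in> carrier S" if "j \<in> J" "l < Suc m" "s \<in> carrier S" for j l s
        using rmod_hom_closed[OF dd] that by blast
      have ccl: "c j t \<in> carrier S" if "j \<in> ?J" "t \<in> carrier S" for j t
        using rmod_hom_closed[OF c(1)[rule_format]] that by blast
      have *: "(\<Oplus>\<^bsub>S\<^esub>j\<in>J. c' j (d j l s)) = (\<Oplus>\<^bsub>S\<^esub>j\<in>?J. c j (d j l s)) \<ominus>\<^bsub>S\<^esub> v (d j0 l s)"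
        if l: "l < Suc m" and s: "s \<in> carrier S" for l s
      proof -
        have "(\<Oplus>\<^bsub>S\<^esub>j\<in>insert j0 ?J. c' j (d j l s)) = c' j0 (d j0 l s) \<oplus>\<^bsub>S\<^esub> (\<Oplus>\<^bsub>S\<^esub>j\<in>?J. c' j (d j l s))"
          using rmod_hom_closed[OF c'hom[rule_format]] cl l s j0(1) Suc(2)
          by (intro S.M.finsum_insert) auto
        moreover have "(\<Oplus>\<^bsub>S\<^esub>j\<in>?J. c' j (d j l s)) = (\<Oplus>\<^bsub>S\<^esub>j\<in>?J. c j (d j l s))"
          using ccl cl l s by (intro S.M.finsum_cong') (auto simp: c'_def)
        moreover have "(\<Oplus>\<^bsub>S\<^esub>j\<in>?J. c j (d j l s)) \<in> carrier S"
          using ccl cl l s by (intro S.M.finsum_closed) auto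
        moreover have "v (d j0 l s) \<in> carrier S"
          using rmod_hom_closed[OF v] cl j0(1) l s by auto
        ultimately show ?thesis
          using j0(1) by (simp add: c'_def insert_absorb a_minus_def S.M.a_comm)
      qed
      have "(\<Oplus>\<^bsub>S\<^esub>j\<in>J. c' j (d j l s)) = \<zero>\<^bsub>S\<^esub>" if l: "l < Suc m" and s: "s \<in> carrier S" for l s
      proof (cases "l = m")
        case True
        have "v (d j0 m s) = (\<Oplus>\<^bsub>S\<^esub>j\<in>?J. c j (d j m s))" using s by (simp add: v_def ud)
        moreover have "(\<Oplus>\<^bsub>S\<^esub>j\<in>?J. c j (d j m s)) \<in> carrier S"
          using ccl cl s by (intro S.M.finsum_closed) auto
        ultimately show ?thesis using *[OF l s] True by (simp add: a_minus_def S.M.r_neg)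
      next
        case False
        then have lm: "l < m" using l by simp
        have udl: "u (d j0 l s) \<in> carrier S" using rmod_hom_closed[OF u] cl j0(1) l s by auto
        have t: "c j (d j l s) \<in> carrier S" "c j (d j m (u (d j0 l s))) \<in> carrier S" if "j \<in> ?J" for j
          using that ccl cl l s udl by auto
        have cd': "c j (d' j l s) = c j (d j l s) \<oplus>\<^bsub>S\<^esub> \<ominus>\<^bsub>S\<^esub> c j (d j m (u (d j0 l s)))" if "j \<in> ?J" for j
          unfolding d'_def a_minus_def[symmetric]
          using that cl udl l s by (intro rmod_hom_minus[OF S' S'] c(1)[rule_format]) auto
        have "\<zero>\<^bsub>S\<^esub> = (\<Oplus>\<^bsub>S\<^esub>j\<in>?J. c j (d' j l s))" using c(3) lm s by simp
        also have "\<dots> = (\<Oplus>\<^bsub>S\<^esub>j\<in>?J. c j (d j l s) \<oplus>\<^bsub>S\<^esub> \<ominus>\<^bsub>S\<^esub> c j (d j m (u (d j0 l s))))"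
          using t by (intro S.M.finsum_cong') (auto simp: cd')
        also have "\<dots> = (\<Oplus>\<^bsub>S\<^esub>j\<in>?J. c j (d j l s)) \<oplus>\<^bsub>S\<^esub> (\<Oplus>\<^bsub>S\<^esub>j\<in>?J. \<ominus>\<^bsub>S\<^esub> c j (d j m (u (d j0 l s))))"
          using t by (intro S.M.finsum_addf) auto
        also have "(\<Oplus>\<^bsub>S\<^esub>j\<in>?J. \<ominus>\<^bsub>S\<^esub> c j (d j m (u (d j0 l s)))) = \<ominus>\<^bsub>S\<^esub> v (d j0 l s)"
          unfolding v_def
          by (rule rmod_hom_finsum[OF S' S' rmod_hom_pointwise_neg[OF S' rmod_hom_id], symmetric])
            (use t Suc(2) in auto)
        finally show ?thesis using *[OF l s] by (simp add: a_minus_def)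
      qed
      moreover have "\<exists>j\<in>J. \<exists>s\<in>carrier S. c' j s \<noteq> \<zero>\<^bsub>S\<^esub>"
        using c(2) by (auto simp: c'_def)
      ultimately show ?thesis using c'hom by (intro exI[of _ c']) auto
    qed
  qed
qed

section \<open>Multiplicities in sums of simple modules\<close>

lemma right_module_simple_sum:
  "ring A \<Longrightarrow> (\<And>i. i < r \<Longrightarrow> right_module A (S i)) \<Longrightarrow> right_module A (simple_sum r S x)"
  unfolding simple_sum_def by (rule right_module_direct_sum) auto

text \<open>The maps \<open>p j\<close> and elements \<open>z k\<close> form a dual system. With
  fewer than \<open>card J\<close> copies of \<open>S i\<close>, a nontrivial combination of the
  \<open>p j\<close> over the endomorphisms of \<open>S i\<close> vanishes on the whole sum;
  evaluated at the \<open>z k\<close> it does not.\<close>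

lemma simple_sum_independent_card_le:
  assumes S: "\<And>i. i < r \<Longrightarrow> simple_rmodule A (S i)"
    and S_iso: "\<And>i j. i < r \<Longrightarrow> j < r \<Longrightarrow> rmod_iso A (S i) (S j) \<Longrightarrow> i = j"
    and i: "i < r" and J: "finite J"
    and p: "\<And>j. j \<in> J \<Longrightarrow> p j \<in> rmod_hom A (simple_sum r S y) (S i)"
    and z: "\<And>k. k \<in> J \<Longrightarrow> z k \<in> carrier (simple_sum r S y)"
    and s: "s \<in> carrier (S i)" "s \<noteq> \<zero>\<^bsub>S i\<^esub>"
    and pz: "\<And>j k. j \<in> J \<Longrightarrow> k \<in> J \<Longrightarrow> p j (z k) = (if j = k then s else \<zero>\<^bsub>S i\<^esub>)"
  shows "enat (card J) \<le> y i"
proof (rule ccontr)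
  assume "\<not> enat (card J) \<le> y i"
  then obtain m where m: "y i = enat m" "m < card J" by (cases "y i") auto
  let ?I = "{(i, k). i < r \<and> enat k < y i}" and ?M = "\<lambda>(i, k). S i"
  have rm: "right_module A (S i)" if "i < r" for i using S[OF that] by (simp add: simple_rmodule_def)
  interpret Si: right_module A "S i" by (rule rm[OF i])
  have rmM: "right_module A (?M q)" if "q \<in> ?I" for q using that rm by (cases q) auto
  note ds = Si.R.ring_axioms rmM
  have D: "right_module A (simple_sum r S y)"
    by (rule right_module_simple_sum[OF Si.R.ring_axioms rm])
  have single: "direct_sum_single ?I ?M (i', k) \<in> rmod_hom A (S i') (simple_sum r S y)"
    if "i' < r" "enat k < y i'" for i' k
  proof -
    have "direct_sum_single ?I ?M (i', k) \<in> rmod_hom A (?M (i', k)) (direct_sum_rmodule ?I ?M)"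
      by (rule direct_sum_single_hom[OF Si.R.ring_axioms]) (use that rm in auto)
    then show ?thesis unfolding simple_sum_def by simp
  qed
  \<comment> \<open>The matrix of the system consists of the restrictions of the \<open>p j\<close>
    to the \<open>m\<close> copies of \<open>S i\<close>; its solution \<open>c\<close> makes the
    sum of the \<open>c j\<close> after \<open>p j\<close> vanish on these copies.\<close>
  obtain c where c: "\<forall>j\<in>J. c j \<in> rmod_hom A (S i) (S i)" "\<exists>j\<in>J. \<exists>s\<in>carrier (S i). c j s \<noteq> \<zero>\<^bsub>S i\<^esub>"
    "\<forall>l<m. \<forall>t\<in>carrier (S i). (\<Oplus>\<^bsub>S i\<^esub>j\<in>J. c j (p j (direct_sum_single ?I ?M (i, l) t))) = \<zero>\<^bsub>S i\<^esub>"
    using homogeneous_system_over_endomorphisms[OF S[OF i] J m(2),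
        of "\<lambda>j l t. p j (direct_sum_single ?I ?M (i, l) t)"] rmod_hom_comp[OF p single] i m(1)
    by auto
  define \<Theta> where "\<Theta> = (\<lambda>F. \<Oplus>\<^bsub>S i\<^esub>j\<in>J. c j (p j F))"
  have \<Theta>: "\<Theta> \<in> rmod_hom A (simple_sum r S y) (S i)"
    unfolding \<Theta>_def using c(1) p J
    by (intro rmod_hom_pointwise_finsum Si.right_module_axioms rmod_hom_comp[OF _ p]) auto
  have "{F \<in> carrier (simple_sum r S y). \<Theta> F = \<zero>\<^bsub>S i\<^esub>} = carrier (direct_sum_rmodule ?I ?M)"
  proof (rule submodule_direct_sum_eq[OF ds])
    show "submodule {F \<in> carrier (simple_sum r S y). \<Theta> F = \<zero>\<^bsub>S i\<^esub>} A (direct_sum_rmodule ?I ?M)"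
      using submodule_equalizer[OF D Si.right_module_axioms \<Theta> rmod_hom_pointwise_zero[OF Si.right_module_axioms]]
      by (simp add: simple_sum_def)
    fix q t assume q: "q \<in> ?I" and "t \<in> carrier (?M q)"
    obtain i' k where ik: "q = (i', k)" "i' < r" "enat k < y i'" using q by auto
    then have t: "t \<in> carrier (S i')" using \<open>t \<in> _\<close> by simp
    have hom: "(\<lambda>t. \<Theta> (direct_sum_single ?I ?M (i', k) t)) \<in> rmod_hom A (S i') (S i)"
      by (rule rmod_hom_comp[OF \<Theta> single[OF ik(2,3)]])
    have "\<Theta> (direct_sum_single ?I ?M (i', k) t) = \<zero>\<^bsub>S i\<^esub>"
    \<comment> \<open>Copies of \<open>S i\<close> are killed by the choice of \<open>c\<close>; on
      another \<open>S i'\<close> a nonzero map to \<open>S i\<close> would be an isomorphism by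
      Schur's lemma.\<close>
    proof (cases "i' = i")
      case True
      then show ?thesis using c(3) ik(3) m(1) t by (simp add: \<Theta>_def)
    next
      case False
      show ?thesis
      proof (rule ccontr)
        assume "\<Theta> (direct_sum_single ?I ?M (i', k) t) \<noteq> \<zero>\<^bsub>S i\<^esub>"
        from simple_rmodule_schur[OF S[OF ik(2)] S[OF i] hom t this]
        have "rmod_iso A (S i') (S i)" using hom unfolding rmod_iso_def by blast
        then show False using S_iso[OF ik(2) i] False by simp
      qed
    qed
    then show "direct_sum_single ?I ?M q t \<in> {F \<in> carrier (simple_sum r S y). \<Theta> F = \<zero>\<^bsub>S i\<^esub>}"
      using rmod_hom_closed[OF single[OF ik(2,3)] t] ik(1) by simp
  qed
  then have \<Theta>0: "\<Theta> F = \<zero>\<^bsub>S i\<^esub>" if "F \<in> carrier (simple_sum r S y)" for F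
    using that by (auto simp: simple_sum_def)
  \<comment> \<open>At \<open>z k\<close> only the term \<open>j = k\<close> survives, so every
    \<open>c k\<close> kills the nonzero element \<open>s\<close>. A nonzero \<open>c j\<close> is
    injective, which gives the contradiction.\<close>
  have cs: "c k s = \<zero>\<^bsub>S i\<^esub>" if k: "k \<in> J" for k
  proof -
    have "\<Theta> (z k) = (\<Oplus>\<^bsub>S i\<^esub>j\<in>J. if k = j then c j s else \<zero>\<^bsub>S i\<^esub>)"
      unfolding \<Theta>_def using k pz s c(1) rmod_hom_closed[OF c(1)[rule_format]]
        rmod_hom_zero[OF Si.right_module_axioms Si.right_module_axioms c(1)[rule_format]]
      by (intro Si.M.finsum_cong') auto
    also have "\<dots> = c k s"
      using k J rmod_hom_closed[OF c(1)[rule_format]] s by (intro Si.M.finsum_singleton) auto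
    finally show ?thesis using \<Theta>0[OF z[OF k]] by simp
  qed
  obtain j t where j: "j \<in> J" "t \<in> carrier (S i)" "c j t \<noteq> \<zero>\<^bsub>S i\<^esub>" using c(2) by blast
  have cj: "c j \<in> rmod_hom A (S i) (S i)" using c(1) j(1) by auto
  have "inj_on (c j) (carrier (S i))"
    using simple_rmodule_schur[OF S[OF i] S[OF i] cj j(2,3)] by (simp add: bij_betw_def)
  then show False
    using cs[OF j(1)] rmod_hom_zero[OF Si.right_module_axioms Si.right_module_axioms cj] s
    by (auto dest!: inj_onD[of _ _ s "\<zero>\<^bsub>S i\<^esub>"])
qed

text \<open>A simple module whose image is not contained in the span of the earlier images
  contributes nothing but zero to that span, so the kept images form a direct sum; the discarded
  ones are covered by strong induction on the numbering. The multiplicity \<open>x i\<close> counts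
  the kept maps of type \<open>i\<close>, and countability of \<open>C\<close> makes every infinite
  count the single value \<infinity>.\<close>

lemma semisimple_decomposition:
  assumes M: "right_module A M" and S: "\<And>i. i < r \<Longrightarrow> simple_rmodule A (S i)"
    and C: "countable C" "\<And>c. c \<in> C \<Longrightarrow> t c < r"
    and f: "\<And>c. c \<in> C \<Longrightarrow> f c \<in> rmod_hom A (S (t c)) M"
    and gen: "\<And>N. submodule N A M \<Longrightarrow> (\<And>c. c \<in> C \<Longrightarrow> f c ` carrier (S (t c)) \<subseteq> N) \<Longrightarrow> N = carrier M"
  shows "\<exists>x. (\<forall>i\<ge>r. x i = 0) \<and> rmod_iso A M (simple_sum r S x)"
proof -
  interpret M: right_module A M by fact
  have rm: "right_module A (S i)" if "i < r" for i using S[OF that] by (simp add: simple_rmodule_def)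
  define idx where "idx = to_nat_on C"
  have idx: "inj_on idx C" unfolding idx_def by (rule inj_on_to_nat_on[OF C(1)])
  define low where "low = (\<lambda>c. rmod_span A M (\<Union>d\<in>{d \<in> C. idx d < idx c}. f d ` carrier (S (t d))))"
  have imf: "f c ` carrier (S (t c)) \<subseteq> carrier M" if "c \<in> C" for c
    using rmod_hom_closed[OF f[OF that]] by auto
  have low_sub: "submodule (low c) A M" for c
    unfolding low_def using imf by (intro M.submodule_span) auto
  have low_mem: "f d u \<in> low c" if "d \<in> C" "idx d < idx c" "u \<in> carrier (S (t d))" for d c u
    unfolding low_def by (rule subsetD[OF M.span_superset]) (use that in auto)
  \<comment> \<open>greedy choice: keep the maps whose image is not already covered by the earlier ones\<close>
  define K where "K = {c \<in> C. \<not> f c ` carrier (S (t c)) \<subseteq> low c}"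
  define K' where "K' = (\<lambda>i. {c \<in> K. t c = i})"
  define x where "x = (\<lambda>i. if i < r then if finite (K' i) then enat (card (K' i)) else \<infinity> else 0)"
  have "\<exists>b. bij_betw b {k. enat k < x i} (K' i)" if "i < r" for i
  proof (cases "finite (K' i)")
    case True
    then show ?thesis using ex_bij_betw_nat_finite[of "K' i"] that by (simp add: x_def atLeast0LessThan lessThan_def)
  next
    case False
    have "countable (K' i)" by (rule countable_subset[OF _ C(1)]) (auto simp: K'_def K_def)
    then show ?thesis using bij_betw_from_nat_into[of "K' i"] False that by (auto simp: x_def)
  qed
  then obtain b where b: "\<And>i. i < r \<Longrightarrow> bij_betw (b i) {k. enat k < x i} (K' i)" by metis
  let ?I = "{(i, k). i < r \<and> enat k < x i}" and ?S = "\<lambda>(i, k). S i"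
  have bK: "b i k \<in> C" "b i k \<in> K" "t (b i k) = i" if "i < r" "enat k < x i" for i k
    using b[OF that(1)] that(2) by (auto simp: bij_betw_def K'_def K_def)
  have b_inj: "i = i' \<and> k = k'"
    if "i < r" "enat k < x i" "i' < r" "enat k' < x i'" "b i k = b i' k'" for i k i' k'
  proof -
    have "i = i'" using bK(3)[OF that(1,2)] bK(3)[OF that(3,4)] that(5) by simp
    then show ?thesis using b[OF that(1)] that by (auto simp: bij_betw_def inj_on_def)
  qed
  have b_surj: "\<exists>i k. i < r \<and> enat k < x i \<and> c = b i k" if "c \<in> K" for c
  proof -
    have "t c < r" "c \<in> K' (t c)" using that C(2) by (auto simp: K_def K'_def)
    then show ?thesis using b[of "t c"] by (auto simp: bij_betw_def)
  qed
  have rmS: "right_module A (?S q)" if "q \<in> ?I" for q using that rm by (cases q) auto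
  define g where "g = (\<lambda>(i, k). f (b i k))"
  have g: "g q \<in> rmod_hom A (?S q) M" if "q \<in> ?I" for q
  proof -
    obtain i k where q: "q = (i, k)" "i < r" "enat k < x i" using \<open>q \<in> ?I\<close> by auto
    then show ?thesis using f[OF bK(1)[OF q(2,3)]] bK(3)[OF q(2,3)] by (simp add: g_def)
  qed
  define \<pi> where "\<pi> = direct_sum_map ?I ?S M g"
  note ds = M.R.ring_axioms rmS
  have D: "right_module A (simple_sum r S x)" by (rule right_module_simple_sum[OF M.R.ring_axioms rm])
  have \<pi>: "\<pi> \<in> rmod_hom A (simple_sum r S x) M"
    unfolding \<pi>_def simple_sum_def by (rule direct_sum_map_hom[OF ds M g])
  have im: "submodule (\<pi> ` carrier (simple_sum r S x)) A M"
    by (rule submodule_image[OF D M \<pi> right_module.submodule_carrier[OF D]])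
  have "f c ` carrier (S (t c)) \<subseteq> \<pi> ` carrier (simple_sum r S x)" if "c \<in> C" for c
    using that
  proof (induct "idx c" arbitrary: c rule: less_induct)
    case less
    show ?case
    proof (cases "c \<in> K")
      case True
      then obtain i k where ik: "i < r" "enat k < x i" "c = b i k" using b_surj by blast
      have q: "(i, k) \<in> ?I" using ik by simp
      show ?thesis
      proof
        fix u assume "u \<in> f c ` carrier (S (t c))"
        then obtain s where s: "s \<in> carrier (S i)" "u = f c s" using ik bK(3) by auto
        have sq: "s \<in> carrier (?S (i, k))" using s by simp
        have "\<pi> (direct_sum_single ?I ?S (i, k) s) = u"
        proof -
          have "\<pi> (direct_sum_single ?I ?S (i, k) s) = g (i, k) s"
            unfolding \<pi>_def by (rule direct_sum_map_single) (fact ds M g q sq)+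
          then show ?thesis using s ik(3) by (simp add: g_def)
        qed
        moreover have "direct_sum_single ?I ?S (i, k) s \<in> carrier (simple_sum r S x)"
        proof -
          have "direct_sum_single ?I ?S (i, k) \<in> rmod_hom A (?S (i, k)) (direct_sum_rmodule ?I ?S)"
            by (rule direct_sum_single_hom) (fact ds q)+
          then show ?thesis unfolding simple_sum_def using sq by (rule rmod_hom_closed)
        qed
        ultimately show "u \<in> \<pi> ` carrier (simple_sum r S x)" by blast
      qed
    next
      case False
      then have "f c ` carrier (S (t c)) \<subseteq> low c" using less(2) by (simp add: K_def)
      also have "low c \<subseteq> \<pi> ` carrier (simple_sum r S x)"
        unfolding low_def using less(1) by (intro M.span_least[OF im]) blast
      finally show ?thesis .
    qed
  qed
  then have surj: "\<pi> ` carrier (simple_sum r S x) = carrier M" by (rule gen[OF im])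
  have "inj_on \<pi> (carrier (simple_sum r S x))"
  proof (rule rmod_hom_inj_onI[OF D M \<pi>], rule ccontr)
    fix F assume F: "F \<in> carrier (simple_sum r S x)" and \<pi>F: "\<pi> F = \<zero>\<^bsub>M\<^esub>"
      and ne: "F \<noteq> \<zero>\<^bsub>simple_sum r S x\<^esub>"
    define T where "T = {q \<in> ?I. F q \<noteq> \<zero>\<^bsub>?S q\<^esub>}"
    have F': "F \<in> carrier (direct_sum_rmodule ?I ?S)" using F by (simp add: simple_sum_def)
    have T: "finite T" "T \<subseteq> ?I" using F' by (auto simp: T_def direct_sum_carrier)
    have "T \<noteq> {}"
    proof
      assume "T = {}"
      then have "F = \<zero>\<^bsub>direct_sum_rmodule ?I ?S\<^esub>"
        using F' by (auto simp: T_def direct_sum_simps direct_sum_carrier PiE_iff extensional_def fun_eq_iff)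
      then show False using ne by (simp add: simple_sum_def)
    qed
    define w where "w = (\<lambda>(i, k). idx (b i k))"
    \<comment> \<open>The last index in the support of a relation: all other terms come from earlier
      maps, so the relation puts the term at \<open>q\<close> into the span of the images before
      it.\<close>
    obtain q where q: "q \<in> T" "\<And>q'. q' \<in> T \<Longrightarrow> w q' \<le> w q"
    proof -
      have "Max (w ` T) \<in> w ` T" using T(1) \<open>T \<noteq> {}\<close> by (intro Max_in) auto
      then obtain q where "q \<in> T" "w q = Max (w ` T)" by auto
      then show ?thesis using that T(1) by simp
    qed
    obtain i k where ik: "q = (i, k)" "i < r" "enat k < x i" using q(1) T(2) by auto
    have Fq: "F q' \<in> carrier (?S q')" if "q' \<in> ?I" for q' by (rule direct_sum_mem[OF F' that])
    have gF: "g q' (F q') \<in> carrier M" if "q' \<in> T" for q'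
      using rmod_hom_closed[OF g[OF subsetD[OF T(2) that]] Fq[OF subsetD[OF T(2) that]]] .
    have "(\<Oplus>\<^bsub>M\<^esub>q'\<in>T - {q}. g q' (F q')) \<in> low (b i k)"
    proof (rule M.submodule_finsum[OF low_sub])
      fix q' assume q': "q' \<in> T - {q}"
      obtain i' k' where ik': "q' = (i', k')" "i' < r" "enat k' < x i'" using q' T(2) by auto
      have "w q' \<noteq> w q"
        using b_inj[OF ik(2,3) ik'(2,3)] inj_onD[OF idx _ bK(1)[OF ik'(2,3)] bK(1)[OF ik(2,3)]] q' ik(1) ik'(1)
        by (auto simp: w_def)
      then have "idx (b i' k') < idx (b i k)" using q(2)[of q'] q' ik(1) ik'(1) by (auto simp: w_def)
      then have "f (b i' k') (F q') \<in> low (b i k)"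
        using low_mem[OF bK(1)[OF ik'(2,3)]] Fq[of q'] ik' bK(3)[OF ik'(2,3)] by auto
      then show "g q' (F q') \<in> low (b i k)" using ik'(1) by (simp add: g_def)
    qed (use T in auto)
    moreover have "\<zero>\<^bsub>M\<^esub> = g q (F q) \<oplus>\<^bsub>M\<^esub> (\<Oplus>\<^bsub>M\<^esub>q'\<in>T - {q}. g q' (F q'))"
    proof -
      have "\<zero>\<^bsub>M\<^esub> = (\<Oplus>\<^bsub>M\<^esub>q'\<in>insert q (T - {q}). g q' (F q'))"
        using \<pi>F q(1) unfolding \<pi>_def direct_sum_map_def T_def[symmetric] by (simp add: insert_absorb)
      also have "\<dots> = g q (F q) \<oplus>\<^bsub>M\<^esub> (\<Oplus>\<^bsub>M\<^esub>q'\<in>T - {q}. g q' (F q'))"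
        using T(1) gF q(1) by (intro M.M.finsum_insert) auto
      finally show ?thesis .
    qed
    moreover have "(\<Oplus>\<^bsub>M\<^esub>q'\<in>T - {q}. g q' (F q')) \<in> carrier M"
      using gF by (intro M.M.finsum_closed) auto
    ultimately have "\<ominus>\<^bsub>M\<^esub> (\<Oplus>\<^bsub>M\<^esub>q'\<in>T - {q}. g q' (F q')) = g q (F q)"
      and "\<ominus>\<^bsub>M\<^esub> (\<Oplus>\<^bsub>M\<^esub>q'\<in>T - {q}. g q' (F q')) \<in> low (b i k)"
      using submodule_neg[OF low_sub] gF[OF q(1)] by (auto intro: M.M.minus_equality)
    then have "g q (F q) \<in> low (b i k)" by simp
    then have fF: "f (b i k) (F q) \<in> low (b i k)" using ik(1) by (simp add: g_def)
    \<comment> \<open>A nonzero element generates \<open>S i\<close>, so one nonzero element mapped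
      into the span drags the whole image along, against the choice of \<open>K\<close>.\<close>
    have "f (b i k) u \<in> low (b i k)" if u: "u \<in> carrier (S i)" for u
    proof -
      have F0: "F q \<in> carrier (S i)" "F q \<noteq> \<zero>\<^bsub>S i\<^esub>" using q(1) Fq[of q] ik by (auto simp: T_def)
      obtain a where a: "a \<in> carrier A" "u = a \<odot>\<^bsub>S i\<^esub> F q"
        using simple_rmodule_cyclic[OF S[OF ik(2)] F0 u] by blast
      then have "f (b i k) u = a \<odot>\<^bsub>M\<^esub> f (b i k) (F q)"
        using rmod_hom_smult[OF f[OF bK(1)[OF ik(2,3)]] a(1)] F0(1) bK(3)[OF ik(2,3)] by simp
      then show ?thesis using submodule_smult[OF low_sub a(1) fF] by simp
    qed
    then show False using bK(2,3)[OF ik(2,3)] by (auto simp: K_def)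
  qed
  then have "bij_betw \<pi> (carrier (simple_sum r S x)) (carrier M)" using surj by (simp add: bij_betw_def)
  then have "rmod_iso A M (simple_sum r S x)"
    unfolding rmod_iso_def using rmod_hom_inv_into[OF D \<pi>] bij_betw_inv_into by blast
  then show ?thesis by (intro exI[of _ x]) (auto simp: x_def)
qed

text \<open>The hypothesis on \<open>e\<close> says that each nonzero element of eA generates
  \<open>e\<close>, so eA is simple and isomorphic to some \<open>S i\<close>. The map
  \<open>\<sigma>\<close> is the inverse of this isomorphism followed by the inclusion of eA in
  \<open>A\<close>.\<close>

lemma minimal_right_ideal_representative:
  fixes A :: "('a, 'k) ring_scheme" and S :: "nat \<Rightarrow> ('a, 's) module"
  assumes A: "ring A" and S: "simple_representatives A r S"
    and e: "e \<in> carrier A" "e \<noteq> \<zero>\<^bsub>A\<^esub>"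
    and min: "\<And>a. a \<in> carrier A \<Longrightarrow> e \<otimes>\<^bsub>A\<^esub> a = \<zero>\<^bsub>A\<^esub> \<or> (\<exists>b\<in>carrier A. (e \<otimes>\<^bsub>A\<^esub> a) \<otimes>\<^bsub>A\<^esub> b = e)"
  shows "\<exists>i<r. \<exists>\<sigma>\<in>rmod_hom A (S i) (regular_rmodule A). e \<in> \<sigma> ` carrier (S i)"
proof -
  interpret A: ring A by fact
  \<comment> \<open>\<open>e A\<close>, carried by singletons since completeness of \<open>S\<close> is about modules of sets of elements of \<open>A\<close>\<close>
  define N :: "('a, 'a set) module" where
    "N = \<lparr>carrier = (\<lambda>a. {e \<otimes>\<^bsub>A\<^esub> a}) ` carrier A, monoid.mult = undefined, one = undefined,
      ring.zero = {\<zero>\<^bsub>A\<^esub>}, ring.add = (\<lambda>U V. {the_elem U \<oplus>\<^bsub>A\<^esub> the_elem V}),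
      module.smult = (\<lambda>a U. {the_elem U \<otimes>\<^bsub>A\<^esub> a})\<rparr>"
  have N_simps: "carrier N = (\<lambda>a. {e \<otimes>\<^bsub>A\<^esub> a}) ` carrier A" "\<zero>\<^bsub>N\<^esub> = {\<zero>\<^bsub>A\<^esub>}"
    "\<And>u v. {u} \<oplus>\<^bsub>N\<^esub> {v} = {u \<oplus>\<^bsub>A\<^esub> v}" "\<And>a u. a \<odot>\<^bsub>N\<^esub> {u} = {u \<otimes>\<^bsub>A\<^esub> a}"
    by (simp_all add: N_def)
  have N: "right_module A N"
    by (rule right_module_image[OF right_module_regular[OF A] A, of "\<lambda>a. a" N "\<lambda>a. {e \<otimes>\<^bsub>A\<^esub> a}"])
      (use e in \<open>auto simp: N_simps A.r_distr A.m_assoc\<close>)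
  have eN: "{e} \<in> carrier N"
    unfolding N_simps using e by (intro image_eqI[of _ _ "\<one>\<^bsub>A\<^esub>"]) auto
  have "simple_rmodule A N"
    unfolding simple_rmodule_def
  proof (intro conjI allI impI N)
    show "carrier N \<noteq> {\<zero>\<^bsub>N\<^esub>}" using eN e(2) by (auto simp: N_simps(2))
    fix L assume L: "submodule L A N"
    show "L = {\<zero>\<^bsub>N\<^esub>} \<or> L = carrier N"
    proof (cases "L = {\<zero>\<^bsub>N\<^esub>}")
      case False
      then obtain U where "U \<in> L" "U \<noteq> \<zero>\<^bsub>N\<^esub>" using submodule_zero[OF L] by blast
      moreover from this obtain a where "a \<in> carrier A" "U = {e \<otimes>\<^bsub>A\<^esub> a}"
        using submodule_subset[OF L] by (auto simp: N_simps(1))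
      ultimately have a: "a \<in> carrier A" "{e \<otimes>\<^bsub>A\<^esub> a} \<in> L" "e \<otimes>\<^bsub>A\<^esub> a \<noteq> \<zero>\<^bsub>A\<^esub>"
        by (auto simp: N_simps(2))
      then obtain b where b: "b \<in> carrier A" "(e \<otimes>\<^bsub>A\<^esub> a) \<otimes>\<^bsub>A\<^esub> b = e" using min by blast
      have "{e} \<in> L" using submodule_smult[OF L b(1) a(2)] b(2) by (simp add: N_simps(4))
      then have "{e \<otimes>\<^bsub>A\<^esub> a} \<in> L" if "a \<in> carrier A" for a
        using submodule_smult[OF L that] by (force simp: N_simps(4))
      then show ?thesis using submodule_subset[OF L] by (auto simp: N_simps(1))
    qed simp
  qed
  then obtain i h where i: "i < r" and h: "h \<in> rmod_hom A N (S i)" "bij_betw h (carrier N) (carrier (S i))"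
    using S unfolding simple_representatives_def rmod_iso_def by blast
  have "the_elem \<in> rmod_hom A N (regular_rmodule A)"
    by (rule rmod_homI) (use e in \<open>auto simp: N_simps\<close>)
  from rmod_hom_comp[OF this rmod_hom_inv_into[OF N h]]
  have \<sigma>: "(\<lambda>s. the_elem (inv_into (carrier N) h s)) \<in> rmod_hom A (S i) (regular_rmodule A)" .
  have "e = the_elem (inv_into (carrier N) h (h {e}))" "h {e} \<in> carrier (S i)"
    using h eN by (auto simp: bij_betw_def inv_into_f_f)
  then have "e \<in> (\<lambda>s. the_elem (inv_into (carrier N) h s)) ` carrier (S i)" by (rule image_eqI)
  then show ?thesis using i by (intro exI[of _ i] conjI bexI[OF _ \<sigma>])
qed

lemma minimal_generators_one:
  "minimal_generators A E \<Longrightarrow> L \<subseteq> carrier A \<Longrightarrow> E \<subseteq> L \<Longrightarrow> \<zero>\<^bsub>A\<^esub> \<in> L \<Longrightarrow>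
    \<forall>x\<in>L. \<forall>y\<in>L. x \<oplus>\<^bsub>A\<^esub> y \<in> L \<Longrightarrow> \<one>\<^bsub>A\<^esub> \<in> L"
  by (simp add: minimal_generators_def)

text \<open>Since the identity is a sum of elements e of \<open>E\<close>, each generator y is a sum
  of elements ye, and ye lies in the image of a simple module under s |-> y \<sigma>(s). The pairs
  (y, e) give countably many such maps.\<close>

lemma simple_sum_exists:
  assumes M: "right_module A M" and S: "simple_representatives A r S" and E: "minimal_generators A E"
    and Y: "countable Y" "Y \<subseteq> carrier M" "\<And>N. submodule N A M \<Longrightarrow> Y \<subseteq> N \<Longrightarrow> N = carrier M"
  shows "\<exists>x. (\<forall>i\<ge>r. x i = 0) \<and> rmod_iso A M (simple_sum r S x)"
proof -
  interpret M: right_module A M by fact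
  have Sim: "simple_rmodule A (S i)" if "i < r" for i
    using S that by (simp add: simple_representatives_def)
  \<comment> \<open>Generators may be zero, and then eA is not simple; these are set aside.\<close>
  let ?E = "E - {\<zero>\<^bsub>A\<^esub>}"
  have EA: "E \<subseteq> carrier A" "finite E" using E by (auto simp: minimal_generators_def)
  have min: "e \<otimes>\<^bsub>A\<^esub> a = \<zero>\<^bsub>A\<^esub> \<or> (\<exists>b\<in>carrier A. (e \<otimes>\<^bsub>A\<^esub> a) \<otimes>\<^bsub>A\<^esub> b = e)" if "e \<in> E" "a \<in> carrier A" for e a
    using E that unfolding minimal_generators_def by blast
  have "\<exists>i \<sigma>. i < r \<and> \<sigma> \<in> rmod_hom A (S i) (regular_rmodule A) \<and> e \<in> \<sigma> ` carrier (S i)" if "e \<in> ?E" for e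
    using minimal_right_ideal_representative[OF M.R.ring_axioms S, of e] min[of e] that EA by blast
  then obtain t \<sigma> where t: "\<And>e. e \<in> ?E \<Longrightarrow> t e < r"
    and \<sigma>: "\<And>e. e \<in> ?E \<Longrightarrow> \<sigma> e \<in> rmod_hom A (S (t e)) (regular_rmodule A)"
    and e\<sigma>: "\<And>e. e \<in> ?E \<Longrightarrow> e \<in> \<sigma> e ` carrier (S (t e))" by metis
  show ?thesis
  proof (rule semisimple_decomposition[OF M Sim, where C = "Y \<times> ?E" and t = "\<lambda>(y, e). t e"
        and f = "\<lambda>(y, e) s. \<sigma> e s \<odot>\<^bsub>M\<^esub> y"])
    show "countable (Y \<times> ?E)" using Y(1) EA(2) by (simp add: countable_finite)
    show "(case c of (y, e) \<Rightarrow> t e) < r" if "c \<in> Y \<times> ?E" for c using that t by auto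
    show "(case c of (y, e) \<Rightarrow> \<lambda>s. \<sigma> e s \<odot>\<^bsub>M\<^esub> y) \<in> rmod_hom A (S (case c of (y, e) \<Rightarrow> t e)) M"
      if "c \<in> Y \<times> ?E" for c
      using that \<sigma> Y(2) by (auto intro!: rank_one_hom[OF M])
    fix N assume N: "submodule N A M"
      and im: "\<And>c. c \<in> Y \<times> ?E \<Longrightarrow>
        (case c of (y, e) \<Rightarrow> \<lambda>s. \<sigma> e s \<odot>\<^bsub>M\<^esub> y) ` carrier (S (case c of (y, e) \<Rightarrow> t e)) \<subseteq> N"
    show "N = carrier M"
    proof (rule Y(3)[OF N], rule subsetI)
      fix y assume y: "y \<in> Y"
      then have yM: "y \<in> carrier M" using Y(2) by auto
      \<comment> \<open>The scalars that carry \<open>y\<close> into \<open>N\<close> are closed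
        under sums and contain \<open>E\<close>, hence contain the identity.\<close>
      let ?L = "{a \<in> carrier A. a \<odot>\<^bsub>M\<^esub> y \<in> N}"
      have "e \<in> ?L" if "e \<in> E" for e
      proof (cases "e = \<zero>\<^bsub>A\<^esub>")
        case True
        then show ?thesis using M.smult_zero_left[OF yM] submodule_zero[OF N] by simp
      next
        case False
        then have e: "e \<in> ?E" using that by simp
        then obtain s where "s \<in> carrier (S (t e))" "e = \<sigma> e s" using e\<sigma> by blast
        then show ?thesis using im[of "(y, e)"] e y EA(1) by auto
      qed
      then have "E \<subseteq> ?L" by blast
      moreover have "\<zero>\<^bsub>A\<^esub> \<in> ?L" using M.smult_zero_left[OF yM] submodule_zero[OF N] by simp
      moreover have "\<forall>a\<in>?L. \<forall>b\<in>?L. a \<oplus>\<^bsub>A\<^esub> b \<in> ?L"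
        using submodule_add[OF N] yM by (auto simp: M.smult_l_distr)
      ultimately have "\<one>\<^bsub>A\<^esub> \<in> ?L" by (intro minimal_generators_one[OF E]) auto
      then show "y \<in> N" using yM by (simp add: M.smult_one)
    qed
  qed
qed

section \<open>Lifting from the quotient by the radical\<close>

text \<open>Extension by zero followed by restriction. Applied to the index sets of the copies of
  the \<open>S i\<close>, it turns the inequality of dimensions into a split inclusion of semisimple
  modules.\<close>

lemma direct_sum_subset_homs:
  assumes R: "ring R" and M: "\<And>i. i \<in> I' \<Longrightarrow> right_module R (M i)" and sub: "I \<subseteq> I'"
  shows "\<exists>f\<in>rmod_hom R (direct_sum_rmodule I M) (direct_sum_rmodule I' M).
    \<exists>g\<in>rmod_hom R (direct_sum_rmodule I' M) (direct_sum_rmodule I M).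
      \<forall>F\<in>carrier (direct_sum_rmodule I M). g (f F) = F"
proof (intro bexI ballI)
  let ?f = "\<lambda>F. \<lambda>i\<in>I'. if i \<in> I then F i else \<zero>\<^bsub>M i\<^esub>" and ?g = "\<lambda>G. restrict G I"
  have zero: "\<zero>\<^bsub>M i\<^esub> \<in> carrier (M i)" "\<zero>\<^bsub>M i\<^esub> \<oplus>\<^bsub>M i\<^esub> \<zero>\<^bsub>M i\<^esub> = \<zero>\<^bsub>M i\<^esub>"
    "a \<in> carrier R \<Longrightarrow> a \<odot>\<^bsub>M i\<^esub> \<zero>\<^bsub>M i\<^esub> = \<zero>\<^bsub>M i\<^esub>" if "i \<in> I'" for i a
  proof -
    interpret right_module R "M i" by (rule M[OF that])
    show "\<zero>\<^bsub>M i\<^esub> \<in> carrier (M i)" "\<zero>\<^bsub>M i\<^esub> \<oplus>\<^bsub>M i\<^esub> \<zero>\<^bsub>M i\<^esub> = \<zero>\<^bsub>M i\<^esub>"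
      "a \<in> carrier R \<Longrightarrow> a \<odot>\<^bsub>M i\<^esub> \<zero>\<^bsub>M i\<^esub> = \<zero>\<^bsub>M i\<^esub>"
      by (simp_all add: smult_zero_right)
  qed
  show "?f \<in> rmod_hom R (direct_sum_rmodule I M) (direct_sum_rmodule I' M)"
  proof (rule rmod_homI)
    fix F assume F: "F \<in> carrier (direct_sum_rmodule I M)"
    have "{i \<in> I'. ?f F i \<noteq> \<zero>\<^bsub>M i\<^esub>} \<subseteq> {i \<in> I. F i \<noteq> \<zero>\<^bsub>M i\<^esub>}" by auto
    then have "finite {i \<in> I'. ?f F i \<noteq> \<zero>\<^bsub>M i\<^esub>}"
      using F unfolding direct_sum_carrier by (elim conjE) (rule finite_subset)
    then show "?f F \<in> carrier (direct_sum_rmodule I' M)"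
      unfolding direct_sum_carrier using direct_sum_mem[OF F] zero(1) by (intro conjI) auto
  qed (use sub zero in \<open>auto simp: direct_sum_simps fun_eq_iff\<close>)
  show "?g \<in> rmod_hom R (direct_sum_rmodule I' M) (direct_sum_rmodule I M)"
  proof (rule rmod_homI)
    fix G assume G: "G \<in> carrier (direct_sum_rmodule I' M)"
    have "{i \<in> I. ?g G i \<noteq> \<zero>\<^bsub>M i\<^esub>} \<subseteq> {i \<in> I'. G i \<noteq> \<zero>\<^bsub>M i\<^esub>}" using sub by auto
    then have "finite {i \<in> I. ?g G i \<noteq> \<zero>\<^bsub>M i\<^esub>}"
      using G unfolding direct_sum_carrier by (elim conjE) (rule finite_subset)
    then show "?g G \<in> carrier (direct_sum_rmodule I M)"
      unfolding direct_sum_carrier using direct_sum_mem[OF G] sub by (intro conjI) auto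
  qed (use sub in \<open>auto simp: direct_sum_simps fun_eq_iff\<close>)
  show "?g (?f F) = F" if "F \<in> carrier (direct_sum_rmodule I M)" for F
    using that sub by (auto simp: direct_sum_carrier PiE_iff extensional_def fun_eq_iff)
qed

text \<open>The definition of projectivity fixes the types of the test modules, while the modules
  used here consist of cosets or lie on the type of another module. A dual basis frees the lifting
  property from these types: the generator \<open>k\<close> goes to a chosen preimage
  \<open>b k\<close> of \<open>f k\<close>.\<close>

lemma projective_lift:
  assumes P: "projective_rmodule R P" and B: "right_module R B" and C: "right_module R C"
    and g: "g \<in> rmod_hom R B C" "g ` carrier B = carrier C" and f: "f \<in> rmod_hom R P C"
  shows "\<exists>h\<in>rmod_hom R P B. \<forall>x\<in>carrier P. g (h x) = f x"
proof -
  have P': "right_module R P" using P by (simp add: projective_rmodule_def)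
  interpret P: right_module R P by fact
  interpret B: right_module R B by fact
  interpret C: right_module R C by fact
  obtain l where l: "dual_basis R P l" using projective_dual_basis[OF P] ..
  note lh = dual_basis_hom[OF l]
  have reg: "right_module R (regular_rmodule R)" by (rule right_module_regular[OF P.R.ring_axioms])
  have "\<exists>b\<in>carrier B. g b = f k" if "k \<in> carrier P" for k
    using rmod_hom_closed[OF f that] g(2) by (metis imageE)
  then obtain b where b: "\<And>k. k \<in> carrier P \<Longrightarrow> b k \<in> carrier B" "\<And>k. k \<in> carrier P \<Longrightarrow> g (b k) = f k"
    by metis
  let ?s = "\<lambda>x. {k \<in> carrier P. l k x \<noteq> \<zero>\<^bsub>R\<^esub>}"
  have lc: "l k x \<in> carrier R" if "k \<in> carrier P" "x \<in> carrier P" for k x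
    using rmod_hom_closed[OF lh[OF that(1)] that(2)] by simp
  have fin: "finite (?s x)" if "x \<in> carrier P" for x
    using l that by (simp add: dual_basis_def)
  \<comment> \<open>The coordinates collected into an element of the free module, so that
    \<open>h\<close> is a composite of homomorphisms although its defining sum runs over a support
    that depends on x.\<close>
  define co where "co = (\<lambda>x. \<lambda>k\<in>carrier P. l k x)"
  have co: "co \<in> rmod_hom R P (direct_sum_rmodule (carrier P) (\<lambda>_. regular_rmodule R))"
  proof (rule rmod_homI)
    fix x assume x: "x \<in> carrier P"
    have "{k \<in> carrier P. co x k \<noteq> \<zero>\<^bsub>regular_rmodule R\<^esub>} = ?s x" by (auto simp: co_def)
    then show "co x \<in> carrier (direct_sum_rmodule (carrier P) (\<lambda>_. regular_rmodule R))"
      unfolding direct_sum_carrier using fin[OF x] lc x by (auto simp: co_def)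
  qed (auto simp: co_def direct_sum_simps fun_eq_iff rmod_hom_add[OF lh] rmod_hom_smult[OF lh])
  have bk: "(\<lambda>a. a \<odot>\<^bsub>B\<^esub> b k) \<in> rmod_hom R (regular_rmodule R) B" if "k \<in> carrier P" for k
    by (rule rank_one_hom[OF B rmod_hom_id b(1)[OF that]])
  define h where "h = (\<lambda>x. direct_sum_map (carrier P) (\<lambda>_. regular_rmodule R) B (\<lambda>k a. a \<odot>\<^bsub>B\<^esub> b k) (co x))"
  have "h \<in> rmod_hom R P B"
    unfolding h_def by (rule rmod_hom_comp[OF direct_sum_map_hom[OF P.R.ring_axioms reg B bk] co])
  moreover have "g (h x) = f x" if x: "x \<in> carrier P" for x
  proof -
    have "h x = (\<Oplus>\<^bsub>B\<^esub>k\<in>?s x. l k x \<odot>\<^bsub>B\<^esub> b k)"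
    proof -
      have "{k \<in> carrier P. co x k \<noteq> \<zero>\<^bsub>regular_rmodule R\<^esub>} = ?s x" by (auto simp: co_def)
      then show ?thesis
        unfolding h_def direct_sum_map_def using lc b(1) x
        by (intro B.M.finsum_cong') (auto simp: co_def B.smult_closed)
    qed
    then have "g (h x) = (\<Oplus>\<^bsub>C\<^esub>k\<in>?s x. g (l k x \<odot>\<^bsub>B\<^esub> b k))"
      using rmod_hom_finsum[OF B C g(1) fin[OF x], of "\<lambda>k. l k x \<odot>\<^bsub>B\<^esub> b k"] lc b(1) x
      by (simp add: Pi_def B.smult_closed)
    also have "\<dots> = (\<Oplus>\<^bsub>C\<^esub>k\<in>?s x. f (l k x \<odot>\<^bsub>P\<^esub> k))"
      using lc b x rmod_hom_closed[OF f]
      by (intro C.M.finsum_cong') (auto simp: rmod_hom_smult[OF g(1)] rmod_hom_smult[OF f] C.smult_closed)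
    also have "\<dots> = f (\<Oplus>\<^bsub>P\<^esub>k\<in>?s x. l k x \<odot>\<^bsub>P\<^esub> k)"
      using lc x by (intro rmod_hom_finsum[OF P' C f fin[OF x], symmetric]) (auto simp: P.smult_closed)
    also have "\<dots> = f x"
      using dual_basis_expand[OF P' l x fin[OF x]] by simp
    finally show ?thesis .
  qed
  ultimately show ?thesis by blast
qed

text \<open>Views a module over R/I as one over \<open>R\<close>, so that the projection of a module
  onto its quotient becomes an \<open>R\<close>-homomorphism along which maps can be lifted.\<close>

definition restrict_scalars :: "('a \<Rightarrow> 'c) \<Rightarrow> ('c, 'b, 'm) module_scheme \<Rightarrow> ('a, 'b) module"
  where "restrict_scalars \<rho> N =
    \<lparr>carrier = carrier N, monoid.mult = undefined, one = undefined, ring.zero = \<zero>\<^bsub>N\<^esub>,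
     ring.add = ring.add N, module.smult = (\<lambda>a x. \<rho> a \<odot>\<^bsub>N\<^esub> x)\<rparr>"

lemma restrict_scalars_simps [simp]:
  "carrier (restrict_scalars \<rho> N) = carrier N" "\<zero>\<^bsub>restrict_scalars \<rho> N\<^esub> = \<zero>\<^bsub>N\<^esub>"
  "x \<oplus>\<^bsub>restrict_scalars \<rho> N\<^esub> y = x \<oplus>\<^bsub>N\<^esub> y" "a \<odot>\<^bsub>restrict_scalars \<rho> N\<^esub> x = \<rho> a \<odot>\<^bsub>N\<^esub> x"
  by (simp_all add: restrict_scalars_def)

section \<open>The quotient of a module by its product with an ideal\<close>

context right_module
begin

context
  fixes I
  assumes I: "ideal I R"
begin

interpretation I: ideal I R by (rule I)

abbreviation (input) "MI \<equiv> rmod_ideal_mult R M I"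

abbreviation (input) "quot x \<equiv> MI +>\<^bsub>M\<^esub> x"

lemma submodule_ideal_mult: "submodule MI R M"
  by (rule submodule_rmod_ideal_mult[OF right_module_axioms I.a_subset])

lemma ideal_mult_mem: "a \<in> I \<Longrightarrow> x \<in> carrier M \<Longrightarrow> a \<odot>\<^bsub>M\<^esub> x \<in> MI"
  unfolding rmod_ideal_mult_def by (rule subsetD[OF span_superset]) auto

lemma abelian_subgroup_ideal_mult: "abelian_subgroup MI M"
  using submodule_ideal_mult
  by (intro abelian_subgroupI3 additive_subgroupI) (auto simp: submodule_def M.abelian_group_axioms)

lemma quot_rmodule_carrier: "carrier (quot_rmodule R M I) = (\<lambda>x. quot x) ` carrier M"
  by (auto simp: quot_rmodule_def A_RCOSETS_def')

lemma quot_zero: "quot \<zero>\<^bsub>M\<^esub> = \<zero>\<^bsub>quot_rmodule R M I\<^esub>"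
  using submodule_subset[OF submodule_ideal_mult] by (simp add: quot_rmodule_def)

lemma quot_add:
  "x \<in> carrier M \<Longrightarrow> y \<in> carrier M \<Longrightarrow> quot (x \<oplus>\<^bsub>M\<^esub> y) = quot x \<oplus>\<^bsub>quot_rmodule R M I\<^esub> quot y"
  by (simp add: quot_rmodule_def abelian_subgroup.a_rcos_sum[OF abelian_subgroup_ideal_mult])

lemma quot_add_left: "n \<in> MI \<Longrightarrow> x \<in> carrier M \<Longrightarrow> quot (n \<oplus>\<^bsub>M\<^esub> x) = quot x"
proof -
  assume nx: "n \<in> MI" "x \<in> carrier M"
  then have "n \<oplus>\<^bsub>M\<^esub> x \<in> quot x" by (auto simp: a_r_coset_def')
  then show ?thesis
    using abelian_subgroup.a_repr_independence'[OF abelian_subgroup_ideal_mult _ nx(2)] by simp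
qed

lemma quot_eqD: "x \<in> carrier M \<Longrightarrow> y \<in> carrier M \<Longrightarrow> quot x = quot y \<Longrightarrow> x \<ominus>\<^bsub>M\<^esub> y \<in> MI"
proof -
  assume xy: "x \<in> carrier M" "y \<in> carrier M" "quot x = quot y"
  have "x \<in> quot x"
    by (rule abelian_subgroup.a_rcos_self[OF abelian_subgroup_ideal_mult xy(1)])
  then obtain n where n: "n \<in> MI" "x = n \<oplus>\<^bsub>M\<^esub> y" using xy(3) by (auto simp: a_r_coset_def')
  moreover have "n \<in> carrier M" using n(1) submodule_subset[OF submodule_ideal_mult] by auto
  ultimately show ?thesis using xy by (simp add: a_minus_def M.a_assoc M.r_neg)
qed

text \<open>The action on cosets is a union over all representatives. Replacing a by j + a and x by
  n + x changes xa by (n + x)j + na, which lies in MI, so all the cosets in the union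
  coincide.\<close>

lemma quot_smult:
  assumes a: "a \<in> carrier R" and x: "x \<in> carrier M"
  shows "quot (a \<odot>\<^bsub>M\<^esub> x) = (I +> a) \<odot>\<^bsub>quot_rmodule R M I\<^esub> quot x"
proof -
  note MI = submodule_facts[OF submodule_ideal_mult]
  have const: "quot (b \<odot>\<^bsub>M\<^esub> y) = quot (a \<odot>\<^bsub>M\<^esub> x)" if b: "b \<in> I +> a" and y: "y \<in> quot x" for b y
  proof -
    obtain j where j: "j \<in> I" "b = j \<oplus> a" using b by (auto simp: a_r_coset_def')
    obtain n where n: "n \<in> MI" "y = n \<oplus>\<^bsub>M\<^esub> x" using y by (auto simp: a_r_coset_def')
    have jn: "j \<in> carrier R" "n \<in> carrier M" "y \<in> carrier M" using j n x MI(1) I.a_subset by auto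
    have "b \<odot>\<^bsub>M\<^esub> y = (j \<odot>\<^bsub>M\<^esub> y \<oplus>\<^bsub>M\<^esub> a \<odot>\<^bsub>M\<^esub> n) \<oplus>\<^bsub>M\<^esub> a \<odot>\<^bsub>M\<^esub> x"
      unfolding j(2) smult_l_distr[OF jn(1) a jn(3)]
      using jn a x by (simp add: n(2) smult_r_distr M.a_assoc smult_closed)
    moreover have "j \<odot>\<^bsub>M\<^esub> y \<oplus>\<^bsub>M\<^esub> a \<odot>\<^bsub>M\<^esub> n \<in> MI"
      by (intro MI(3) ideal_mult_mem MI(4) j n jn a)
    ultimately show ?thesis using quot_add_left[OF _ smult_closed[OF a x]] by simp
  qed
  have "a \<in> I +> a" by (rule I.a_rcos_self[OF a])
  moreover have "x \<in> quot x"
    by (rule abelian_subgroup.a_rcos_self[OF abelian_subgroup_ideal_mult x])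
  ultimately have ne: "I +> a \<noteq> {}" "quot x \<noteq> {}" by auto
  have "(\<Union>b\<in>I +> a. \<Union>y\<in>quot x. quot (b \<odot>\<^bsub>M\<^esub> y)) = (\<Union>b\<in>I +> a. \<Union>y\<in>quot x. quot (a \<odot>\<^bsub>M\<^esub> x))"
    by (intro SUP_cong refl const)
  also have "\<dots> = quot (a \<odot>\<^bsub>M\<^esub> x)" using ne by simp
  finally show ?thesis unfolding quot_rmodule_def by simp
qed

lemma coset_ring_hom:
  "b \<in> carrier (R Quot I) \<Longrightarrow> \<exists>a\<in>carrier R. b = I +> a"
  "a \<in> carrier R \<Longrightarrow> a' \<in> carrier R \<Longrightarrow> I +> (a \<oplus> a') = (I +> a) \<oplus>\<^bsub>R Quot I\<^esub> (I +> a')"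
  "a \<in> carrier R \<Longrightarrow> a' \<in> carrier R \<Longrightarrow> I +> (a \<otimes> a') = (I +> a) \<otimes>\<^bsub>R Quot I\<^esub> (I +> a')"
  "I +> \<one> = \<one>\<^bsub>R Quot I\<^esub>"
  using I.rcos_ring_hom by (auto simp: ring_hom_def FactRing_def A_RCOSETS_def')

lemma right_module_quot: "right_module (R Quot I) (quot_rmodule R M I)"
  by (rule right_module_image[OF right_module_axioms I.quotient_is_ring, where \<rho> = "\<lambda>a. I +> a" and q = "\<lambda>x. quot x"])
    (fact coset_ring_hom quot_rmodule_carrier quot_zero quot_add quot_smult)+

lemma right_module_quot_restrict: "right_module R (restrict_scalars (\<lambda>a. I +> a) (quot_rmodule R M I))"
  by (rule right_module_image[OF right_module_axioms R.ring_axioms, where \<rho> = "\<lambda>a. a" and q = "\<lambda>x. quot x"])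
    (auto simp: quot_rmodule_carrier quot_zero quot_add quot_smult)

lemma quot_hom: "(\<lambda>x. quot x) \<in> rmod_hom R M (restrict_scalars (\<lambda>a. I +> a) (quot_rmodule R M I))"
  by (rule rmod_homI) (auto simp: quot_rmodule_carrier quot_add quot_smult)

end

end

lemma rmod_hom_ideal_mult:
  assumes M: "right_module R M" and N: "right_module R N" and f: "f \<in> rmod_hom R M N"
    and I: "ideal I R" and x: "x \<in> rmod_ideal_mult R M I"
  shows "f x \<in> rmod_ideal_mult R N I"
proof -
  interpret M: right_module R M by fact
  interpret N: right_module R N by fact
  have IR: "I \<subseteq> carrier R" by (rule additive_subgroup.a_subset[OF ideal.axioms(1)[OF I]])
  have "submodule {x \<in> carrier M. f x \<in> rmod_ideal_mult R N I} R M"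
    by (rule submodule_vimage[OF M N f N.submodule_ideal_mult[OF I]])
  then have "rmod_ideal_mult R M I \<subseteq> {x \<in> carrier M. f x \<in> rmod_ideal_mult R N I}"
    unfolding rmod_ideal_mult_def[of R M] using IR rmod_hom_closed[OF f]
    by (intro M.span_least)
      (auto simp: rmod_hom_smult[OF f] M.smult_closed subset_iff intro!: N.ideal_mult_mem[OF I])
  then show ?thesis using x by blast
qed

lemma rmod_hom_quot_induced:
  assumes M: "right_module R M" and N: "right_module R N" and f: "f \<in> rmod_hom R M N" and I: "ideal I R"
  shows "\<exists>g\<in>rmod_hom (R Quot I) (quot_rmodule R M I) (quot_rmodule R N I).
    \<forall>x\<in>carrier M. g (rmod_ideal_mult R M I +>\<^bsub>M\<^esub> x) = rmod_ideal_mult R N I +>\<^bsub>N\<^esub> f x"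
proof -
  interpret M: right_module R M by fact
  interpret N: right_module R N by fact
  let ?q = "\<lambda>x. rmod_ideal_mult R M I +>\<^bsub>M\<^esub> x" and ?p = "\<lambda>x. rmod_ideal_mult R N I +>\<^bsub>N\<^esub> x"
  have eq: "?p (f x) = ?p (f y)" if xy: "x \<in> carrier M" "y \<in> carrier M" "?q x = ?q y" for x y
  proof -
    have "f (x \<ominus>\<^bsub>M\<^esub> y) \<in> rmod_ideal_mult R N I"
      by (rule rmod_hom_ideal_mult[OF M N f I M.quot_eqD[OF I xy]])
    then have "?p (f (x \<ominus>\<^bsub>M\<^esub> y) \<oplus>\<^bsub>N\<^esub> f y) = ?p (f y)"
      using rmod_hom_closed[OF f xy(2)] by (rule N.quot_add_left[OF I])
    moreover have "f (x \<ominus>\<^bsub>M\<^esub> y) \<oplus>\<^bsub>N\<^esub> f y = f x"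
      using xy rmod_hom_add[OF f, of "x \<ominus>\<^bsub>M\<^esub> y" y] by (simp add: a_minus_def M.M.a_assoc M.M.l_neg)
    ultimately show ?thesis by simp
  qed
  \<comment> \<open>A representative of the coset is chosen; by \<open>eq\<close> the result does
    not depend on the choice, because \<open>f\<close> maps MI into NI.\<close>
  define g where "g = (\<lambda>Y. ?p (f (SOME x. x \<in> carrier M \<and> ?q x = Y)))"
  have gq: "g (?q x) = ?p (f x)" if x: "x \<in> carrier M" for x
  proof -
    have "\<exists>u. u \<in> carrier M \<and> ?q u = ?q x" using x by blast
    from someI_ex[OF this] show ?thesis unfolding g_def using x by (intro eq) auto
  qed
  have "g \<in> rmod_hom (R Quot I) (quot_rmodule R M I) (quot_rmodule R N I)"
  proof (rule rmod_homI)
    fix Y assume "Y \<in> carrier (quot_rmodule R M I)"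
    then obtain x where x: "x \<in> carrier M" "Y = ?q x" by (auto simp: M.quot_rmodule_carrier[OF I])
    then show "g Y \<in> carrier (quot_rmodule R N I)"
      using rmod_hom_closed[OF f] by (simp add: gq N.quot_rmodule_carrier[OF I])
    fix Z assume "Z \<in> carrier (quot_rmodule R M I)"
    then obtain y where y: "y \<in> carrier M" "Z = ?q y" by (auto simp: M.quot_rmodule_carrier[OF I])
    show "g (Y \<oplus>\<^bsub>quot_rmodule R M I\<^esub> Z) = g Y \<oplus>\<^bsub>quot_rmodule R N I\<^esub> g Z"
      using x y rmod_hom_closed[OF f]
      by (simp add: M.quot_add[OF I, symmetric] gq rmod_hom_add[OF f] N.quot_add[OF I])
  next
    fix b Y assume b: "b \<in> carrier (R Quot I)" and "Y \<in> carrier (quot_rmodule R M I)"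
    then obtain x where x: "x \<in> carrier M" "Y = ?q x" by (auto simp: M.quot_rmodule_carrier[OF I])
    obtain a where a: "a \<in> carrier R" "b = I +>\<^bsub>R\<^esub> a" using M.coset_ring_hom(1)[OF I b] ..
    with x show "g (b \<odot>\<^bsub>quot_rmodule R M I\<^esub> Y) = b \<odot>\<^bsub>quot_rmodule R N I\<^esub> g Y"
      using rmod_hom_closed[OF f]
      by (simp add: M.quot_smult[OF I, symmetric] gq rmod_hom_smult[OF f] N.quot_smult[OF I] M.smult_closed)
  qed
  then show ?thesis using gq by blast
qed

text \<open>Over \<open>R\<close>, the map \<open>h\<close> after the projection of \<open>P\<close>
  is a homomorphism to the quotient of \<open>Q\<close>, and it lifts along the surjection from
  \<open>Q\<close>.\<close>

lemma projective_lift_quot: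
  assumes P: "projective_rmodule R P" and Q: "right_module R Q" and I: "ideal I R"
    and h: "h \<in> rmod_hom (R Quot I) (quot_rmodule R P I) (quot_rmodule R Q I)"
  shows "\<exists>f\<in>rmod_hom R P Q. \<forall>x\<in>carrier P.
    rmod_ideal_mult R Q I +>\<^bsub>Q\<^esub> f x = h (rmod_ideal_mult R P I +>\<^bsub>P\<^esub> x)"
proof -
  interpret P: right_module R P using P by (simp add: projective_rmodule_def)
  interpret Q: right_module R Q by fact
  let ?r = "restrict_scalars (\<lambda>a. I +>\<^bsub>R\<^esub> a)"
  have coset: "I +>\<^bsub>R\<^esub> a \<in> carrier (R Quot I)" if "a \<in> carrier R" for a
    using that by (auto simp: FactRing_def A_RCOSETS_def')
  have "h \<in> rmod_hom R (?r (quot_rmodule R P I)) (?r (quot_rmodule R Q I))"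
    by (rule rmod_homI) (auto simp: rmod_hom_closed[OF h] rmod_hom_add[OF h] rmod_hom_smult[OF h coset])
  from rmod_hom_comp[OF this P.quot_hom[OF I]]
  show ?thesis
    by (intro projective_lift[OF P Q Q.right_module_quot_restrict[OF I] Q.quot_hom[OF I]])
      (simp_all add: Q.quot_rmodule_carrier[OF I])
qed

section \<open>Existence, uniqueness and comparison of dimensions\<close>

lemma rmod_iso_inverse:
  assumes "right_module R M" "rmod_iso R M N"
  obtains h k where "h \<in> rmod_hom R M N" "k \<in> rmod_hom R N M"
    "\<And>x. x \<in> carrier M \<Longrightarrow> k (h x) = x" "\<And>y. y \<in> carrier N \<Longrightarrow> h (k y) = y"
proof -
  obtain h where h: "h \<in> rmod_hom R M N" "bij_betw h (carrier M) (carrier N)"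
    using assms(2) by (auto simp: rmod_iso_def)
  show thesis
    by (rule that[OF h(1) rmod_hom_inv_into[OF assms(1) h]])
      (use h(2) in \<open>auto simp: bij_betw_def inv_into_f_f f_inv_into_f\<close>)
qed

text \<open>Infinite multiplicities are compared through their finite lower bounds, so only finitely
  many copies of a simple module have to be handled at a time.\<close>

lemma enat_le_from_finite:
  fixes a b :: enat
  assumes "\<And>n. enat n \<le> a \<Longrightarrow> enat n \<le> b"
  shows "a \<le> b"
  using assms by (cases a; cases b) (auto, metis Suc_n_not_le_n)

text \<open>The lifting hypothesis holds both for isomorphic sums and for the situation produced by
  (i), so the lemma serves the uniqueness of the dimension as well as its monotonicity. It is
  applied to n copies of one nonzero element of \<open>S i\<close>, one in each position.\<close>

lemma simple_sum_rank_le: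
  assumes S: "simple_representatives A r S"
    and lift: "\<And>Z. finite Z \<Longrightarrow> Z \<subseteq> carrier (simple_sum r S x) \<Longrightarrow>
      \<exists>g\<in>rmod_hom A (simple_sum r S y) (simple_sum r S x). Z \<subseteq> g ` carrier (simple_sum r S y)"
    and i: "i < r"
  shows "x i \<le> y i"
proof (rule enat_le_from_finite)
  fix n assume n: "enat n \<le> x i"
  have Sim: "simple_rmodule A (S i)" if "i < r" for i
    using S that by (simp add: simple_representatives_def)
  have rm: "right_module A (S i)" if "i < r" for i using Sim[OF that] by (simp add: simple_rmodule_def)
  interpret Si: right_module A "S i" by (rule rm[OF i])
  let ?I = "{(i, k). i < r \<and> enat k < x i}" and ?M = "\<lambda>(i, k). S i"
  obtain s where s: "s \<in> carrier (S i)" "s \<noteq> \<zero>\<^bsub>S i\<^esub>"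
    using Sim[OF i] Si.M.zero_closed unfolding simple_rmodule_def by blast
  have mem: "(i, k) \<in> ?I" if "k < n" for k
    using i n that by (auto intro: less_le_trans[of "enat k" "enat n"])
  define Z where "Z = (\<lambda>k. direct_sum_single ?I ?M (i, k) s) ` {..<n}"
  have "Z \<subseteq> carrier (simple_sum r S x)"
  proof
    fix z assume "z \<in> Z"
    then obtain k where k: "k < n" "z = direct_sum_single ?I ?M (i, k) s" by (auto simp: Z_def)
    have "direct_sum_single ?I ?M (i, k) \<in> rmod_hom A (?M (i, k)) (direct_sum_rmodule ?I ?M)"
      by (rule direct_sum_single_hom[OF Si.R.ring_axioms]) (use rm mem[OF k(1)] in auto)
    from rmod_hom_closed[OF this, of s] show "z \<in> carrier (simple_sum r S x)"
      using s k by (simp add: simple_sum_def)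
  qed
  then obtain g where g: "g \<in> rmod_hom A (simple_sum r S y) (simple_sum r S x)"
    and Zg: "Z \<subseteq> g ` carrier (simple_sum r S y)"
    using lift[of Z] by (auto simp: Z_def)
  have "\<forall>k\<in>{..<n}. \<exists>z. z \<in> carrier (simple_sum r S y) \<and> g z = direct_sum_single ?I ?M (i, k) s"
  proof
    fix k assume "k \<in> {..<n}"
    then have "direct_sum_single ?I ?M (i, k) s \<in> g ` carrier (simple_sum r S y)"
      by (intro subsetD[OF Zg]) (simp add: Z_def)
    then show "\<exists>z. z \<in> carrier (simple_sum r S y) \<and> g z = direct_sum_single ?I ?M (i, k) s"
      by (elim imageE) auto
  qed
  from bchoice[OF this] obtain z where z: "\<And>k. k < n \<Longrightarrow> z k \<in> carrier (simple_sum r S y)"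
    "\<And>k. k < n \<Longrightarrow> g (z k) = direct_sum_single ?I ?M (i, k) s" by auto
  have "enat (card {..<n}) \<le> y i"
  \<comment> \<open>The dual system: \<open>z k\<close> is a preimage of the vector with
    \<open>s\<close> in position k, and the functionals are the coordinates of
    \<open>g\<close>.\<close>
  proof (rule simple_sum_independent_card_le[OF Sim, where p = "\<lambda>j F. g F (i, j)" and z = z and s = s])
    show "(\<lambda>F. g F (i, j)) \<in> rmod_hom A (simple_sum r S y) (S i)" if "j \<in> {..<n}" for j
    proof -
      have "(\<lambda>F. F (i, j)) \<in> rmod_hom A (direct_sum_rmodule ?I ?M) (?M (i, j))"
        by (rule direct_sum_component_hom[OF Si.R.ring_axioms]) (use rm mem that in auto)
      then show ?thesis using g by (intro rmod_hom_comp[OF _ g]) (simp add: simple_sum_def)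
    qed
    show "g (z k) (i, j) = (if j = k then s else \<zero>\<^bsub>S i\<^esub>)" if "j \<in> {..<n}" "k \<in> {..<n}" for j k
      using that mem by (auto simp: z direct_sum_single_def)
  qed (use S i s z in \<open>auto simp: simple_representatives_def\<close>)
  then show "enat n \<le> y i" by simp
qed

text \<open>The definite description in \<open>rmod_dim\<close> has this property once existence and
  uniqueness are known. Below \<open>r\<close> uniqueness is the rank inequality in both directions;
  from \<open>r\<close> on the entries are zero by normalisation.\<close>

lemma rmod_dim_simple_sum:
  assumes R: "semilocal_ring R" and P: "right_module R P" "countably_generated R P"
    and S: "simple_representatives (R Quot jacobson_radical R) r S"
  shows "rmod_iso (R Quot jacobson_radical R) (quot_rmodule R P (jacobson_radical R))
    (simple_sum r S (rmod_dim R r S P))"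
proof -
  let ?J = "jacobson_radical R"
  let ?A = "R Quot ?J" and ?Q = "quot_rmodule R P ?J"
  interpret P: right_module R P by fact
  have J: "ideal ?J R" by (rule P.R.jacobson_radical_ideal)
  have Q: "right_module ?A ?Q" by (rule P.right_module_quot[OF J])
  interpret Q: right_module ?A ?Q by (rule Q)
  obtain E where E: "minimal_generators ?A E"
    using semisimple_ring_minimal_generators R unfolding semilocal_ring_def by blast
  obtain Y where Y: "countable Y" "Y \<subseteq> carrier P" "rmod_span R P Y = carrier P"
    using P(2) by (auto simp: countably_generated_def)
  let ?q = "\<lambda>x. rmod_ideal_mult R P ?J +>\<^bsub>P\<^esub> x"
  have "\<exists>x. (\<forall>i\<ge>r. x i = 0) \<and> rmod_iso ?A ?Q (simple_sum r S x)"
  proof (rule simple_sum_exists[OF Q S E, of "?q ` Y"])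
    show "countable (?q ` Y)" "?q ` Y \<subseteq> carrier ?Q"
      using Y by (auto simp: P.quot_rmodule_carrier[OF J])
    fix N assume N: "submodule N ?A ?Q" and YN: "?q ` Y \<subseteq> N"
    have coset: "?J +>\<^bsub>R\<^esub> a \<in> carrier ?A" if "a \<in> carrier R" for a
      using that by (auto simp: FactRing_def A_RCOSETS_def')
    \<comment> \<open>The preimage of \<open>N\<close> in \<open>P\<close> is an
      \<open>R\<close>-submodule containing the generators \<open>Y\<close>, so the cosets of
      \<open>Y\<close> generate the quotient.\<close>
    have "submodule {x \<in> carrier P. ?q x \<in> N} R P"
      using submodule_zero[OF N] submodule_add[OF N] submodule_smult[OF N coset]
      by (intro P.submoduleI')
        (auto simp: P.quot_zero[OF J] P.quot_add[OF J] P.quot_smult[OF J] P.smult_closed)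
    then have "carrier P \<subseteq> {x \<in> carrier P. ?q x \<in> N}"
      unfolding Y(3)[symmetric] using Y YN by (intro P.span_least) auto
    then show "N = carrier ?Q"
      using submodule_subset[OF N] by (auto simp: P.quot_rmodule_carrier[OF J])
  qed
  then have "\<exists>!x. (\<forall>i\<ge>r. x i = 0) \<and> rmod_iso ?A ?Q (simple_sum r S x)"
  proof (elim ex_ex1I)
    \<comment> \<open>The isomorphism from one sum to the other through \<open>?Q\<close> reaches
      every finite set, so the rank inequality applies.\<close>
    have le: "x i \<le> y i"
      if iso: "rmod_iso ?A ?Q (simple_sum r S x)" "rmod_iso ?A ?Q (simple_sum r S y)" and i: "i < r" for x y i
    proof (rule simple_sum_rank_le[OF S _ i])
      fix Z assume "finite Z" "Z \<subseteq> carrier (simple_sum r S x)"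
      obtain h k where h: "h \<in> rmod_hom ?A ?Q (simple_sum r S x)" "k \<in> rmod_hom ?A (simple_sum r S x) ?Q"
        "\<And>z. z \<in> carrier (simple_sum r S x) \<Longrightarrow> h (k z) = z"
        using rmod_iso_inverse[OF Q iso(1)] by metis
      obtain h' k' where h': "h' \<in> rmod_hom ?A ?Q (simple_sum r S y)" "k' \<in> rmod_hom ?A (simple_sum r S y) ?Q"
        "\<And>z. z \<in> carrier ?Q \<Longrightarrow> k' (h' z) = z"
        using rmod_iso_inverse[OF Q iso(2)] by metis
      have "Z \<subseteq> (\<lambda>z. h (k' z)) ` carrier (simple_sum r S y)"
      proof
        fix z assume "z \<in> Z"
        then have z: "z \<in> carrier (simple_sum r S x)" using \<open>Z \<subseteq> _\<close> by blast
        show "z \<in> (\<lambda>z. h (k' z)) ` carrier (simple_sum r S y)"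
          using h(3)[OF z] h'(3) rmod_hom_closed[OF h(2) z] rmod_hom_closed[OF h'(1)]
          by (intro image_eqI[of _ _ "h' (k z)"]) auto
      qed
      then show "\<exists>g\<in>rmod_hom ?A (simple_sum r S y) (simple_sum r S x). Z \<subseteq> g ` carrier (simple_sum r S y)"
        using rmod_hom_comp[OF h(1) h'(2)] by (intro bexI)
    qed
    fix x y assume xy: "(\<forall>i\<ge>r. x i = 0) \<and> rmod_iso ?A ?Q (simple_sum r S x)"
      "(\<forall>i\<ge>r. y i = 0) \<and> rmod_iso ?A ?Q (simple_sum r S y)"
    show "x = y"
    proof
      fix i show "x i = y i"
        using xy le[of x y i] le[of y x i] by (cases "i < r") auto
    qed
  qed
  from theI'[OF this] show ?thesis unfolding rmod_dim_def by blast
qed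

text \<open>Given finitely many classes in the quotient of \<open>P\<close>, lift them to
  \<open>P\<close> and apply (i) to the submodule they generate. The map induced by
  \<open>\<psi>\<close> on the quotients then hits every given class, at the class of the
  \<open>\<phi>\<close>-image of its lift.\<close>

lemma precsim_rmodule_dim_le:
  assumes R: "semilocal_ring R" and P: "right_module R P" "countably_generated R P"
    and Q: "right_module R Q" "countably_generated R Q"
    and S: "simple_representatives (R Quot jacobson_radical R) r S"
    and le: "precsim_rmodule R P Q" and i: "i < r"
  shows "rmod_dim R r S P i \<le> rmod_dim R r S Q i"
proof (rule simple_sum_rank_le[OF S _ i])
  let ?J = "jacobson_radical R"
  let ?A = "R Quot ?J" and ?P = "quot_rmodule R P ?J" and ?Q = "quot_rmodule R Q ?J"
  let ?x = "rmod_dim R r S P" and ?y = "rmod_dim R r S Q"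
  interpret P: right_module R P by fact
  interpret Q: right_module R Q by fact
  have J: "ideal ?J R" by (rule P.R.jacobson_radical_ideal)
  obtain h k where h: "h \<in> rmod_hom ?A ?P (simple_sum r S ?x)" "k \<in> rmod_hom ?A (simple_sum r S ?x) ?P"
    "\<And>z. z \<in> carrier (simple_sum r S ?x) \<Longrightarrow> h (k z) = z"
    using rmod_iso_inverse[OF P.right_module_quot[OF J] rmod_dim_simple_sum[OF R P S]] by metis
  obtain h' k' where h': "h' \<in> rmod_hom ?A ?Q (simple_sum r S ?y)" "k' \<in> rmod_hom ?A (simple_sum r S ?y) ?Q"
    "\<And>z. z \<in> carrier ?Q \<Longrightarrow> k' (h' z) = z"
    using rmod_iso_inverse[OF Q.right_module_quot[OF J] rmod_dim_simple_sum[OF R Q S]] by metis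
  let ?q = "\<lambda>x. rmod_ideal_mult R P ?J +>\<^bsub>P\<^esub> x" and ?q' = "\<lambda>x. rmod_ideal_mult R Q ?J +>\<^bsub>Q\<^esub> x"
  fix Z assume Z: "finite Z" "Z \<subseteq> carrier (simple_sum r S ?x)"
  have "\<exists>u\<in>carrier P. ?q u = k z" if "z \<in> Z" for z
  proof -
    have "k z \<in> ?q ` carrier P"
      using rmod_hom_closed[OF h(2)] that Z(2) by (auto simp: P.quot_rmodule_carrier[OF J, symmetric])
    then show ?thesis by force
  qed
  then obtain u where u: "\<And>z. z \<in> Z \<Longrightarrow> u z \<in> carrier P" "\<And>z. z \<in> Z \<Longrightarrow> ?q (u z) = k z" by metis
  have "u ` Z \<subseteq> carrier P" using u(1) by auto
  then have "fg_submodule R P (rmod_span R P (u ` Z))"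
    using P.submodule_span Z(1) unfolding fg_submodule_def by blast
  from le[unfolded precsim_rmodule_def, rule_format, OF this] obtain \<phi> \<psi> where \<phi>: "\<phi> \<in> rmod_hom R (P\<lparr>carrier := rmod_span R P (u ` Z)\<rparr>) Q"
    and \<psi>: "\<psi> \<in> rmod_hom R Q P" "\<And>v. v \<in> rmod_span R P (u ` Z) \<Longrightarrow> \<psi> (\<phi> v) = v"
    by auto
  have uZ: "u z \<in> rmod_span R P (u ` Z)" if "z \<in> Z" for z
    using that P.span_superset[of "u ` Z"] by auto
  have \<phi>u: "\<phi> (u z) \<in> carrier Q" if "z \<in> Z" for z
    using rmod_hom_closed[OF \<phi>] uZ[OF that] by simp
  obtain g where g: "g \<in> rmod_hom ?A ?Q ?P" "\<And>v. v \<in> carrier Q \<Longrightarrow> g (?q' v) = ?q (\<psi> v)"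
    using rmod_hom_quot_induced[OF Q(1) P(1) \<psi>(1) J] by blast
  have "Z \<subseteq> (\<lambda>w. h (g (k' w))) ` carrier (simple_sum r S ?y)"
  proof
    fix z assume z: "z \<in> Z"
    have c: "?q' (\<phi> (u z)) \<in> carrier ?Q" using \<phi>u[OF z] by (simp add: Q.quot_rmodule_carrier[OF J])
    have "h (g (k' (h' (?q' (\<phi> (u z)))))) = z"
      using h'(3)[OF c] g(2)[OF \<phi>u[OF z]] \<psi>(2)[OF uZ[OF z]] u(2)[OF z] h(3) z Z(2) by auto
    then show "z \<in> (\<lambda>w. h (g (k' w))) ` carrier (simple_sum r S ?y)"
      using rmod_hom_closed[OF h'(1) c] by (metis image_eqI)
  qed
  then show "\<exists>g\<in>rmod_hom ?A (simple_sum r S ?y) (simple_sum r S ?x). Z \<subseteq> g ` carrier (simple_sum r S ?y)"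
    using rmod_hom_comp[OF h(1) rmod_hom_comp[OF g(1) h'(2)]] by (intro bexI)
qed

text \<open>The order of quantifiers is the point: a single \<open>f\<close> serves all finite sets,
  and only \<open>\<psi>\<close> varies with \<open>Z\<close>. This is what makes the image of
  \<open>f\<close> a pure submodule isomorphic to \<open>P\<close>.\<close>

lemma dim_le_locally_split_hom:
  assumes R: "semilocal_ring R" and P: "projective_rmodule R P" "countably_generated R P"
    and Q: "projective_rmodule R Q" "countably_generated R Q"
    and S: "simple_representatives (R Quot jacobson_radical R) r S"
    and le: "\<forall>i<r. rmod_dim R r S P i \<le> rmod_dim R r S Q i"
  shows "\<exists>f\<in>rmod_hom R P Q. \<forall>Z. finite Z \<longrightarrow> Z \<subseteq> carrier P \<longrightarrow>
    (\<exists>\<psi>\<in>rmod_hom R Q P. \<forall>z\<in>Z. \<psi> (f z) = z)"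
proof -
  let ?J = "jacobson_radical R"
  let ?A = "R Quot ?J" and ?P = "quot_rmodule R P ?J" and ?Q = "quot_rmodule R Q ?J"
  let ?x = "rmod_dim R r S P" and ?y = "rmod_dim R r S Q"
  have P': "right_module R P" and Q': "right_module R Q"
    using P Q by (simp_all add: projective_rmodule_def)
  interpret P: right_module R P by fact
  interpret Q: right_module R Q by fact
  have J: "ideal ?J R" by (rule P.R.jacobson_radical_ideal)
  have A: "ring ?A" by (rule ideal.quotient_is_ring[OF J])
  obtain h k where h: "h \<in> rmod_hom ?A ?P (simple_sum r S ?x)" "k \<in> rmod_hom ?A (simple_sum r S ?x) ?P"
    "\<And>z. z \<in> carrier ?P \<Longrightarrow> k (h z) = z"
    using rmod_iso_inverse[OF P.right_module_quot[OF J] rmod_dim_simple_sum[OF R P' P(2) S]] by metis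
  obtain h' k' where h': "h' \<in> rmod_hom ?A ?Q (simple_sum r S ?y)" "k' \<in> rmod_hom ?A (simple_sum r S ?y) ?Q"
    "\<And>z. z \<in> carrier (simple_sum r S ?y) \<Longrightarrow> h' (k' z) = z"
    using rmod_iso_inverse[OF Q.right_module_quot[OF J] rmod_dim_simple_sum[OF R Q' Q(2) S]] by metis
  let ?I = "\<lambda>x :: nat \<Rightarrow> enat. {(i, k). i < r \<and> enat k < x i}"
  have Srm: "right_module ?A (case p of (i, k) \<Rightarrow> S i)" if "p \<in> ?I ?y" for p
    using S that by (auto simp: simple_representatives_def simple_rmodule_def)
  have sub: "?I ?x \<subseteq> ?I ?y" using le by (auto intro: less_le_trans)
  have "\<exists>m\<in>rmod_hom ?A (simple_sum r S ?x) (simple_sum r S ?y).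
      \<exists>n\<in>rmod_hom ?A (simple_sum r S ?y) (simple_sum r S ?x). \<forall>F\<in>carrier (simple_sum r S ?x). n (m F) = F"
    unfolding simple_sum_def by (rule direct_sum_subset_homs[OF A _ sub]) (rule Srm)
  then obtain m n where m: "m \<in> rmod_hom ?A (simple_sum r S ?x) (simple_sum r S ?y)"
    and n: "n \<in> rmod_hom ?A (simple_sum r S ?y) (simple_sum r S ?x)"
    and nm: "\<And>F. F \<in> carrier (simple_sum r S ?x) \<Longrightarrow> n (m F) = F"
    by (elim bexE) simp
  let ?q = "\<lambda>x. rmod_ideal_mult R P ?J +>\<^bsub>P\<^esub> x" and ?q' = "\<lambda>x. rmod_ideal_mult R Q ?J +>\<^bsub>Q\<^esub> x"
  obtain f where f: "f \<in> rmod_hom R P Q" "\<And>v. v \<in> carrier P \<Longrightarrow> ?q' (f v) = k' (m (h (?q v)))"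
    using projective_lift_quot[OF P(1) Q' J rmod_hom_comp[OF h'(2) rmod_hom_comp[OF m h(1)]]] by blast
  obtain g where g: "g \<in> rmod_hom R Q P" "\<And>v. v \<in> carrier Q \<Longrightarrow> ?q (g v) = k (n (h' (?q' v)))"
    using projective_lift_quot[OF Q(1) P' J rmod_hom_comp[OF h(2) rmod_hom_comp[OF n h'(1)]]] by blast
  \<comment> \<open>The error of \<open>g\<close> as a left inverse of \<open>f\<close>. Both were
    lifted from maps whose composite is the identity, so \<open>d\<close> takes values in
    PJ.\<close>
  define d where "d = (\<lambda>v. g (f v) \<ominus>\<^bsub>P\<^esub> v)"
  have d: "d \<in> rmod_hom R P P"
    unfolding d_def by (intro rmod_hom_pointwise_minus P' rmod_hom_comp[OF g(1) f(1)] rmod_hom_id)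
  have gf: "g (f v) \<in> carrier P" if "v \<in> carrier P" for v
    by (rule rmod_hom_closed[OF rmod_hom_comp[OF g(1) f(1)] that])
  have dJ: "d v \<in> rmod_ideal_mult R P ?J" if v: "v \<in> carrier P" for v
  proof -
    have c: "?q v \<in> carrier ?P" using v by (simp add: P.quot_rmodule_carrier[OF J])
    note hc = rmod_hom_closed[OF h(1) c]
    \<comment> \<open>Modulo the radical the composite is \<open>k n h' k' m h\<close>, and it
      collapses from the inside: \<open>h' k'\<close>, then \<open>n m\<close>, then
      \<open>k h\<close>.\<close>
    have "?q (g (f v)) = ?q v"
      using g(2)[OF rmod_hom_closed[OF f(1) v]] f(2)[OF v] h'(3)[OF rmod_hom_closed[OF m hc]] nm[OF hc] h(3)[OF c]
      by simp
    then show ?thesis unfolding d_def by (rule P.quot_eqD[OF J gf[OF v] v])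
  qed
  have vd: "v \<oplus>\<^bsub>P\<^esub> d v = g (f v)" if v: "v \<in> carrier P" for v
  proof -
    have "v \<oplus>\<^bsub>P\<^esub> d v = (v \<oplus>\<^bsub>P\<^esub> \<ominus>\<^bsub>P\<^esub> v) \<oplus>\<^bsub>P\<^esub> g (f v)"
      using v gf[OF v] unfolding d_def a_minus_def by (simp add: P.M.a_ac)
    then show ?thesis using v gf[OF v] by (simp add: P.M.r_neg)
  qed
  have "\<exists>\<psi>\<in>rmod_hom R Q P. \<forall>z\<in>Z. \<psi> (f z) = z" if Z: "finite Z" "Z \<subseteq> carrier P" for Z
  proof -
    obtain w where w: "w \<in> rmod_hom R P P" "\<forall>z\<in>Z. w (z \<oplus>\<^bsub>P\<^esub> d z) = z"
      using left_inverse_on_finite_set[OF P(1) d dJ Z] by blast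
    have "\<forall>z\<in>Z. w (g (f z)) = z"
    proof
      fix z assume "z \<in> Z"
      then show "w (g (f z)) = z" using w(2) vd[of z] Z(2) by (metis subsetD)
    qed
    then show ?thesis by (intro bexI[OF _ rmod_hom_comp[OF w(1) g(1)]])
  qed
  then show ?thesis using f(1) by blast
qed

text \<open>Splitting on a finite generating set extends to the submodule generated, since the
  elements fixed by \<open>\<psi>\<close> after \<open>f\<close> form a submodule. The map
  \<open>\<phi>\<close> is the restriction of \<open>f\<close>.\<close>

lemma locally_split_precsim:
  assumes P: "right_module R P" and f: "f \<in> rmod_hom R P Q"
    and split: "\<And>Z. finite Z \<Longrightarrow> Z \<subseteq> carrier P \<Longrightarrow> \<exists>\<psi>\<in>rmod_hom R Q P. \<forall>z\<in>Z. \<psi> (f z) = z"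
  shows "precsim_rmodule R P Q"
  unfolding precsim_rmodule_def
proof (intro allI impI)
  interpret P: right_module R P by fact
  fix Y assume "fg_submodule R P Y"
  then obtain Z where Z: "finite Z" "Z \<subseteq> carrier P" "rmod_span R P Z = Y"
    by (auto simp: fg_submodule_def)
  obtain \<psi> where \<psi>: "\<psi> \<in> rmod_hom R Q P" "\<forall>z\<in>Z. \<psi> (f z) = z" using split[OF Z(1,2)] ..
  have "submodule {x \<in> carrier P. \<psi> (f x) = x} R P"
    by (rule submodule_equalizer[OF P P rmod_hom_comp[OF \<psi>(1) f] rmod_hom_id])
  then have Y: "Y \<subseteq> {x \<in> carrier P. \<psi> (f x) = x}"
    unfolding Z(3)[symmetric] using Z(2) \<psi>(2) by (intro P.span_least) auto
  then have "f \<in> rmod_hom R (P\<lparr>carrier := Y\<rparr>) Q"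
    by (intro rmod_homI) (auto intro!: rmod_hom_closed[OF f] rmod_hom_add[OF f] rmod_hom_smult[OF f])
  then show "\<exists>\<phi>\<in>rmod_hom R (P\<lparr>carrier := Y\<rparr>) Q. \<exists>\<psi>\<in>rmod_hom R Q P. \<forall>x\<in>Y. \<psi> (\<phi> x) = x"
    using \<psi>(1) Y by blast
qed

text \<open>Choose \<open>\<psi>\<close> for preimages of the finitely many constants. Then
  \<open>f\<close> after \<open>\<psi>\<close> is an endomorphism of \<open>Q\<close> that fixes the
  constants and has its values in the image of \<open>f\<close>, so it carries a solution in
  \<open>Q\<close> to a solution in the image.\<close>

lemma locally_split_pure:
  assumes P: "right_module R P" and Q: "right_module R Q" and f: "f \<in> rmod_hom R P Q"
    and split: "\<And>Z. finite Z \<Longrightarrow> Z \<subseteq> carrier P \<Longrightarrow> \<exists>\<psi>\<in>rmod_hom R Q P. \<forall>z\<in>Z. \<psi> (f z) = z"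
  shows "pure_submodule R Q (f ` carrier P) \<and> rmod_iso R P (Q\<lparr>carrier := f ` carrier P\<rparr>)"
proof
  interpret P: right_module R P by fact
  interpret Q: right_module R Q by fact
  show "pure_submodule R Q (f ` carrier P)"
    unfolding pure_submodule_def
  proof (intro conjI allI impI)
    show "submodule (f ` carrier P) R Q" by (rule submodule_image[OF P Q f P.submodule_carrier])
    fix m n :: nat and a b
    assume a: "\<forall>j<n. \<forall>i<m. a j i \<in> carrier R" and b: "\<forall>i<m. b i \<in> f ` carrier P"
      and "\<exists>x. (\<forall>j<n. x j \<in> carrier Q) \<and> (\<forall>i<m. (\<Oplus>\<^bsub>Q\<^esub>j\<in>{..<n}. a j i \<odot>\<^bsub>Q\<^esub> x j) = b i)"
    then obtain x where x: "\<And>j. j < n \<Longrightarrow> x j \<in> carrier Q"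
      "\<And>i. i < m \<Longrightarrow> (\<Oplus>\<^bsub>Q\<^esub>j\<in>{..<n}. a j i \<odot>\<^bsub>Q\<^esub> x j) = b i" by blast
    have "\<forall>i\<in>{..<m}. \<exists>c. c \<in> carrier P \<and> b i = f c" using b by blast
    then obtain c where c: "\<And>i. i < m \<Longrightarrow> c i \<in> carrier P" "\<And>i. i < m \<Longrightarrow> b i = f (c i)"
      by (metis lessThan_iff)
    have "c ` {..<m} \<subseteq> carrier P" using c(1) by auto
    then obtain \<psi> where \<psi>: "\<psi> \<in> rmod_hom R Q P" "\<And>i. i < m \<Longrightarrow> \<psi> (f (c i)) = c i"
      using split[of "c ` {..<m}"] by auto
    have h: "(\<lambda>v. f (\<psi> v)) \<in> rmod_hom R Q Q" by (rule rmod_hom_comp[OF f \<psi>(1)])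
    have "(\<Oplus>\<^bsub>Q\<^esub>j\<in>{..<n}. a j i \<odot>\<^bsub>Q\<^esub> f (\<psi> (x j))) = b i" if i: "i < m" for i
    proof -
      have "(\<Oplus>\<^bsub>Q\<^esub>j\<in>{..<n}. a j i \<odot>\<^bsub>Q\<^esub> f (\<psi> (x j))) = (\<Oplus>\<^bsub>Q\<^esub>j\<in>{..<n}. f (\<psi> (a j i \<odot>\<^bsub>Q\<^esub> x j)))"
        using a i x(1) rmod_hom_closed[OF h]
        by (intro Q.M.finsum_cong') (auto simp: rmod_hom_smult[OF h] Q.smult_closed)
      also have "\<dots> = f (\<psi> (b i))"
        unfolding x(2)[OF i, symmetric]
        by (rule rmod_hom_finsum[OF Q Q h, symmetric]) (use a i x(1) Q.smult_closed in auto)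
      finally show ?thesis using c \<psi>(2) i by simp
    qed
    then show "\<exists>y. (\<forall>j<n. y j \<in> f ` carrier P) \<and> (\<forall>i<m. (\<Oplus>\<^bsub>Q\<^esub>j\<in>{..<n}. a j i \<odot>\<^bsub>Q\<^esub> y j) = b i)"
      using rmod_hom_closed[OF \<psi>(1)] x(1) by (intro exI[of _ "\<lambda>j. f (\<psi> (x j))"]) auto
  qed
  have "inj_on f (carrier P)"
  \<comment> \<open>A splitting on the two-element set {u, v} separates \<open>u\<close> and
    \<open>v\<close>.\<close>
  proof (rule inj_onI)
    fix u v assume "u \<in> carrier P" "v \<in> carrier P" "f u = f v"
    then show "u = v" using split[of "{u, v}"] by auto
  qed
  moreover have "f \<in> rmod_hom R P (Q\<lparr>carrier := f ` carrier P\<rparr>)"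
    by (rule rmod_homI) (auto simp: rmod_hom_add[OF f] rmod_hom_smult[OF f])
  ultimately show "rmod_iso R P (Q\<lparr>carrier := f ` carrier P\<rparr>)"
    unfolding rmod_iso_def by (intro bexI[of _ f]) (auto simp: bij_betw_def)
qed

text \<open>The isomorphism onto \<open>N\<close>, read as a map to \<open>Q\<close>, is split on
  each finite set: an endomorphism \<open>\<theta>\<close> of \<open>Q\<close> with image in
  \<open>N\<close> that fixes the image of the set is followed by the inverse isomorphism.\<close>

lemma pure_iso_precsim:
  assumes P: "right_module R P" and Q: "projective_rmodule R Q" and N: "pure_submodule R Q N"
    and iso: "rmod_iso R P (Q\<lparr>carrier := N\<rparr>)"
  shows "precsim_rmodule R P Q"
proof -
  obtain h k where h: "h \<in> rmod_hom R P (Q\<lparr>carrier := N\<rparr>)" and k: "k \<in> rmod_hom R (Q\<lparr>carrier := N\<rparr>) P"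
    and kh: "\<And>x. x \<in> carrier P \<Longrightarrow> k (h x) = x"
    using rmod_iso_inverse[OF P iso] by metis
  have NQ: "N \<subseteq> carrier Q" using N submodule_subset by (auto simp: pure_submodule_def)
  have hN: "h x \<in> N" if "x \<in> carrier P" for x using rmod_hom_closed[OF h that] by simp
  have hQ: "h \<in> rmod_hom R P Q"
    using hN NQ rmod_hom_add[OF h] rmod_hom_smult[OF h] by (intro rmod_homI) auto
  show ?thesis
  proof (rule locally_split_precsim[OF P hQ])
    fix Z assume Z: "finite Z" "Z \<subseteq> carrier P"
    have "h ` Z \<subseteq> N" using hN Z(2) by auto
    then obtain \<theta> where \<theta>: "\<theta> \<in> rmod_hom R Q Q" "\<theta> ` carrier Q \<subseteq> N" "\<forall>x\<in>h ` Z. \<theta> x = x"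
      using pure_submodule_retraction[OF Q N, of "h ` Z"] Z(1) by auto
    \<comment> \<open>The codomain is narrowed to \<open>N\<close>, since \<open>k\<close> is a
      homomorphism on \<open>N\<close> only.\<close>
    have "\<theta> \<in> rmod_hom R Q (Q\<lparr>carrier := N\<rparr>)"
      using \<theta>(2) by (intro rmod_homI) (auto simp: rmod_hom_add[OF \<theta>(1)] rmod_hom_smult[OF \<theta>(1)])
    from rmod_hom_comp[OF k this] have "(\<lambda>x. k (\<theta> x)) \<in> rmod_hom R Q P" .
    moreover have "\<forall>z\<in>Z. k (\<theta> (h z)) = z" using \<theta>(3) kh Z(2) by auto
    ultimately show "\<exists>\<psi>\<in>rmod_hom R Q P. \<forall>z\<in>Z. \<psi> (h z) = z" by (intro bexI)
  qed
qed

theorem proposition6p13: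
  fixes R :: "('a, 'k) ring_scheme"
    and P :: "('a, 'p, 'm) module_scheme"
    and Q :: "('a, 'q, 'n) module_scheme"
    and r :: nat
    and S :: "nat \<Rightarrow> ('a set, 's) module"
  assumes semilocal: "semilocal_ring R"
    and P: "projective_rmodule R P" "countably_generated R P"
    and Q: "projective_rmodule R Q" "countably_generated R Q"
    and S: "simple_representatives (R Quot jacobson_radical R) r S"
  shows "(precsim_rmodule R P Q \<longleftrightarrow> (\<forall>i<r. rmod_dim R r S P i \<le> rmod_dim R r S Q i)) \<and>
    ((\<forall>i<r. rmod_dim R r S P i \<le> rmod_dim R r S Q i) \<longleftrightarrow>
      (\<exists>N. pure_submodule R Q N \<and> rmod_iso R P (Q\<lparr>carrier := N\<rparr>)))"
proof -
  have P': "right_module R P" and Q': "right_module R Q"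
    using P Q by (simp_all add: projective_rmodule_def)
  have dim: "\<forall>i<r. rmod_dim R r S P i \<le> rmod_dim R r S Q i" if "precsim_rmodule R P Q"
    using precsim_rmodule_dim_le[OF semilocal P' P(2) Q' Q(2) S that] by blast
  have split: "precsim_rmodule R P Q \<and> (\<exists>N. pure_submodule R Q N \<and> rmod_iso R P (Q\<lparr>carrier := N\<rparr>))"
    if le: "\<forall>i<r. rmod_dim R r S P i \<le> rmod_dim R r S Q i"
  proof -
    obtain f where f: "f \<in> rmod_hom R P Q"
      and f_split: "\<And>Z. finite Z \<Longrightarrow> Z \<subseteq> carrier P \<Longrightarrow> \<exists>\<psi>\<in>rmod_hom R Q P. \<forall>z\<in>Z. \<psi> (f z) = z"
      using dim_le_locally_split_hom[OF semilocal P Q S le] by blast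
    show ?thesis
      using locally_split_precsim[OF P' f f_split] locally_split_pure[OF P' Q' f f_split] by blast
  qed
  have "precsim_rmodule R P Q" if "\<exists>N. pure_submodule R Q N \<and> rmod_iso R P (Q\<lparr>carrier := N\<rparr>)"
    using that pure_iso_precsim[OF P' Q(1)] by blast
  then show ?thesis using dim split by blast
qed

end
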